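(* Let $K$ be a field. For each $k\geq2$, there exists a squarefree monomial ideal $I$ in some polynomial ring $S=K[x_1,\dots,x_n]$ with $\operatorname{ht} I=2$ such that $$\operatorname{depth} S/I^{(k)}<\operatorname{depth} S/I^{k}.$$
   Context: For a squarefree monomial ideal $I$ of a polynomial ring $S=K[x_1,\dots,x_n]$, the $k$-th symbolic power is $I^{(k)}=\bigcap_{P\in\operatorname{Min}(I)}P^k$, where $\operatorname{Min}(I)$ is the set of minimal primes of $I$; $I^k$ is the ordinary power. $\operatorname{ht}$ denotes height, and $\operatorname{depth}$ is taken with respect to the homogeneous maximal ideal $(x_1,\dots,x_n)$. *)

theory Defs
  imports
    "HOL-Library.Poly_Mapping"
    "HOL-Library.Extended_Nat"
    "HOL-Algebra.Module"
    "HOL-Algebra.QuotRing"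
    "HOL-Algebra.Ideal_Product"
begin

section \<open>Polynomial rings\<close>

text \<open>
  Polynomials over \<open>'k\<close> are finitely supported functions from exponent vectors to coefficients,
  with the library's convolution product. The type has infinitely many variables; the ring
  \<open>K[x\<^sub>1,\<dots>,x\<^sub>n]\<close> is carved out by a carrier set, so that \<open>n\<close> may be
  quantified inside a formula. Variables are numbered \<open>0,\<dots>,n-1\<close>.
\<close>

type_synonym 'k mpoly = "(nat \<Rightarrow>\<^sub>0 nat) \<Rightarrow>\<^sub>0 'k"

definition mpoly_ring :: "nat \<Rightarrow> 'k::field mpoly ring" where
  "mpoly_ring n =
    \<lparr>carrier = {p. \<forall>e\<in>Poly_Mapping.keys p. Poly_Mapping.keys e \<subseteq> {..<n}},
     mult = (*), one = 1, zero = 0, add = (+)\<rparr>"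

definition monomial :: "(nat \<Rightarrow>\<^sub>0 nat) \<Rightarrow> 'k::field mpoly" where
  "monomial e = Poly_Mapping.single e 1"

definition variable :: "nat \<Rightarrow> 'k::field mpoly" where
  "variable i = monomial (Poly_Mapping.single i 1)"

definition homogeneous_maximal_ideal :: "nat \<Rightarrow> 'k::field mpoly set" where
  "homogeneous_maximal_ideal n = Idl\<^bsub>mpoly_ring n\<^esub> (variable ` {..<n})"

definition squarefree_monomials :: "nat \<Rightarrow> 'k::field mpoly set" where
  "squarefree_monomials n =
    monomial ` {e. Poly_Mapping.keys e \<subseteq> {..<n} \<and> (\<forall>i. Poly_Mapping.lookup e i \<le> 1)}"

definition squarefree_monomial_ideal :: "nat \<Rightarrow> 'k::field mpoly set \<Rightarrow> bool" where
  "squarefree_monomial_ideal n I \<longleftrightarrow>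
    (\<exists>A\<subseteq>squarefree_monomials n. I = Idl\<^bsub>mpoly_ring n\<^esub> A)"

lemma monomial_in_carrier:
  "Poly_Mapping.keys e \<subseteq> {..<n} \<Longrightarrow> monomial e \<in> carrier (mpoly_ring n)"
  by (auto simp: mpoly_ring_def monomial_def)

lemma mult_in_carrier:
  assumes "p \<in> carrier (mpoly_ring n)" "q \<in> carrier (mpoly_ring n)"
  shows "p * q \<in> carrier (mpoly_ring n)"
proof -
  have "Poly_Mapping.keys e \<subseteq> {..<n}" if e: "e \<in> Poly_Mapping.keys (p * q)" for e
  proof -
    obtain a b where ab: "e = a + b" "a \<in> Poly_Mapping.keys p" "b \<in> Poly_Mapping.keys q"
      using keys_mult[of p q] e by blast
    then show ?thesis
      using assms Poly_Mapping.keys_add[of a b] by (fastforce simp: mpoly_ring_def)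
  qed
  then show ?thesis by (simp add: mpoly_ring_def)
qed

lemma mpoly_ring_cring: "cring (mpoly_ring n :: 'k::field mpoly ring)"
proof (intro cringI abelian_groupI comm_monoidI)
  fix x y :: "'k mpoly"
  assume x: "x \<in> carrier (mpoly_ring n)"
  then show "\<exists>y\<in>carrier (mpoly_ring n). y \<oplus>\<^bsub>mpoly_ring n\<^esub> x = \<zero>\<^bsub>mpoly_ring n\<^esub>"
    by (intro bexI[of _ "- x"]) (auto simp: mpoly_ring_def)
  assume y: "y \<in> carrier (mpoly_ring n)"
  show "x \<oplus>\<^bsub>mpoly_ring n\<^esub> y \<in> carrier (mpoly_ring n)"
    using x y Poly_Mapping.keys_add[of x y] by (fastforce simp: mpoly_ring_def)
  show "x \<otimes>\<^bsub>mpoly_ring n\<^esub> y \<in> carrier (mpoly_ring n)"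
    using mult_in_carrier[OF x y] by (simp add: mpoly_ring_def)
qed (auto simp: mpoly_ring_def algebra_simps)

section \<open>Symbolic powers and height\<close>

definition minimal_primes :: "('a, 'b) ring_scheme \<Rightarrow> 'a set \<Rightarrow> 'a set set" where
  "minimal_primes R I =
    {P. primeideal P R \<and> I \<subseteq> P \<and>
        (\<forall>Q. primeideal Q R \<longrightarrow> I \<subseteq> Q \<longrightarrow> Q \<subseteq> P \<longrightarrow> Q = P)}"

text \<open>The power in the monoid of ideals under the product of ideals; in particular \<open>I\<^sup>0 = R\<close>.\<close>

definition ideal_power :: "('a, 'b) ring_scheme \<Rightarrow> 'a set \<Rightarrow> nat \<Rightarrow> 'a set" where
  "ideal_power R I k = I [^]\<^bsub>ideals_set R\<^esub> k"

lemma ideal_power_simps: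
  "ideal_power R I 0 = carrier R"
  "ideal_power R I (Suc k) = ideal_prod R (ideal_power R I k) I"
  by (simp_all add: ideal_power_def ideals_set_def nat_pow_def)

text \<open>
  This is the notion of symbolic power for radical ideals, such as squarefree monomial ideals.
  Intersecting with the carrier only matters if there are no minimal primes, that is, for the
  unit ideal.
\<close>

definition symbolic_power :: "('a, 'b) ring_scheme \<Rightarrow> 'a set \<Rightarrow> nat \<Rightarrow> 'a set" where
  "symbolic_power R I k = carrier R \<inter> (\<Inter>P\<in>minimal_primes R I. ideal_power R P k)"

definition prime_height :: "('a, 'b) ring_scheme \<Rightarrow> 'a set \<Rightarrow> enat" where
  "prime_height R P =
    Sup {enat r | r. \<exists>Q :: nat \<Rightarrow> 'a set.
           (\<forall>i\<le>r. primeideal (Q i) R) \<and> (\<forall>i<r. Q i \<subset> Q (Suc i)) \<and> Q r = P}"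

definition ideal_height :: "('a, 'b) ring_scheme \<Rightarrow> 'a set \<Rightarrow> enat" where
  "ideal_height R I = Inf (prime_height R ` {P. primeideal P R \<and> I \<subseteq> P})"

section \<open>Depth\<close>

text \<open>The submodule \<open>A M\<close> generated by all products of an element of \<open>A\<close> and one of \<open>M\<close>.\<close>

definition set_times_module ::
    "('a, 'c) ring_scheme \<Rightarrow> 'a set \<Rightarrow> ('a, 'b, 'd) module_scheme \<Rightarrow> 'b set" where
  "set_times_module R A M =
    \<Inter>{N. submodule N R M \<and> (\<forall>a\<in>A. \<forall>x\<in>carrier M. a \<odot>\<^bsub>M\<^esub> x \<in> N)}"

text \<open>
  The sequence \<open>f\<^sub>1,\<dots>,f\<^sub>r\<close> is \<open>M\<close>-regular if each \<open>f\<^sub>i\<close> is a nonzerodivisor on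
  \<open>M/(f\<^sub>1,\<dots>,f\<^sub>i\<^sub>-\<^sub>1)M\<close>, stated here for representatives in \<open>M\<close>, and
  \<open>M \<noteq> (f\<^sub>1,\<dots>,f\<^sub>r)M\<close>.
\<close>

definition regular_sequence ::
    "('a, 'c) ring_scheme \<Rightarrow> ('a, 'b, 'd) module_scheme \<Rightarrow> 'a list \<Rightarrow> bool" where
  "regular_sequence R M fs \<longleftrightarrow>
    set fs \<subseteq> carrier R \<and>
    (\<forall>i<length fs. \<forall>x\<in>carrier M.
       (fs ! i) \<odot>\<^bsub>M\<^esub> x \<in> set_times_module R (set (take i fs)) M \<longrightarrow>
       x \<in> set_times_module R (set (take i fs)) M) \<and>
    set_times_module R (set fs) M \<noteq> carrier M"

text \<open>
  The depth of \<open>M\<close> with respect to the ideal \<open>I\<close>, with the usual convention that it is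
  \<open>\<infinity>\<close> if \<open>I M = M\<close>.
\<close>

definition depth ::
    "('a, 'c) ring_scheme \<Rightarrow> 'a set \<Rightarrow> ('a, 'b, 'd) module_scheme \<Rightarrow> enat" where
  "depth R I M =
    (if set_times_module R I M = carrier M then \<infinity>
     else Sup {enat (length fs) | fs. set fs \<subseteq> I \<and> regular_sequence R M fs})"

text \<open>The factor ring \<open>R/J\<close> regarded as an \<open>R\<close>-module.\<close>

definition quotient_module ::
    "('a, 'c) ring_scheme \<Rightarrow> 'a set \<Rightarrow> ('a, 'a set) module" where
  "quotient_module R J =
    \<lparr>carrier = carrier (R Quot J), mult = mult (R Quot J), one = one (R Quot J),
     zero = zero (R Quot J), add = add (R Quot J),
     smult = (\<lambda>r X. (J +>\<^bsub>R\<^esub> r) \<otimes>\<^bsub>R Quot J\<^esub> X)\<rparr>"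

lemma quotient_module_is_module:
  assumes "cring R" and "ideal J R"
  shows "module R (quotient_module R J)"
proof -
  interpret R: cring R by fact
  interpret J: ideal J R by fact
  interpret Q: cring "R Quot J"
    using J.quotient_is_cring[OF assms(1)] .
  interpret h: ring_hom_ring R "R Quot J" "(+>\<^bsub>R\<^esub>) J"
    by (rule J.rcos_ring_hom_ring)
  show ?thesis
  proof (rule moduleI)
    show "abelian_group (quotient_module R J)"
    proof (rule abelian_groupI)
      fix X assume "X \<in> carrier (quotient_module R J)"
      then show "\<exists>Y\<in>carrier (quotient_module R J).
          Y \<oplus>\<^bsub>quotient_module R J\<^esub> X = \<zero>\<^bsub>quotient_module R J\<^esub>"
        using Q.a_inv_closed Q.l_neg by (auto simp: quotient_module_def)
    qed (simp_all add: quotient_module_def Q.a_ac)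
  qed (auto simp: quotient_module_def assms(1) Q.l_distr Q.r_distr Q.m_assoc h.hom_add h.hom_mult)
qed

end

theory Submission
  imports Defs
begin

text \<open>
  Let \<open>m = k + 1\<close>, let \<open>S\<close> be the polynomial ring in \<open>2m\<close> variables \<open>x\<^sub>0, \<dots>, x\<^sub>m\<^sub>-\<^sub>1, y\<^sub>0, \<dots>, y\<^sub>m\<^sub>-\<^sub>1\<close>, and
  let \<open>I\<close> be generated by \<open>x\<^sub>0 \<dots> x\<^sub>m\<^sub>-\<^sub>1\<close> and by the \<open>m\<close> monomials that arise from it when one \<open>x\<^sub>i\<close> is
  replaced by \<open>y\<^sub>i\<close>. Its minimal primes are \<open>(x\<^sub>i, y\<^sub>i)\<close> and \<open>(x\<^sub>i, x\<^sub>j)\<close> for \<open>i \<noteq> j\<close>, so it has height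
  two. The two depths differ because \<open>S/I\<^bsup>(k)\<^esup>\<close> has depth less than \<open>m\<close>, while \<open>S/I\<^sup>k\<close> has depth
  at least \<open>m\<close>.

  The symbolic power: put \<open>F = (x\<^sub>0 \<dots> x\<^sub>m\<^sub>-\<^sub>1)\<^bsup>k-1\<^esup>\<close>. As \<open>2(k - 1) \<ge> k\<close>, this lies in the \<open>k\<close>-th power
  of every \<open>(x\<^sub>i, x\<^sub>j)\<close>, and it misses the \<open>k\<close>-th power of every \<open>(x\<^sub>i, y\<^sub>i)\<close> by one factor. Hence
  \<open>I\<^bsup>(k)\<^esup> : F\<close> is the intersection of the \<open>m\<close> primes \<open>(x\<^sub>i, y\<^sub>i)\<close> in disjoint sets of variables,
  whose factor ring has projective dimension \<open>m + 1\<close>. In terms of the Koszul complex of all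
  variables, there is an explicit cycle of degree \<open>m + 1\<close> with coefficients in \<open>S/I\<^bsup>(k)\<^esup>\<close> that is not a
  boundary; if it were one, \<open>F y\<^sub>0 \<dots> y\<^sub>m\<^sub>-\<^sub>1\<close> would lie in \<open>(y\<^sub>0, \<dots>, y\<^sub>m\<^sub>-\<^sub>1) I\<^bsup>(k)\<^esup>\<close>
  (\<open>koszul_exact_imp_member\<close>). A regular sequence of length \<open>m\<close> would force the Koszul homology to
  vanish in this degree (\<open>koszul_exact_of_regular_sequence\<close>).

  The ordinary power: a monomial with exponents \<open>u\<^sub>i\<close> of \<open>x\<^sub>i\<close> and \<open>v\<^sub>i\<close> of \<open>y\<^sub>i\<close> lies in \<open>I\<^sup>k\<close> if and only
  if \<open>u\<^sub>i + v\<^sub>i \<ge> k\<close> for all \<open>i\<close> and \<open>\<Sum> max(0, k - u\<^sub>i) \<le> k\<close> (\<open>ideal_power_example_ideal\<close>). The second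
  condition, which the symbolic power relaxes to \<open>u\<^sub>i + u\<^sub>j \<ge> k\<close> for \<open>i \<noteq> j\<close>, only involves the \<open>x\<^sub>i\<close>. So no associated prime of \<open>I\<^sup>k\<close>
  contains two of the \<open>y\<^sub>i\<close>, and this persists when the \<open>y\<^sub>i\<close> are identified with each other one after
  the other. Once all are identified, no associated prime contains all the remaining variables, because
  at most \<open>k < m\<close> of the summands can be positive. This gives a regular sequence of \<open>m - 1\<close>
  differences \<open>y\<^sub>0 - y\<^sub>j\<close> and one linear form in all remaining variables (\<open>depth_ideal_power_ge\<close>).

  The height: that \<open>(x\<^sub>0, y\<^sub>0)\<close> has height at most two follows from the fact that a prime chain in a
  polynomial ring in \<open>n\<close> variables has length at most \<open>n\<close> (\<open>prime_chain_length_le\<close>). Elements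
  that witness the strict inclusions of a chain are algebraically independent, whereas any \<open>n + 1\<close>
  polynomials are algebraically dependent, by a count of monomials.
\<close>

section \<open>Regular sequences on factor rings\<close>

text \<open>
  Every ideal between \<open>J\<close> and \<open>R\<close> is the preimage of a submodule of \<open>R/J\<close>, and conversely. So
  regularity on \<open>R/J\<close> can be tested on elements of \<open>R\<close>, modulo the ideals \<open>J + (f\<^sub>1,\<dots>,f\<^sub>i)\<close>, and
  no cosets occur after this section.
\<close>

lemma mem_set_times_quotient_module_iff:
  assumes "cring R" "ideal J R" "A \<subseteq> carrier R" "p \<in> carrier R"
  shows "J +>\<^bsub>R\<^esub> p \<in> set_times_module R A (quotient_module R J)
    \<longleftrightarrow> p \<in> Idl\<^bsub>R\<^esub> (J \<union> A)"
proof -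
  interpret R: cring R by fact
  interpret J: ideal J R by fact
  define M where "M = quotient_module R J"
  interpret M: module R M
    unfolding M_def by (rule quotient_module_is_module) fact+
  have JA: "J \<union> A \<subseteq> carrier R"
    using assms(3) J.Icarr by auto
  interpret JA: ideal "Idl\<^bsub>R\<^esub> (J \<union> A)" R
    by (rule R.genideal_ideal[OF JA])
  have gen: "J \<subseteq> Idl\<^bsub>R\<^esub> (J \<union> A)" "A \<subseteq> Idl\<^bsub>R\<^esub> (J \<union> A)"
    using R.genideal_self[OF JA] by auto
  let ?c = "\<lambda>q. J +>\<^bsub>R\<^esub> q"
  have carM: "X \<in> carrier M \<longleftrightarrow> (\<exists>q\<in>carrier R. X = ?c q)" for X
    by (auto simp: M_def quotient_module_def FactRing_def A_RCOSETS_def' a_r_coset_def')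
  have addM: "?c q \<oplus>\<^bsub>M\<^esub> ?c r = ?c (q \<oplus>\<^bsub>R\<^esub> r)" if "q \<in> carrier R" "r \<in> carrier R" for q r
    using ring_hom_add[OF J.rcos_ring_hom that] by (simp add: M_def quotient_module_def)
  have smulM: "q \<odot>\<^bsub>M\<^esub> ?c r = ?c (q \<otimes>\<^bsub>R\<^esub> r)" if "q \<in> carrier R" "r \<in> carrier R" for q r
    using ring_hom_mult[OF J.rcos_ring_hom that] by (simp add: M_def quotient_module_def)
  have zeroM: "\<zero>\<^bsub>M\<^esub> = ?c \<zero>\<^bsub>R\<^esub>"
    using R.a_rcos_zero[OF assms(2) J.zero_closed] by (simp add: M_def quotient_module_def FactRing_def)
  have invM: "\<ominus>\<^bsub>M\<^esub> ?c q = ?c (\<ominus>\<^bsub>R\<^esub> q)" if "q \<in> carrier R" for q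
  proof (rule M.M.minus_equality)
    show "?c (\<ominus>\<^bsub>R\<^esub> q) \<oplus>\<^bsub>M\<^esub> ?c q = \<zero>\<^bsub>M\<^esub>"
      using addM[of "\<ominus>\<^bsub>R\<^esub> q" q] that R.l_neg[OF that] by (simp only: zeroM R.a_inv_closed)
  qed (use that carM R.a_inv_closed in blast)+
  show ?thesis
    unfolding M_def[symmetric]
  proof
    assume p: "?c p \<in> set_times_module R A M"
    define N where "N = ?c ` (Idl\<^bsub>R\<^esub> (J \<union> A))"
    have "submodule N R M"
    proof (rule M.submoduleI)
      show "N \<subseteq> carrier M"
      proof
        fix X assume "X \<in> N"
        then obtain q where "q \<in> Idl\<^bsub>R\<^esub> (J \<union> A)" "X = ?c q"
          by (auto simp: N_def)
        then show "X \<in> carrier M"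
          using JA.Icarr[of q] unfolding carM by blast
      qed
      show "\<zero>\<^bsub>M\<^esub> \<in> N"
        using JA.zero_closed by (auto simp: N_def zeroM)
      show "\<ominus>\<^bsub>M\<^esub> X \<in> N" if "X \<in> N" for X
        using that JA.a_inv_closed JA.Icarr by (auto simp: N_def invM)
      show "X \<oplus>\<^bsub>M\<^esub> Y \<in> N" if "X \<in> N" "Y \<in> N" for X Y
        using that JA.a_closed JA.Icarr by (auto simp: N_def addM)
      show "a \<odot>\<^bsub>M\<^esub> X \<in> N" if "a \<in> carrier R" "X \<in> N" for a X
        using that JA.I_l_closed JA.Icarr by (auto simp: N_def smulM)
    qed
    moreover have "a \<odot>\<^bsub>M\<^esub> X \<in> N" if aX: "a \<in> A" "X \<in> carrier M" for a X
    proof -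
      obtain q where q: "q \<in> carrier R" "X = ?c q"
        using aX(2) carM by auto
      have "a \<otimes>\<^bsub>R\<^esub> q \<in> Idl\<^bsub>R\<^esub> (J \<union> A)"
        using aX(1) gen(2) q(1) JA.I_r_closed by blast
      then show ?thesis
        using aX(1) assms(3) q by (auto simp: N_def smulM)
    qed
    ultimately have "?c p \<in> N"
      using p unfolding set_times_module_def by blast
    then obtain q where q: "q \<in> Idl\<^bsub>R\<^esub> (J \<union> A)" "?c p = ?c q"
      by (auto simp: N_def)
    have qR: "q \<in> carrier R"
      using q(1) JA.Icarr by blast
    have "p \<ominus>\<^bsub>R\<^esub> q \<in> J"
      using R.quotient_eq_iff_same_a_r_cos[OF assms(2,4) qR] q(2) by simp
    then have "(p \<ominus>\<^bsub>R\<^esub> q) \<oplus>\<^bsub>R\<^esub> q \<in> Idl\<^bsub>R\<^esub> (J \<union> A)"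
      using gen(1) q(1) by (blast intro: JA.a_closed)
    then show "p \<in> Idl\<^bsub>R\<^esub> (J \<union> A)"
      using assms(4) qR by (simp add: R.minus_eq R.a_assoc R.l_neg)
  next
    assume p: "p \<in> Idl\<^bsub>R\<^esub> (J \<union> A)"
    have "?c p \<in> N"
      if N: "submodule N R M" and AN: "\<forall>a\<in>A. \<forall>X\<in>carrier M. a \<odot>\<^bsub>M\<^esub> X \<in> N" for N
    proof -
      note N' = M.submoduleE[OF N]
      define I where "I = {q \<in> carrier R. ?c q \<in> N}"
      have zN: "\<zero>\<^bsub>M\<^esub> \<in> N"
        using subgroup.one_closed[OF submodule.axioms(1)[OF N]] by simp
      have "ideal I R"
      proof (rule idealI)
        show "subgroup I (add_monoid R)"
        proof (rule R.add.subgroupI)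
          show "I \<noteq> {}" using zN by (auto simp: I_def zeroM)
          show "\<ominus>\<^bsub>R\<^esub> a \<in> I" if "a \<in> I" for a
            using that N'(3)[of "?c a"] by (simp add: I_def invM)
          show "a \<oplus>\<^bsub>R\<^esub> b \<in> I" if "a \<in> I" "b \<in> I" for a b
            using that N'(5)[of "?c a" "?c b"] by (simp add: I_def addM)
        qed (auto simp: I_def)
        show l: "x \<otimes>\<^bsub>R\<^esub> a \<in> I" if "a \<in> I" "x \<in> carrier R" for a x
          using that N'(4)[of x "?c a"] by (simp add: I_def smulM)
        show "a \<otimes>\<^bsub>R\<^esub> x \<in> I" if "a \<in> I" "x \<in> carrier R" for a x
          using that l[OF that] R.m_comm[of a x] by (simp add: I_def)
      qed (rule R.ring_axioms)
      moreover have "J \<subseteq> I"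
      proof
        fix j assume j: "j \<in> J"
        then have "?c j = \<zero>\<^bsub>M\<^esub>"
          using R.a_rcos_zero[OF assms(2)] by (simp add: M_def quotient_module_def FactRing_def)
        then show "j \<in> I" using zN j J.Icarr by (simp add: I_def)
      qed
      moreover have "A \<subseteq> I"
      proof
        fix a assume a: "a \<in> A"
        then have "a \<odot>\<^bsub>M\<^esub> ?c \<one>\<^bsub>R\<^esub> \<in> N"
          using AN carM R.one_closed by blast
        then show "a \<in> I" using a assms(3) by (auto simp: I_def smulM)
      qed
      ultimately have "Idl\<^bsub>R\<^esub> (J \<union> A) \<subseteq> I"
        by (intro R.genideal_minimal) auto
      then show ?thesis using p by (auto simp: I_def)
    qed
    then show "?c p \<in> set_times_module R A M"
      by (auto simp: set_times_module_def)
  qed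
qed

lemma set_times_quotient_module_eq_carrier_iff:
  assumes "cring R" "ideal J R" "A \<subseteq> carrier R"
  shows "set_times_module R A (quotient_module R J) = carrier (quotient_module R J)
    \<longleftrightarrow> \<one>\<^bsub>R\<^esub> \<in> Idl\<^bsub>R\<^esub> (J \<union> A)"
proof -
  interpret R: cring R by fact
  interpret J: ideal J R by fact
  interpret M: module R "quotient_module R J"
    by (rule quotient_module_is_module) fact+
  have JA: "J \<union> A \<subseteq> carrier R"
    using assms(3) J.Icarr by auto
  interpret JA: ideal "Idl\<^bsub>R\<^esub> (J \<union> A)" R
    by (rule R.genideal_ideal[OF JA])
  have carM: "carrier (quotient_module R J) = (\<lambda>q. J +>\<^bsub>R\<^esub> q) ` carrier R"
    by (auto simp: quotient_module_def FactRing_def A_RCOSETS_def' a_r_coset_def')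
  note mem = mem_set_times_quotient_module_iff[OF assms]
  have sub: "set_times_module R A (quotient_module R J) \<subseteq> carrier (quotient_module R J)"
    using M.carrier_is_submodule assms(3) by (auto simp: set_times_module_def)
  show ?thesis
  proof
    assume "set_times_module R A (quotient_module R J) = carrier (quotient_module R J)"
    then show "\<one>\<^bsub>R\<^esub> \<in> Idl\<^bsub>R\<^esub> (J \<union> A)"
      using mem[of "\<one>\<^bsub>R\<^esub>"] carM by auto
  next
    assume "\<one>\<^bsub>R\<^esub> \<in> Idl\<^bsub>R\<^esub> (J \<union> A)"
    then have "Idl\<^bsub>R\<^esub> (J \<union> A) = carrier R"
      by (rule JA.one_imp_carrier)
    then show "set_times_module R A (quotient_module R J) = carrier (quotient_module R J)"
      using sub mem carM by auto
  qed
qed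

lemma regular_sequence_quotient_module_iff:
  assumes "cring R" "ideal J R"
  shows "regular_sequence R (quotient_module R J) fs \<longleftrightarrow>
    set fs \<subseteq> carrier R \<and>
    (\<forall>i<length fs. \<forall>p\<in>carrier R.
       (fs ! i) \<otimes>\<^bsub>R\<^esub> p \<in> Idl\<^bsub>R\<^esub> (J \<union> set (take i fs)) \<longrightarrow>
       p \<in> Idl\<^bsub>R\<^esub> (J \<union> set (take i fs))) \<and>
    \<one>\<^bsub>R\<^esub> \<notin> Idl\<^bsub>R\<^esub> (J \<union> set fs)"
proof (cases "set fs \<subseteq> carrier R")
  case True
  interpret R: cring R by fact
  interpret J: ideal J R by fact
  have ballM: "(\<forall>x\<in>carrier (quotient_module R J). P x) \<longleftrightarrow> (\<forall>q\<in>carrier R. P (J +>\<^bsub>R\<^esub> q))" for P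
    by (auto simp: quotient_module_def FactRing_def A_RCOSETS_def' a_r_coset_def')
  have smulM: "q \<odot>\<^bsub>quotient_module R J\<^esub> (J +>\<^bsub>R\<^esub> r) = J +>\<^bsub>R\<^esub> (q \<otimes>\<^bsub>R\<^esub> r)"
    if "q \<in> carrier R" "r \<in> carrier R" for q r
    using ring_hom_mult[OF J.rcos_ring_hom that] by (simp add: quotient_module_def)
  have fsR: "fs ! i \<in> carrier R" "set (take i fs) \<subseteq> carrier R" if "i < length fs" for i
    using True that set_take_subset[of i fs] by (auto dest: nth_mem)
  show ?thesis
    using True fsR
    by (simp add: regular_sequence_def ballM smulM mem_set_times_quotient_module_iff[OF assms]
        set_times_quotient_module_eq_carrier_iff[OF assms])
qed (simp add: regular_sequence_def)

section \<open>The Koszul complex\<close>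

text \<open>
  A polynomial ring in finitely many variables is a proper subset of its type, so the Koszul
  complex is developed for a subring \<open>C\<close> of a commutative ring, and modulo an ideal of \<open>C\<close>.
\<close>

locale subring_of_type =
  fixes C :: "'a::comm_ring_1 set"
  assumes zero_mem [simp]: "0 \<in> C" and one_mem [simp]: "1 \<in> C"
    and add_mem [intro]: "a \<in> C \<Longrightarrow> b \<in> C \<Longrightarrow> a + b \<in> C"
    and uminus_mem [intro]: "a \<in> C \<Longrightarrow> - a \<in> C"
    and mult_mem [intro]: "a \<in> C \<Longrightarrow> b \<in> C \<Longrightarrow> a * b \<in> C"
begin

definition is_ideal :: "'a set \<Rightarrow> bool" where
  "is_ideal J \<longleftrightarrow> J \<subseteq> C \<and> 0 \<in> J \<and> (\<forall>a\<in>J. \<forall>b\<in>J. a + b \<in> J) \<and> (\<forall>c\<in>C. \<forall>a\<in>J. c * a \<in> J)"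

lemma diff_mem: "a \<in> C \<Longrightarrow> b \<in> C \<Longrightarrow> a - b \<in> C"
  using add_mem[of a "- b"] uminus_mem[of b] by simp

lemma sum_mem: "(\<And>i. i \<in> S \<Longrightarrow> f i \<in> C) \<Longrightarrow> sum f S \<in> C"
  by (induction S rule: infinite_finite_induct) auto

lemma power_mem: "a \<in> C \<Longrightarrow> a ^ k \<in> C"
  by (induction k) auto

lemma minus_one_power_mem: "(- 1) ^ k \<in> C"
  by (intro power_mem uminus_mem) simp

lemma ideal_subset: "is_ideal J \<Longrightarrow> a \<in> J \<Longrightarrow> a \<in> C"
  by (auto simp: is_ideal_def)

lemma ideal_zero: "is_ideal J \<Longrightarrow> 0 \<in> J"
  by (auto simp: is_ideal_def)

lemma ideal_add: "is_ideal J \<Longrightarrow> a \<in> J \<Longrightarrow> b \<in> J \<Longrightarrow> a + b \<in> J"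
  by (auto simp: is_ideal_def)

lemma ideal_mult: "is_ideal J \<Longrightarrow> c \<in> C \<Longrightarrow> a \<in> J \<Longrightarrow> c * a \<in> J"
  by (auto simp: is_ideal_def)

lemma ideal_uminus: "is_ideal J \<Longrightarrow> a \<in> J \<Longrightarrow> - a \<in> J"
  using ideal_mult[of J "- 1" a] uminus_mem[of 1] by simp

lemma ideal_diff: "is_ideal J \<Longrightarrow> a \<in> J \<Longrightarrow> b \<in> J \<Longrightarrow> a - b \<in> J"
  using ideal_add[of J a "- b"] ideal_uminus[of J b] by simp

lemma ideal_sum: "is_ideal J \<Longrightarrow> (\<And>i. i \<in> S \<Longrightarrow> f i \<in> J) \<Longrightarrow> sum f S \<in> J"
  by (induction S rule: infinite_finite_induct) (auto intro: ideal_zero ideal_add)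

end

text \<open>
  A Koszul chain is stored as its family of coefficients \<open>z A\<close> at the basis elements
  \<open>e\<^sub>A = e\<^sub>i\<^sub>1 \<and> \<dots> \<and> e\<^sub>i\<^sub>p\<close>, all degrees together; restricting attention to sets of cardinality
  \<open>p\<close> gives the chains of degree \<open>p\<close>.
\<close>

definition koszul_sign :: "nat \<Rightarrow> nat set \<Rightarrow> 'a::comm_ring_1" where
  "koszul_sign i A = (- 1) ^ card {j \<in> A. j < i}"

definition koszul_diff ::
    "nat set \<Rightarrow> (nat \<Rightarrow> 'a::comm_ring_1) \<Rightarrow> (nat set \<Rightarrow> 'a) \<Rightarrow> nat set \<Rightarrow> 'a" where
  "koszul_diff V g z A = (\<Sum>i\<in>V - A. koszul_sign i A * g i * z (insert i A))"

definition wedge :: "(nat \<Rightarrow> 'a::comm_ring_1) \<Rightarrow> (nat set \<Rightarrow> 'a) \<Rightarrow> nat set \<Rightarrow> 'a" where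
  "wedge c z A = (\<Sum>i\<in>A. koszul_sign i A * c i * z (A - {i}))"

lemma koszul_sign_insert:
  assumes "finite A" "i \<notin> A"
  shows "koszul_sign l (insert i A) = (if i < l then - koszul_sign l A else koszul_sign l A)"
proof -
  have "{j \<in> insert i A. j < l} = (if i < l then insert i {j \<in> A. j < l} else {j \<in> A. j < l})"
    by auto
  then show ?thesis
    using assms by (simp add: koszul_sign_def)
qed

lemma koszul_sign_insert_self: "koszul_sign i (insert i A) = koszul_sign i A"
proof -
  have "{j \<in> insert i A. j < i} = {j \<in> A. j < i}" by auto
  then show ?thesis by (simp add: koszul_sign_def)
qed

lemma koszul_sign_remove_self: "koszul_sign i (A - {i}) = koszul_sign i A"
proof -
  have "{j \<in> A - {i}. j < i} = {j \<in> A. j < i}" by auto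
  then show ?thesis by (simp add: koszul_sign_def)
qed

lemma koszul_sign_square: "koszul_sign i A * koszul_sign i A = 1"
  by (simp add: koszul_sign_def flip: power_add)

lemma koszul_sign_swap:
  assumes "finite A" "i \<notin> A" "l \<notin> A" "i \<noteq> l"
  shows "koszul_sign i A * koszul_sign l (insert i A) = - (koszul_sign l A * koszul_sign i (insert l A))"
  using assms by (auto simp: koszul_sign_insert)

text \<open>
  The terms that remove \<open>i\<close> and \<open>l\<close> in the two possible orders cancel.
\<close>

lemma koszul_diff_koszul_diff:
  assumes "finite V" "A \<subseteq> V"
  shows "koszul_diff V g (koszul_diff V g z) A = 0"
proof -
  have fA: "finite A" using assms finite_subset by blast
  define F where "F i l = (if i = l then 0 else koszul_sign i A * koszul_sign l (insert i A) * g i * g l * z (insert l (insert i A)))" for i l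
  have anti: "F l i = - F i l" if "l \<in> V - A" "i \<in> V - A" for i l
  proof (cases "i = l")
    case False
    have "F l i = (koszul_sign l A * koszul_sign i (insert l A)) * (g i * g l * z (insert l (insert i A)))"
      using False by (simp add: F_def insert_commute mult_ac)
    also have "koszul_sign l A * koszul_sign i (insert l A) = - (koszul_sign i A * koszul_sign l (insert i A) :: 'a)"
      using koszul_sign_swap[OF fA, of l i] that False by simp
    finally show ?thesis
      using False by (simp add: F_def mult_ac)
  qed (simp add: F_def)
  have "koszul_diff V g (koszul_diff V g z) A = (\<Sum>i\<in>V - A. \<Sum>l\<in>V - A. F i l)"
    unfolding koszul_diff_def sum_distrib_left
  proof (rule sum.cong[OF refl])
    fix i assume i: "i \<in> V - A"
    have "(\<Sum>l\<in>V - insert i A. koszul_sign i A * g i * (koszul_sign l (insert i A) * g l * z (insert l (insert i A)))) = (\<Sum>l\<in>V - insert i A. F i l)"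
      by (intro sum.cong) (auto simp: F_def mult_ac)
    also have "\<dots> = (\<Sum>l\<in>V - A. F i l)"
      using assms by (intro sum.mono_neutral_left) (auto simp: F_def)
    finally show "(\<Sum>l\<in>V - insert i A. koszul_sign i A * g i * (koszul_sign l (insert i A) * g l * z (insert l (insert i A)))) = (\<Sum>l\<in>V - A. F i l)" .
  qed
  also have "\<dots> = (\<Sum>i\<in>V - A. \<Sum>l\<in>{l\<in>V - A. l < i}. F i l) + (\<Sum>i\<in>V - A. \<Sum>l\<in>{l\<in>V - A. i < l}. F i l)"
  proof -
    have "(\<Sum>l\<in>V - A. F i l) = (\<Sum>l\<in>{l\<in>V - A. l < i}. F i l) + (\<Sum>l\<in>{l\<in>V - A. i < l}. F i l)"
      if "i \<in> V - A" for i
    proof -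
      have "(\<Sum>l\<in>V - A. F i l) = (\<Sum>l\<in>{l\<in>V - A. l < i} \<union> {l\<in>V - A. i < l}. F i l)"
        using assms(1) by (intro sum.mono_neutral_right) (auto simp: F_def)
      also have "\<dots> = (\<Sum>l\<in>{l\<in>V - A. l < i}. F i l) + (\<Sum>l\<in>{l\<in>V - A. i < l}. F i l)"
        using assms(1) by (intro sum.union_disjoint) auto
      finally show ?thesis .
    qed
    then show ?thesis by (simp add: sum.distrib)
  qed
  also have "(\<Sum>i\<in>V - A. \<Sum>l\<in>{l\<in>V - A. i < l}. F i l) = (\<Sum>i\<in>V - A. \<Sum>l\<in>{l\<in>V - A. l < i}. F l i)"
    using assms(1) by (subst sum.swap_restrict) auto
  also have "(\<Sum>i\<in>V - A. \<Sum>l\<in>{l\<in>V - A. l < i}. F l i) = - (\<Sum>i\<in>V - A. \<Sum>l\<in>{l\<in>V - A. l < i}. F i l)"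
    unfolding sum_negf[symmetric] by (intro sum.cong refl anti) auto
  finally show ?thesis by simp
qed

text \<open>
  The contraction with \<open>g\<close> is an antiderivation. For \<open>f = \<Sum> c\<^sub>i g\<^sub>i\<close> this says that multiplication
  by \<open>f\<close> is homotopic to zero, with the wedge product by \<open>c\<close> as homotopy.
\<close>

lemma koszul_diff_wedge:
  assumes "finite V" "A \<subseteq> V"
  shows "koszul_diff V g (wedge c z) A + wedge c (koszul_diff V g z) A = (\<Sum>i\<in>V. c i * g i) * z A"
proof -
  have fA: "finite A" using assms finite_subset by blast
  define F where "F i l = koszul_sign i A * koszul_sign l (insert i A) * g i * c l * z (insert i (A - {l}))" for i l
  have "koszul_diff V g (wedge c z) A = (\<Sum>i\<in>V - A. c i * g i * z A + (\<Sum>l\<in>A. F i l))"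
    unfolding koszul_diff_def
  proof (rule sum.cong[OF refl])
    fix i assume i: "i \<in> V - A"
    have "insert i A - {l} = insert i (A - {l})" if "l \<in> A" for l using i that by auto
    then have "wedge c z (insert i A) = koszul_sign i A * c i * z A + (\<Sum>l\<in>A. koszul_sign l (insert i A) * c l * z (insert i (A - {l})))"
      using i fA by (simp add: wedge_def koszul_sign_insert_self)
    then have "koszul_sign i A * g i * wedge c z (insert i A)
      = (koszul_sign i A * koszul_sign i A) * c i * g i * z A + (\<Sum>l\<in>A. F i l)"
      by (simp add: F_def sum_distrib_left algebra_simps)
    then show "koszul_sign i A * g i * wedge c z (insert i A) = c i * g i * z A + (\<Sum>l\<in>A. F i l)"
      by (simp add: koszul_sign_square)
  qed
  moreover have "wedge c (koszul_diff V g z) A = (\<Sum>l\<in>A. c l * g l * z A + (\<Sum>i\<in>V - A. - F i l))"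
    unfolding wedge_def
  proof (rule sum.cong[OF refl])
    fix l assume l: "l \<in> A"
    have "V - (A - {l}) = insert l (V - A)" using l assms by auto
    then have "koszul_diff V g z (A - {l}) = koszul_sign l A * g l * z A + (\<Sum>i\<in>V - A. koszul_sign i (A - {l}) * g i * z (insert i (A - {l})))"
      using l assms by (simp add: koszul_diff_def koszul_sign_remove_self insert_absorb)
    then have "koszul_sign l A * c l * koszul_diff V g z (A - {l})
      = (koszul_sign l A * koszul_sign l A) * c l * g l * z A + (\<Sum>i\<in>V - A. koszul_sign l A * koszul_sign i (A - {l}) * g i * c l * z (insert i (A - {l})))"
      by (simp add: sum_distrib_left algebra_simps)
    also have "(\<Sum>i\<in>V - A. koszul_sign l A * koszul_sign i (A - {l}) * g i * c l * z (insert i (A - {l}))) = (\<Sum>i\<in>V - A. - F i l)"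
    proof (rule sum.cong[OF refl])
      fix i assume i: "i \<in> V - A"
      define B where "B = A - {l}"
      have B: "A = insert l B" "l \<notin> B" "finite B" "i \<notin> B" "i \<noteq> l"
        using l i fA by (auto simp: B_def)
      have "koszul_sign l A * koszul_sign i (A - {l}) = - (koszul_sign i A * koszul_sign l (insert i A) :: 'a)"
        using B by (auto simp: koszul_sign_insert koszul_sign_insert_self insert_commute[of i l])
      then show "koszul_sign l A * koszul_sign i (A - {l}) * g i * c l * z (insert i (A - {l})) = - F i l"
        by (simp add: F_def)
    qed
    finally show "koszul_sign l A * c l * koszul_diff V g z (A - {l}) = c l * g l * z A + (\<Sum>i\<in>V - A. - F i l)"
      by (simp add: koszul_sign_square)
  qed
  moreover have "(\<Sum>i\<in>V. c i * g i * z A) = (\<Sum>i\<in>V - A. c i * g i * z A) + (\<Sum>i\<in>A. c i * g i * z A)"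
    by (rule sum.subset_diff[OF assms(2,1)])
  moreover have "(\<Sum>i\<in>V - A. \<Sum>l\<in>A. F i l) = (\<Sum>l\<in>A. \<Sum>i\<in>V - A. F i l)"
    by (rule sum.swap)
  ultimately have "koszul_diff V g (wedge c z) A + wedge c (koszul_diff V g z) A = (\<Sum>i\<in>V. c i * g i * z A)"
    by (simp only: sum.distrib sum_negf) simp
  then show ?thesis
    by (simp only: sum_distrib_right)
qed

context subring_of_type
begin

text \<open>
  Vanishing of the \<open>p\<close>-th Koszul homology of \<open>C/J\<close>, for representatives in \<open>C\<close>: being a cycle or a
  boundary is only required modulo \<open>J\<close>. For \<open>p = 0\<close> there is no cycle condition.
\<close>

definition koszul_exact :: "nat set \<Rightarrow> (nat \<Rightarrow> 'a) \<Rightarrow> 'a set \<Rightarrow> nat \<Rightarrow> bool" where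
  "koszul_exact V g J p \<longleftrightarrow> (\<forall>z. (\<forall>A. z A \<in> C) \<longrightarrow>
    (\<forall>A\<subseteq>V. card A + 1 = p \<longrightarrow> koszul_diff V g z A \<in> J) \<longrightarrow>
    (\<exists>w. (\<forall>A. w A \<in> C) \<and> (\<forall>A\<subseteq>V. card A = p \<longrightarrow> z A - koszul_diff V g w A \<in> J)))"

lemma koszul_exact_above:
  assumes "finite V" "card V < p"
  shows "koszul_exact V g J p"
proof -
  have "card A \<noteq> p" if "A \<subseteq> V" for A
    using card_mono[OF assms(1) that] assms(2) by simp
  then show ?thesis
    unfolding koszul_exact_def by (auto intro!: exI[of _ "\<lambda>_. 0"])
qed

lemma koszul_sign_mem: "koszul_sign i A \<in> C"
  by (simp add: koszul_sign_def minus_one_power_mem)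

text \<open>
  This replaces the long exact sequence of \<open>0 \<rightarrow> C/J \<rightarrow> C/J \<rightarrow> C/J' \<rightarrow> 0\<close>, where the first map is
  multiplication by \<open>f\<close> and \<open>J' = J + (f)\<close>. Given a cycle \<open>z\<close> modulo \<open>J\<close>, the homotopy writes
  \<open>f z\<close> as the boundary of \<open>w = c \<and> z\<close> modulo \<open>J\<close>. Hence \<open>w\<close> is a cycle modulo \<open>J'\<close>, so it is a
  boundary plus some \<open>f t\<close> modulo \<open>J\<close>. Then \<open>f (z - \<partial>t)\<close> is zero modulo \<open>J\<close>, and \<open>f\<close> cancels.
\<close>

lemma koszul_exact_step:
  assumes V: "finite V" and g: "\<And>i. i \<in> V \<Longrightarrow> g i \<in> C"
    and J: "is_ideal J" "is_ideal J'" and J': "\<And>a. a \<in> J' \<Longrightarrow> \<exists>b\<in>J. \<exists>t\<in>C. a = b + f * t"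
    and sub: "J \<subseteq> J'" "f \<in> J'"
    and f: "f = (\<Sum>i\<in>V. c i * g i)" "\<And>i. c i \<in> C"
    and nzd: "\<And>a. a \<in> C \<Longrightarrow> f * a \<in> J \<Longrightarrow> a \<in> J"
    and ex: "koszul_exact V g J' (Suc p)"
  shows "koszul_exact V g J p"
  unfolding koszul_exact_def
proof (intro allI impI)
  fix z :: "nat set \<Rightarrow> 'a"
  assume z: "\<forall>A. z A \<in> C" and cyc: "\<forall>A\<subseteq>V. card A + 1 = p \<longrightarrow> koszul_diff V g z A \<in> J"
  define w where "w = wedge c z"
  have wC: "w A \<in> C" for A
    unfolding w_def wedge_def using z f(2) by (intro sum_mem mult_mem koszul_sign_mem) auto
  have dw: "f * z A - koszul_diff V g w A \<in> J" if A: "A \<subseteq> V" "card A = p" for A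
  proof -
    have fin: "finite A" using A V finite_subset by blast
    have "wedge c (koszul_diff V g z) A \<in> J"
      unfolding wedge_def
    proof (intro ideal_sum[OF J(1)] ideal_mult[OF J(1)] mult_mem koszul_sign_mem f(2))
      fix i assume "i \<in> A"
      then show "koszul_diff V g z (A - {i}) \<in> J"
        using A fin cyc by (metis Diff_subset Suc_eq_plus1 card_Suc_Diff1 subset_trans)
    qed
    moreover have "f * z A - koszul_diff V g w A = wedge c (koszul_diff V g z) A"
      using koszul_diff_wedge[OF V A(1), of g c z] f(1) by (simp add: w_def algebra_simps)
    ultimately show ?thesis by simp
  qed
  have "koszul_diff V g w A \<in> J'" if A: "A \<subseteq> V" "card A + 1 = Suc p" for A
  proof -
    have "f * z A \<in> J'"
      using ideal_mult[OF J(2), of "z A" f] z sub(2) by (simp add: mult.commute)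
    moreover have "f * z A - koszul_diff V g w A \<in> J'"
      using dw[of A] A sub(1) by auto
    ultimately show ?thesis
      using ideal_diff[OF J(2)] by fastforce
  qed
  then obtain v where v: "\<And>A. v A \<in> C" "\<And>A. A \<subseteq> V \<Longrightarrow> card A = Suc p \<Longrightarrow> w A - koszul_diff V g v A \<in> J'"
    using ex[unfolded koszul_exact_def, rule_format, of w] wC by auto
  have "\<exists>t\<in>C. A \<subseteq> V \<longrightarrow> card A = Suc p \<longrightarrow> w A - koszul_diff V g v A - f * t \<in> J" for A
  proof (cases "A \<subseteq> V \<and> card A = Suc p")
    case True
    then obtain b t where "b \<in> J" "t \<in> C" "w A - koszul_diff V g v A = b + f * t"
      using J'[OF v(2)[of A]] by blast
    then show ?thesis by (intro bexI[of _ t]) simp_all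
  qed (use zero_mem in blast)
  then obtain t where t: "\<And>A. t A \<in> C"
    "\<And>A. A \<subseteq> V \<Longrightarrow> card A = Suc p \<Longrightarrow> w A - koszul_diff V g v A - f * t A \<in> J"
    by metis
  have "z A - koszul_diff V g t A \<in> J" if A: "A \<subseteq> V" "card A = p" for A
  proof -
    have fin: "finite A" using A V finite_subset by blast
    have "koszul_diff V g (\<lambda>B. w B - koszul_diff V g v B - f * t B) A \<in> J"
      unfolding koszul_diff_def[of _ _ _ A]
      using A fin by (intro ideal_sum[OF J(1)] ideal_mult[OF J(1)] mult_mem koszul_sign_mem g t(2)) auto
    also have "koszul_diff V g (\<lambda>B. w B - koszul_diff V g v B - f * t B) A
      = koszul_diff V g w A - koszul_diff V g (koszul_diff V g v) A - f * koszul_diff V g t A"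
      unfolding koszul_diff_def[of _ _ _ A] by (simp add: sum_subtractf sum.distrib sum_distrib_left algebra_simps)
    also have "\<dots> = koszul_diff V g w A - f * koszul_diff V g t A"
      by (simp add: koszul_diff_koszul_diff[OF V A(1)])
    finally have "(f * z A - koszul_diff V g w A) + (koszul_diff V g w A - f * koszul_diff V g t A) \<in> J"
      using dw[OF A] ideal_add[OF J(1)] by blast
    then have "f * (z A - koszul_diff V g t A) \<in> J"
      by (simp add: algebra_simps)
    moreover have "koszul_diff V g t A \<in> C"
      unfolding koszul_diff_def using g t(1) by (intro sum_mem mult_mem koszul_sign_mem) auto
    ultimately show ?thesis
      using nzd z diff_mem by blast
  qed
  then show "\<exists>w. (\<forall>A. w A \<in> C) \<and> (\<forall>A\<subseteq>V. card A = p \<longrightarrow> z A - koszul_diff V g w A \<in> J)"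
    using t(1) by blast
qed

end

section \<open>Ideals spanned by monomials\<close>

type_synonym exponent = "nat \<Rightarrow>\<^sub>0 nat"

abbreviation lk :: "exponent \<Rightarrow> nat \<Rightarrow> nat" where "lk \<equiv> Poly_Mapping.lookup"

abbreviation unit_exponent :: "nat \<Rightarrow> exponent" where
  "unit_exponent i \<equiv> Poly_Mapping.single i 1"

text \<open>
  The carrier of the polynomial ring, as a set on which the operations of the type are used
  directly.
\<close>

definition polys :: "nat \<Rightarrow> 'k::field mpoly set" where
  "polys n = {p. \<forall>e\<in>Poly_Mapping.keys p. Poly_Mapping.keys e \<subseteq> {..<n}}"

definition monomial_span :: "nat \<Rightarrow> (exponent \<Rightarrow> bool) \<Rightarrow> 'k::field mpoly set" where
  "monomial_span n Q = {p \<in> polys n. \<forall>e\<in>Poly_Mapping.keys p. Q e}"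

definition upward_closed :: "(exponent \<Rightarrow> bool) \<Rightarrow> bool" where
  "upward_closed Q \<longleftrightarrow> (\<forall>a b. Q a \<longrightarrow> Q (a + b))"

lemma mpoly_ring_simps [simp]:
  "carrier (mpoly_ring n) = polys n" "\<zero>\<^bsub>mpoly_ring n\<^esub> = 0" "\<one>\<^bsub>mpoly_ring n\<^esub> = 1"
  "p \<oplus>\<^bsub>mpoly_ring n\<^esub> q = p + q" "p \<otimes>\<^bsub>mpoly_ring n\<^esub> q = p * q"
  by (simp_all add: mpoly_ring_def polys_def)

lemma polys_zero [simp]: "0 \<in> polys n" and polys_one [simp]: "1 \<in> polys n"
  by (simp_all add: polys_def)

lemma polys_add: "p \<in> polys n \<Longrightarrow> q \<in> polys n \<Longrightarrow> p + q \<in> polys n"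
  using Poly_Mapping.keys_add[of p q] by (fastforce simp: polys_def)

lemma polys_uminus: "p \<in> polys n \<Longrightarrow> - p \<in> polys n"
  by (simp add: polys_def)

lemma polys_mult: "p \<in> polys n \<Longrightarrow> q \<in> polys n \<Longrightarrow> p * q \<in> polys n"
  using mult_in_carrier[of p n q] by simp

interpretation polys: subring_of_type "polys n :: 'k::field mpoly set" for n
  by unfold_locales (auto intro: polys_add polys_uminus polys_mult)

lemma a_inv_mpoly_ring: "p \<in> polys n \<Longrightarrow> \<ominus>\<^bsub>mpoly_ring n\<^esub> p = (- p :: 'k::field mpoly)"
proof -
  interpret R: cring "mpoly_ring n :: 'k mpoly ring" by (rule mpoly_ring_cring)
  assume "p \<in> polys n"
  then show ?thesis
    by (intro R.minus_equality) (auto simp: polys_uminus)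
qed

lemma ideal_mpoly_ring_iff:
  "ideal J (mpoly_ring n) \<longleftrightarrow> polys.is_ideal n (J :: 'k::field mpoly set)"
proof
  interpret R: cring "mpoly_ring n :: 'k mpoly ring" by (rule mpoly_ring_cring)
  assume "ideal J (mpoly_ring n)"
  then interpret J: ideal J "mpoly_ring n" .
  show "polys.is_ideal n J"
    unfolding polys.is_ideal_def
    using J.a_subset J.zero_closed J.a_closed J.I_l_closed by simp
next
  interpret R: cring "mpoly_ring n :: 'k mpoly ring" by (rule mpoly_ring_cring)
  assume J: "polys.is_ideal n J"
  show "ideal J (mpoly_ring n)"
  proof (rule idealI)
    show "subgroup J (add_monoid (mpoly_ring n))"
    proof (rule R.add.subgroupI)
      show "\<ominus>\<^bsub>mpoly_ring n\<^esub> a \<in> J" if "a \<in> J" for a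
        using polys.ideal_uminus[OF J that] polys.ideal_subset[OF J that] by (simp add: a_inv_mpoly_ring)
    qed (use polys.ideal_zero[OF J] polys.ideal_subset[OF J] polys.ideal_add[OF J] in auto)
    show "x \<otimes>\<^bsub>mpoly_ring n\<^esub> a \<in> J" "a \<otimes>\<^bsub>mpoly_ring n\<^esub> x \<in> J"
      if "a \<in> J" "x \<in> carrier (mpoly_ring n)" for a x
      using polys.ideal_mult[OF J, of x a] that by (simp_all add: mult.commute)
  qed (rule R.ring_axioms)
qed

lemma monomial_in_polys_iff: "monomial e \<in> polys n \<longleftrightarrow> Poly_Mapping.keys e \<subseteq> {..<n}"
  by (simp add: polys_def monomial_def)

lemma monomial_mult: "monomial a * monomial b = (monomial (a + b) :: 'k::field mpoly)"
  by (simp add: monomial_def mult_single)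

lemma monomial_zero: "monomial 0 = (1 :: 'k::field mpoly)"
  by (simp add: monomial_def)

lemma variable_mult_monomial:
  "variable i * monomial b = (monomial (unit_exponent i + b) :: 'k::field mpoly)"
  by (simp add: variable_def monomial_mult)

lemma variable_in_polys [simp]: "i < n \<Longrightarrow> variable i \<in> polys n"
  by (simp add: variable_def monomial_in_polys_iff)

lemma lookup_single_mult:
  "Poly_Mapping.lookup (Poly_Mapping.single a c * p) e =
    c * Sum_any (\<lambda>b. Poly_Mapping.lookup p b when e = a + b)"
  by (simp add: lookup_mult lookup_single when_mult)

lemma lookup_monomial_mult:
  "Poly_Mapping.lookup (monomial a * p) (a + e) = Poly_Mapping.lookup (p :: 'k::field mpoly) e"
  by (simp add: monomial_def lookup_single_mult)

lemma lookup_monomial_mult_zero: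
  assumes "\<And>b. e \<noteq> a + b"
  shows "Poly_Mapping.lookup (monomial a * p) e = (0 :: 'k::field)"
  using assms by (simp add: monomial_def lookup_single_mult)

lemma sum_monomials:
  "(p :: 'k::field mpoly) = (\<Sum>e\<in>Poly_Mapping.keys p. Poly_Mapping.single 0 (Poly_Mapping.lookup p e) * monomial e)"
  by (rule poly_mapping_eqI)
    (auto simp: lookup_sum monomial_def mult_single lookup_single when_def in_keys_iff)

lemma monomial_span_is_ideal:
  assumes "upward_closed Q"
  shows "polys.is_ideal n (monomial_span n Q :: 'k::field mpoly set)"
proof -
  have "c * p \<in> monomial_span n Q" if c: "c \<in> polys n" and p: "p \<in> monomial_span n Q" for c p :: "'k mpoly"
  proof -
    have "Q e" if e: "e \<in> Poly_Mapping.keys (c * p)" for e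
    proof -
      obtain a b where "e = a + b" "b \<in> Poly_Mapping.keys p"
        using keys_mult[of c p] e by blast
      then show ?thesis
        using assms p by (auto simp: upward_closed_def monomial_span_def add.commute[of a b])
    qed
    then show ?thesis
      using polys_mult[OF c] p by (auto simp: monomial_span_def)
  qed
  moreover have "p + q \<in> monomial_span n Q" if "p \<in> monomial_span n Q" "q \<in> monomial_span n Q" for p q :: "'k mpoly"
  proof -
    have "Q e" if "e \<in> Poly_Mapping.keys (p + q)" for e
      using that Poly_Mapping.keys_add[of p q] \<open>p \<in> monomial_span n Q\<close> \<open>q \<in> monomial_span n Q\<close>
      unfolding monomial_span_def by blast
    then show ?thesis
      using that polys_add[of p n q] by (simp add: monomial_span_def)
  qed
  moreover have "monomial_span n Q \<subseteq> polys n" "0 \<in> monomial_span n Q"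
    by (auto simp: monomial_span_def)
  ultimately show ?thesis
    unfolding polys.is_ideal_def by blast
qed

lemma monomial_in_span_iff:
  "monomial e \<in> monomial_span n Q \<longleftrightarrow> Poly_Mapping.keys e \<subseteq> {..<n} \<and> Q e"
  by (simp add: monomial_span_def monomial_in_polys_iff) (simp add: monomial_def)

lemma single_zero_in_polys: "Poly_Mapping.single 0 c \<in> polys n"
  by (simp add: polys_def)

lemma monomial_span_subset:
  assumes "polys.is_ideal n J" "\<And>e. Poly_Mapping.keys e \<subseteq> {..<n} \<Longrightarrow> Q e \<Longrightarrow> monomial e \<in> J"
  shows "monomial_span n Q \<subseteq> (J :: 'k::field mpoly set)"
proof
  fix p :: "'k mpoly" assume p: "p \<in> monomial_span n Q"
  have "(\<Sum>e\<in>Poly_Mapping.keys p. Poly_Mapping.single 0 (Poly_Mapping.lookup p e) * monomial e) \<in> J"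
    using p by (intro polys.ideal_sum[OF assms(1)] polys.ideal_mult[OF assms(1)] assms(2) single_zero_in_polys)
      (auto simp: monomial_span_def polys_def)
  then show "p \<in> J" using sum_monomials[of p] by simp
qed

lemma is_ideal_genideal:
  assumes "A \<subseteq> polys n"
  shows "polys.is_ideal n (Idl\<^bsub>mpoly_ring n\<^esub> A :: 'k::field mpoly set)"
proof -
  interpret R: cring "mpoly_ring n :: 'k mpoly ring" by (rule mpoly_ring_cring)
  show ?thesis
    using R.genideal_ideal[of A] assms by (simp add: ideal_mpoly_ring_iff)
qed

lemma genideal_least:
  assumes "polys.is_ideal n J" "A \<subseteq> J"
  shows "Idl\<^bsub>mpoly_ring n\<^esub> A \<subseteq> (J :: 'k::field mpoly set)"
proof -
  interpret R: cring "mpoly_ring n :: 'k mpoly ring" by (rule mpoly_ring_cring)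
  show ?thesis
    using R.genideal_minimal[of J A] assms by (simp add: ideal_mpoly_ring_iff)
qed

lemma genideal_contains: "A \<subseteq> Idl\<^bsub>mpoly_ring n\<^esub> A"
  by (auto simp: genideal_def)

section \<open>Powers of monomial ideals and variable primes\<close>

definition expo :: "nat \<Rightarrow> (nat \<Rightarrow> nat) \<Rightarrow> exponent" where
  "expo n f = (\<Sum>i<n. Poly_Mapping.single i (f i))"

lemma lookup_expo [simp]: "lk (expo n f) i = (if i < n then f i else 0)"
  by (simp add: expo_def lookup_sum lookup_single when_def)

lemma keys_expo: "Poly_Mapping.keys (expo n f) \<subseteq> {..<n}"
  by (auto simp: in_keys_iff split: if_splits)

lemma keys_add_exponent: "Poly_Mapping.keys (a + b :: exponent) = Poly_Mapping.keys a \<union> Poly_Mapping.keys b"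
  by (auto simp: in_keys_iff lookup_add)

lemma exponent_split:
  assumes "\<And>i. lk b i \<le> lk e i"
  shows "(e :: exponent) = (e - b) + b"
  by (rule poly_mapping_eqI) (simp add: lookup_add lookup_minus assms)

lemma keys_diff_exponent: "Poly_Mapping.keys (e - b :: exponent) \<subseteq> Poly_Mapping.keys e"
  by (auto simp: in_keys_iff lookup_minus)

lemma monomial_mem_of_divisor:
  assumes "polys.is_ideal n J" "monomial b \<in> J" "\<And>i. lk b i \<le> lk e i" "Poly_Mapping.keys e \<subseteq> {..<n}"
  shows "monomial e \<in> (J :: 'k::field mpoly set)"
proof -
  have "monomial (e - b) \<in> (polys n :: 'k mpoly set)"
    using keys_diff_exponent[of e b] assms(4) by (simp add: monomial_in_polys_iff)
  then have "monomial (e - b) * monomial b \<in> J"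
    by (rule polys.ideal_mult[OF assms(1) _ assms(2)])
  then show ?thesis
    using exponent_split[of b e] assms(3) by (simp add: monomial_mult)
qed

lemma variable_power: "variable i ^ s = (monomial (Poly_Mapping.single i s) :: 'k::field mpoly)"
  by (induction s) (simp_all add: monomial_zero variable_mult_monomial flip: single_add)

lemma ideal_power_is_ideal:
  assumes "ideal P (mpoly_ring n)"
  shows "ideal (ideal_power (mpoly_ring n) P k) (mpoly_ring n :: 'k::field mpoly ring)"
proof -
  interpret R: cring "mpoly_ring n :: 'k mpoly ring" by (rule mpoly_ring_cring)
  show ?thesis
    by (induction k) (auto simp: ideal_power_simps intro: R.oneideal R.ideal_prod_is_ideal assms simp del: mpoly_ring_simps(1))
qed

lemma ideal_prod_mono:
  assumes "A \<subseteq> A'" "B \<subseteq> B'"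
  shows "ideal_prod R A B \<subseteq> ideal_prod R A' B'"
proof
  fix x assume "x \<in> ideal_prod R A B"
  then show "x \<in> ideal_prod R A' B'"
    by induction (use assms in \<open>auto intro: ideal_prod.intros\<close>)
qed

text \<open>
  Reduces powers of monomial ideals to additive combinatorics of exponent vectors.
\<close>

lemma ideal_prod_monomial_span:
  assumes "upward_closed Q" "upward_closed Q'"
  shows "ideal_prod (mpoly_ring n) (monomial_span n Q) (monomial_span n Q') =
    (monomial_span n (\<lambda>e. \<exists>a b. e = a + b \<and> Q a \<and> Q' b) :: 'k::field mpoly set)"
    (is "?P = monomial_span n ?S")
proof
  have S: "upward_closed ?S"
    unfolding upward_closed_def
  proof (intro allI impI)
    fix c d assume "?S c"
    then obtain a b where "c = a + b" "Q a" "Q' b" by blast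
    then show "?S (c + d)"
      using assms(1) by (intro exI[of _ "a + d"] exI[of _ b]) (auto simp: upward_closed_def add_ac)
  qed
  show "?P \<subseteq> monomial_span n ?S"
  proof
    fix x :: "'k mpoly" assume "x \<in> ?P"
    then show "x \<in> monomial_span n ?S"
    proof induction
      case (prod p q)
      have "?S e" if "e \<in> Poly_Mapping.keys (p * q)" for e
        using keys_mult[of p q] that prod unfolding monomial_span_def by blast
      then show ?case
        using prod polys_mult by (auto simp: monomial_span_def)
    next
      case (sum p q)
      then show ?case
        using polys.ideal_add[OF monomial_span_is_ideal[OF S]] by simp
    qed
  qed
  interpret R: cring "mpoly_ring n :: 'k mpoly ring" by (rule mpoly_ring_cring)
  have P: "polys.is_ideal n ?P"
    using R.ideal_prod_is_ideal[of "monomial_span n Q" "monomial_span n Q'"]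
      monomial_span_is_ideal[OF assms(1), of n, where 'k = 'k] monomial_span_is_ideal[OF assms(2), of n, where 'k = 'k]
    by (simp add: ideal_mpoly_ring_iff)
  show "monomial_span n ?S \<subseteq> ?P"
  proof (rule monomial_span_subset[OF P])
    fix e assume e: "Poly_Mapping.keys e \<subseteq> {..<n}" "?S e"
    then obtain a b where ab: "e = a + b" "Q a" "Q' b" by blast
    then have "monomial a \<in> (monomial_span n Q :: 'k mpoly set)" "monomial b \<in> (monomial_span n Q' :: 'k mpoly set)"
      using e(1) by (auto simp: monomial_in_span_iff keys_add_exponent)
    then show "monomial e \<in> ?P"
      using ideal_prod.prod[of "monomial a" _ "monomial b" _ "mpoly_ring n :: 'k mpoly ring"]
      by (simp add: monomial_mult ab(1))
  qed
qed

definition variable_prime :: "nat \<Rightarrow> nat set \<Rightarrow> 'k::field mpoly set" where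
  "variable_prime n B = monomial_span n (\<lambda>e. \<exists>i\<in>B. 0 < lk e i)"

lemma upward_closed_variable_prime: "upward_closed (\<lambda>e. \<exists>i\<in>B. 0 < lk e i)"
  by (auto simp: upward_closed_def lookup_add)

lemma variable_prime_is_ideal: "polys.is_ideal n (variable_prime n B)"
  unfolding variable_prime_def by (rule monomial_span_is_ideal[OF upward_closed_variable_prime])

lemma one_not_in_variable_prime: "1 \<notin> variable_prime n B"
  by (auto simp: variable_prime_def monomial_span_def)

lemma variable_in_variable_prime_iff:
  "i < n \<Longrightarrow> variable i \<in> variable_prime n B \<longleftrightarrow> i \<in> B"
  by (auto simp: variable_prime_def variable_def monomial_in_span_iff lookup_single when_def)

text \<open>
  Dropping the monomials that a variable in \<open>B\<close> divides gives a representative modulo the ideal.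
  A product of two such representatives again has no monomial in the ideal, so it lies in the
  ideal only if it vanishes. Since polynomials have no zero divisors, the ideal is prime.
\<close>

lemma split_off_variable_prime:
  assumes "p \<in> polys n"
  shows "\<exists>q\<in>polys n. p - q \<in> variable_prime n B \<and> (\<forall>e\<in>Poly_Mapping.keys q. \<forall>i\<in>B. lk e i = 0)"
proof -
  define q where "q = (\<Sum>e\<in>{e \<in> Poly_Mapping.keys p. \<forall>i\<in>B. lk e i = 0}. Poly_Mapping.single 0 (Poly_Mapping.lookup p e) * monomial e)"
  define r where "r = (\<Sum>e\<in>{e \<in> Poly_Mapping.keys p. \<not> (\<forall>i\<in>B. lk e i = 0)}. Poly_Mapping.single 0 (Poly_Mapping.lookup p e) * monomial e)"
  have p: "\<And>e. e \<in> Poly_Mapping.keys p \<Longrightarrow> Poly_Mapping.keys e \<subseteq> {..<n}"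
    using assms by (simp add: polys_def)
  have "p = q + r"
    unfolding q_def r_def
    by (subst sum_monomials[of p], subst sum.union_disjoint[symmetric]) (auto intro!: sum.cong)
  moreover have "q \<in> polys n"
    unfolding q_def using p
    by (intro polys.sum_mem polys_mult single_zero_in_polys) (simp add: monomial_in_polys_iff)
  moreover have "r \<in> variable_prime n B"
    unfolding r_def using p
    by (intro polys.ideal_sum[OF variable_prime_is_ideal] polys.ideal_mult[OF variable_prime_is_ideal] single_zero_in_polys)
      (simp add: variable_prime_def monomial_in_span_iff)
  moreover have "\<forall>i\<in>B. lk e i = 0" if "e \<in> Poly_Mapping.keys q" for e
  proof -
    have "e \<in> (\<Union>e\<in>{e \<in> Poly_Mapping.keys p. \<forall>i\<in>B. lk e i = 0}. Poly_Mapping.keys (Poly_Mapping.single 0 (Poly_Mapping.lookup p e) * monomial e))"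
      using that keys_sum[of "\<lambda>e. Poly_Mapping.single 0 (Poly_Mapping.lookup p e) * monomial e" "{e \<in> Poly_Mapping.keys p. \<forall>i\<in>B. lk e i = 0}"]
      unfolding q_def by blast
    then show ?thesis by (auto simp: monomial_def mult_single split: if_splits)
  qed
  ultimately show ?thesis by (intro bexI[of _ q]) auto
qed

lemma primeideal_variable_prime:
  "primeideal (variable_prime n B) (mpoly_ring n :: 'k::field mpoly ring)"
proof (rule primeidealI)
  let ?P = "variable_prime n B :: 'k mpoly set"
  note P = variable_prime_is_ideal[of n B]
  show "ideal ?P (mpoly_ring n)"
    using P by (simp add: ideal_mpoly_ring_iff)
  show "carrier (mpoly_ring n) \<noteq> ?P"
  proof
    assume "carrier (mpoly_ring n) = ?P"
    moreover have "(1 :: 'k mpoly) \<in> carrier (mpoly_ring n)" by simp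
    ultimately have "(1 :: 'k mpoly) \<in> ?P" by blast
    then show False using one_not_in_variable_prime by blast
  qed
  fix a b :: "'k mpoly"
  assume ab: "a \<in> carrier (mpoly_ring n)" "b \<in> carrier (mpoly_ring n)" "a \<otimes>\<^bsub>mpoly_ring n\<^esub> b \<in> ?P"
  obtain a' where a': "a' \<in> polys n" "a - a' \<in> ?P" "\<forall>e\<in>Poly_Mapping.keys a'. \<forall>i\<in>B. lk e i = 0"
    using split_off_variable_prime[of a n B] ab(1) by auto
  obtain b' where b': "b' \<in> polys n" "b - b' \<in> ?P" "\<forall>e\<in>Poly_Mapping.keys b'. \<forall>i\<in>B. lk e i = 0"
    using split_off_variable_prime[of b n B] ab(2) by auto
  have "a * b - a' * b' = b * (a - a') + a' * (b - b')" by (simp add: algebra_simps)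
  then have "a * b - a' * b' \<in> ?P"
    using ab a' b' by (simp add: polys.ideal_add[OF P] polys.ideal_mult[OF P])
  moreover have "a * b \<in> ?P" using ab(3) by simp
  ultimately have "a * b - (a * b - a' * b') \<in> ?P"
    by (metis polys.ideal_diff[OF P])
  then have *: "a' * b' \<in> ?P" by simp
  have "Poly_Mapping.keys (a' * b') = {}"
  proof (rule ccontr)
    assume "Poly_Mapping.keys (a' * b') \<noteq> {}"
    then obtain e where e: "e \<in> Poly_Mapping.keys (a' * b')" by blast
    then obtain c d where "e = c + d" "c \<in> Poly_Mapping.keys a'" "d \<in> Poly_Mapping.keys b'"
      using keys_mult by blast
    then have "\<forall>i\<in>B. lk e i = 0" using a'(3) b'(3) by (simp add: lookup_add)
    then show False using * e by (auto simp: variable_prime_def monomial_span_def)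
  qed
  then have "a' * b' = 0" by simp
  then have "a' = 0 \<or> b' = 0" by simp
  then show "a \<in> ?P \<or> b \<in> ?P" using a'(2) b'(2) by auto
qed (rule mpoly_ring_cring)

lemma primeideal_contains_variable:
  assumes P: "primeideal P (mpoly_ring n :: 'k::field mpoly ring)" and e: "Poly_Mapping.keys e \<subseteq> {..<n}"
    and "monomial e \<in> P"
  shows "\<exists>i\<in>Poly_Mapping.keys e. variable i \<in> P"
  using e \<open>monomial e \<in> P\<close>
proof (induction "\<Sum>i<n. lk e i" arbitrary: e rule: less_induct)
  case less
  interpret P: primeideal P "mpoly_ring n :: 'k mpoly ring" by (rule P)
  have "e \<noteq> 0"
  proof
    assume "e = 0"
    then have "\<one>\<^bsub>mpoly_ring n\<^esub> \<in> P" using less.prems(2) by (simp add: monomial_zero)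
    then show False using P.one_imp_carrier P.I_notcarr by blast
  qed
  then obtain i where i: "i \<in> Poly_Mapping.keys e" by fastforce
  then have le: "lk (unit_exponent i) l \<le> lk e l" for l
    by (auto simp: in_keys_iff lookup_single when_def)
  have split: "e = unit_exponent i + (e - unit_exponent i)"
    using exponent_split[OF le] by (simp add: add.commute)
  have kd: "Poly_Mapping.keys (e - unit_exponent i) \<subseteq> Poly_Mapping.keys e"
    by (rule keys_diff_exponent)
  have "variable i * monomial (e - unit_exponent i) \<in> P"
    using less.prems(2) split by (simp add: variable_mult_monomial)
  then have "variable i \<in> P \<or> monomial (e - unit_exponent i) \<in> P"
  proof -
    have "i < n" using i less.prems(1) by auto
    moreover have "Poly_Mapping.keys (e - unit_exponent i) \<subseteq> {..<n}" using kd less.prems(1) by blast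
    ultimately show ?thesis
      using P.I_prime[of "variable i" "monomial (e - unit_exponent i)"] \<open>variable i * monomial (e - unit_exponent i) \<in> P\<close>
      by (simp add: monomial_in_polys_iff)
  qed
  moreover have "(\<Sum>l<n. lk (e - unit_exponent i) l) < (\<Sum>l<n. lk e l)"
  proof (rule sum_strict_mono_ex1)
    show "\<exists>l\<in>{..<n}. lk (e - unit_exponent i) l < lk e l"
    proof
      show "i \<in> {..<n}" using i less.prems(1) by blast
      show "lk (e - unit_exponent i) i < lk e i" using i by (simp add: lookup_minus in_keys_iff)
    qed
  qed (auto simp: lookup_minus)
  ultimately show ?case
    using less.hyps[of "e - unit_exponent i"] less.prems(1) kd i by blast
qed

section \<open>A Koszul obstruction to long regular sequences\<close>

context subring_of_type
begin

text \<open>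
  For the variables \<open>x\<^sub>j = g j\<close> and \<open>y\<^sub>j = g (m + j)\<close> this is the wedge product, over the entries
  \<open>j\<close> of the list, of the Koszul syzygies \<open>y\<^sub>j e\<^sub>j - x\<^sub>j e\<^sub>m\<^sub>+\<^sub>j\<close>, multiplied by \<open>F\<close>.
\<close>

definition syzygy_wedge :: "(nat \<Rightarrow> 'a) \<Rightarrow> nat \<Rightarrow> 'a \<Rightarrow> nat list \<Rightarrow> nat set \<Rightarrow> 'a" where
  "syzygy_wedge g m F js = foldr
     (\<lambda>j. wedge (\<lambda>l. if l = j then g (m + j) else if l = m + j then - g j else 0)) js
     (\<lambda>A. if A = {} then F else 0)"

lemma syzygy_wedge_Cons:
  "syzygy_wedge g m F (j # js) =
    wedge (\<lambda>l. if l = j then g (m + j) else if l = m + j then - g j else 0) (syzygy_wedge g m F js)"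
  by (simp add: syzygy_wedge_def)

text \<open>
  Each factor pairs to \<open>y\<^sub>j x\<^sub>j - x\<^sub>j y\<^sub>j = 0\<close> with \<open>g\<close>.
\<close>

lemma koszul_diff_syzygy_wedge:
  assumes "set js \<subseteq> {..<m}" "A \<subseteq> {..<2 * m}"
  shows "koszul_diff {..<2 * m} g (syzygy_wedge g m F js) A = 0"
  using assms
proof (induction js arbitrary: A)
  case Nil
  then show ?case by (simp add: syzygy_wedge_def koszul_diff_def)
next
  case (Cons j js)
  let ?c = "\<lambda>l. if l = j then g (m + j) else if l = m + j then - g j else 0"
  have jm: "j < m" using Cons.prems by simp
  have "(\<Sum>i<2 * m. ?c i * g i) = (\<Sum>i\<in>{j, m + j}. ?c i * g i)"
    using jm by (intro sum.mono_neutral_right) auto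
  also have "\<dots> = 0" using jm by (simp add: mult.commute)
  finally have "koszul_diff {..<2 * m} g (wedge ?c (syzygy_wedge g m F js)) A
      + wedge ?c (koszul_diff {..<2 * m} g (syzygy_wedge g m F js)) A = 0"
    using koszul_diff_wedge[of "{..<2 * m}" A g ?c "syzygy_wedge g m F js"] Cons.prems(2)
    by simp
  moreover have "wedge ?c (koszul_diff {..<2 * m} g (syzygy_wedge g m F js)) A = 0"
  proof -
    have "koszul_diff {..<2 * m} g (syzygy_wedge g m F js) (A - {l}) = 0" for l
      using Cons.prems by (intro Cons.IH) auto
    then show ?thesis by (simp add: wedge_def)
  qed
  ultimately show ?case
    by (simp add: syzygy_wedge_Cons)
qed

text \<open>
  Expanding the wedge product, every coefficient is a signed sum of products of \<open>F\<close> with one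
  variable from each pair \<open>x\<^sub>j, y\<^sub>j\<close>.
\<close>

lemma syzygy_wedge_in_ideal:
  assumes J: "is_ideal J" and g: "\<And>i. i < 2 * m \<Longrightarrow> g i \<in> C" and js: "set js \<subseteq> {..<m}"
    and h: "\<And>\<sigma>. h * (F * (\<Prod>j\<leftarrow>js. if \<sigma> j then g j else g (m + j))) \<in> J"
    and "distinct js"
  shows "h * syzygy_wedge g m F js A \<in> J"
  using js h \<open>distinct js\<close>
proof (induction js arbitrary: h A)
  case Nil
  then show ?case using ideal_zero[OF J] by (auto simp: syzygy_wedge_def)
next
  case (Cons j js)
  let ?z = "syzygy_wedge g m F js"
  let ?c = "\<lambda>l. if l = j then g (m + j) else if l = m + j then - g j else 0"
  have mem: "(h * (if s then g j else g (m + j))) * ?z B \<in> J" for s B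
  proof (rule Cons.IH)
    fix \<sigma>
    have "(\<Prod>i\<leftarrow>js. if (\<sigma>(j := s)) i then g i else g (m + i)) = (\<Prod>i\<leftarrow>js. if \<sigma> i then g i else g (m + i))"
      using Cons.prems(3) by (intro arg_cong[of _ _ prod_list] map_cong) auto
    then show "h * (if s then g j else g (m + j)) * (F * (\<Prod>i\<leftarrow>js. if \<sigma> i then g i else g (m + i))) \<in> J"
      using Cons.prems(2)[of "\<sigma>(j := s)"] by (simp add: mult_ac)
  qed (use Cons.prems in auto)
  have "koszul_sign l A * (h * ?c l * ?z (A - {l})) \<in> J" for l
  proof (rule ideal_mult[OF J koszul_sign_mem])
    show "h * ?c l * ?z (A - {l}) \<in> J"
      using mem[of False "A - {l}"] ideal_uminus[OF J mem[of True "A - {l}"]] ideal_zero[OF J] Cons.prems(1) by auto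
  qed
  then have "(\<Sum>l\<in>A. koszul_sign l A * (h * ?c l * ?z (A - {l}))) \<in> J"
    by (intro ideal_sum[OF J])
  then show ?case
    by (simp add: syzygy_wedge_Cons wedge_def sum_distrib_left mult_ac)
qed

lemma syzygy_wedge_mem:
  assumes g: "\<And>i. i < 2 * m \<Longrightarrow> g i \<in> C" and "set js \<subseteq> {..<m}" "F \<in> C"
  shows "syzygy_wedge g m F js A \<in> C"
  using assms(2)
proof (induction js arbitrary: A)
  case (Cons j js)
  have "(if l = j then g (m + j) else if l = m + j then - g j else 0) \<in> C" for l
    using Cons.prems g[of j] g[of "m + j"] uminus_mem[of "g j"] by auto
  then show ?case
    unfolding syzygy_wedge_Cons wedge_def
    using Cons by (intro sum_mem mult_mem koszul_sign_mem) auto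
qed (simp add: syzygy_wedge_def assms)

lemma koszul_sign_cases: "koszul_sign i A = (1 :: 'a) \<or> koszul_sign i A = (- 1 :: 'a)"
  by (cases "even (card {j \<in> A. j < i})") (auto simp: koszul_sign_def)

text \<open>
  At the set of all \<open>x\<^sub>j\<close> only one term of the expansion survives, the one that takes the
  coefficient \<open>y\<^sub>j\<close> from each factor.
\<close>

lemma syzygy_wedge_at_first_variables:
  assumes "set js \<subseteq> {..<m}" "distinct js"
  shows "\<exists>s\<in>{1, - 1}. syzygy_wedge g m F js (set js) = s * (F * (\<Prod>j\<leftarrow>js. g (m + j)))"
  using assms
proof (induction js)
  case Nil
  then show ?case by (simp add: syzygy_wedge_def)
next
  case (Cons j js)
  let ?z = "syzygy_wedge g m F js"
  let ?c = "\<lambda>l. if l = j then g (m + j) else if l = m + j then - g j else 0"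
  let ?A = "set (j # js)"
  have "wedge ?c ?z ?A = (\<Sum>l\<in>{j}. koszul_sign l ?A * ?c l * ?z (?A - {l}))"
    unfolding wedge_def using Cons.prems by (intro sum.mono_neutral_right) auto
  also have "?A - {j} = set js" using Cons.prems by auto
  then have "(\<Sum>l\<in>{j}. koszul_sign l ?A * ?c l * ?z (?A - {l})) = koszul_sign j ?A * g (m + j) * ?z (set js)"
    by simp
  finally have eq: "syzygy_wedge g m F (j # js) ?A = koszul_sign j ?A * g (m + j) * ?z (set js)"
    by (simp add: syzygy_wedge_Cons)
  obtain s where "s \<in> {1, - 1}" "?z (set js) = s * (F * (\<Prod>j\<leftarrow>js. g (m + j)))"
    using Cons.IH Cons.prems by (metis distinct.simps(2) insert_subset list.simps(15))
  then show ?case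
    unfolding eq using koszul_sign_cases[of j ?A]
    by (intro bexI[of _ "koszul_sign j ?A * s"]) (auto simp: mult_ac)
qed

text \<open>
  The hypothesis on \<open>J\<close> makes \<open>z = e\<^sub>0 \<and> e\<^sub>m \<and> \<And>\<^bsub>j>0\<^esub> (y\<^sub>j e\<^sub>j - x\<^sub>j e\<^sub>m\<^sub>+\<^sub>j) F\<close> a cycle of degree
  \<open>m + 1\<close> modulo \<open>J\<close>: its differential only has coefficients \<open>x\<^sub>0\<close> or \<open>y\<^sub>0\<close> times those of the
  wedge product. Suppose that \<open>z = \<partial>w\<close> modulo \<open>J\<close>, and compare the differentials at the set of all
  \<open>x\<^sub>j\<close>. On one side it is \<open>F y\<^sub>0 \<dots> y\<^sub>m\<^sub>-\<^sub>1\<close> up to sign. On the other side \<open>\<partial>\<partial>w = 0\<close>, and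
  only the \<open>y\<^sub>j\<close> are missing from this set, so that a combination of the \<open>y\<^sub>j\<close> with coefficients in
  \<open>J\<close> remains.
\<close>

lemma koszul_exact_imp_member:
  assumes J: "is_ideal J" and g: "\<And>i. i < 2 * m \<Longrightarrow> g i \<in> C" and F: "F \<in> C" and m: "0 < m"
    and mem: "\<And>\<sigma>. F * (\<Prod>j<m. if \<sigma> j then g j else g (m + j)) \<in> J"
    and ex: "koszul_exact {..<2 * m} g J (Suc m)"
  shows "\<exists>q. (\<forall>j<m. q j \<in> J) \<and> F * (\<Prod>j<m. g (m + j)) = (\<Sum>j<m. g (m + j) * q j)"
proof -
  let ?V = "{..<2 * m}"
  let ?e = "\<lambda>i l. if l = i then 1 else (0 :: 'a)"
  \<comment> \<open>The first pair is left out: it enters through \<open>e\<^sub>0 \<and> e\<^sub>m\<close>, whose differential supplies the missing \<open>x\<^sub>0\<close> or \<open>y\<^sub>0\<close>.\<close>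
  define P where "P = syzygy_wedge g m F [1..<m]"
  define z where "z = wedge (?e 0) (wedge (?e m) P)"
  have prod_split: "(\<Prod>j<m. h j) = h 0 * (\<Prod>j\<leftarrow>[1..<m]. h j)" for h :: "nat \<Rightarrow> 'a"
  proof -
    have "(\<Prod>j<m. h j) = prod_list (map h [0..<m])"
      using prod.distinct_set_conv_list[of "[0..<m]" h] by (simp add: atLeast0LessThan)
    then show ?thesis using m by (simp add: upt_conv_Cons)
  qed
  have PC: "P A \<in> C" for A
    unfolding P_def by (rule syzygy_wedge_mem) (use g F in auto)
  have PJ: "g i * P A \<in> J" if "i = 0 \<or> i = m" for i A
    unfolding P_def
  proof (rule syzygy_wedge_in_ideal[OF J g])
    fix \<sigma>
    have "F * (\<Prod>j<m. if (\<sigma>(0 := (i = 0))) j then g j else g (m + j)) \<in> J" by (rule mem)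
    moreover have "(\<Prod>j\<leftarrow>[1..<m]. if (\<sigma>(0 := (i = 0))) j then g j else g (m + j)) = (\<Prod>j\<leftarrow>[1..<m]. if \<sigma> j then g j else g (m + j))"
      by (intro arg_cong[of _ _ prod_list] map_cong) auto
    ultimately show "g i * (F * (\<Prod>j\<leftarrow>[1..<m]. if \<sigma> j then g j else g (m + j))) \<in> J"
      using that by (auto simp: prod_split mult_ac split: if_splits)
  qed auto
  have dP: "koszul_diff ?V g P A = 0" if "A \<subseteq> ?V" for A
    unfolding P_def using that by (intro koszul_diff_syzygy_wedge) auto
  have pair: "(\<Sum>l<2 * m. ?e i l * g l) = g i" if "i < 2 * m" for i
  proof -
    have "(\<Sum>l<2 * m. ?e i l * g l) = (\<Sum>l\<in>{i}. ?e i l * g l)"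
      using that by (intro sum.mono_neutral_right) auto
    then show ?thesis by simp
  qed
  have d1: "koszul_diff ?V g (wedge (?e m) P) A = g m * P A" if "A \<subseteq> ?V" for A
  proof -
    have "wedge (?e m) (koszul_diff ?V g P) A = 0"
    proof -
      have "koszul_diff ?V g P (A - {l}) = 0" for l
        using that by (intro dP) auto
      then show ?thesis by (simp add: wedge_def)
    qed
    then show ?thesis
      using koszul_diff_wedge[of ?V A g "?e m" P] that pair[of m] m by simp
  qed
  have dz: "koszul_diff ?V g z A = g 0 * wedge (?e m) P A - wedge (?e 0) (\<lambda>B. g m * P B) A" if A: "A \<subseteq> ?V" for A
  proof -
    have "wedge (?e 0) (koszul_diff ?V g (wedge (?e m) P)) A = wedge (?e 0) (\<lambda>B. g m * P B) A"
    proof -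
      have "koszul_diff ?V g (wedge (?e m) P) (A - {l}) = g m * P (A - {l})" for l
        using A by (intro d1) auto
      then show ?thesis by (simp add: wedge_def[of _ _ A])
    qed
    then show ?thesis
      using koszul_diff_wedge[of ?V A g "?e 0" "wedge (?e m) P"] A pair[of 0] m
      by (simp add: z_def eq_diff_eq)
  qed
  have eC: "?e i l \<in> C" for i l by simp
  have zC: "z A \<in> C" for A
    unfolding z_def wedge_def by (intro sum_mem mult_mem koszul_sign_mem PC eC)
  have cyc: "koszul_diff ?V g z A \<in> J" if A: "A \<subseteq> ?V" for A
  proof -
    have "(\<Sum>l\<in>A. koszul_sign l A * ?e m l * (g 0 * P (A - {l}))) \<in> J"
      by (intro ideal_sum[OF J] ideal_mult[OF J] mult_mem koszul_sign_mem eC PJ) simp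
    moreover have "(\<Sum>l\<in>A. koszul_sign l A * ?e 0 l * (g m * P (A - {l}))) \<in> J"
      by (intro ideal_sum[OF J] ideal_mult[OF J] mult_mem koszul_sign_mem eC PJ) simp
    ultimately show ?thesis
      unfolding dz[OF A] wedge_def using ideal_diff[OF J]
      by (simp add: sum_distrib_left mult_ac)
  qed
  obtain w where w: "\<And>A. A \<subseteq> ?V \<Longrightarrow> card A = Suc m \<Longrightarrow> z A - koszul_diff ?V g w A \<in> J"
    using ex[unfolded koszul_exact_def, rule_format, of z] zC cyc by auto
  define A0 where "A0 = {..<m}"
  have A0: "A0 \<subseteq> ?V" by (auto simp: A0_def)
  define r where "r j = koszul_sign (m + j) A0 * (z (insert (m + j) A0) - koszul_diff ?V g w (insert (m + j) A0))" for j
  have rJ: "r j \<in> J" if "j < m" for j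
    unfolding r_def using that by (intro ideal_mult[OF J] koszul_sign_mem w) (auto simp: A0_def)
  have "?V - A0 = (\<lambda>j. m + j) ` {..<m}"
  proof -
    have "x \<in> (\<lambda>j. m + j) ` {..<m}" if "x \<in> ?V - A0" for x
      using that by (intro image_eqI[of _ _ "x - m"]) (auto simp: A0_def)
    then show ?thesis by (auto simp: A0_def)
  qed
  then have "(\<Sum>j<m. g (m + j) * r j) = (\<Sum>i\<in>?V - A0. koszul_sign i A0 * g i * (z (insert i A0) - koszul_diff ?V g w (insert i A0)))"
    by (simp add: sum.reindex r_def mult_ac)
  also have "\<dots> = koszul_diff ?V g z A0 - koszul_diff ?V g (koszul_diff ?V g w) A0"
    unfolding koszul_diff_def[of _ _ _ A0] by (simp add: sum_subtractf algebra_simps)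
  also have "\<dots> = koszul_diff ?V g z A0"
    using koszul_diff_koszul_diff[OF _ A0] by simp
  also have "\<dots> = - (koszul_sign 0 A0 * (g m * P {1..<m}))"
  proof -
    have "wedge (?e m) P A0 = 0"
      unfolding wedge_def by (intro sum.neutral) (auto simp: A0_def)
    moreover have "wedge (?e 0) (\<lambda>B. g m * P B) A0 = (\<Sum>l\<in>{0}. koszul_sign l A0 * ?e 0 l * (g m * P (A0 - {l})))"
      unfolding wedge_def using m by (intro sum.mono_neutral_right) (auto simp: A0_def)
    moreover have "A0 - {0} = {1..<m}" by (auto simp: A0_def)
    ultimately show ?thesis unfolding dz[OF A0] by simp
  qed
  finally have sum_eq: "(\<Sum>j<m. g (m + j) * r j) = - (koszul_sign 0 A0 * (g m * P {1..<m}))" .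
  have "\<exists>s\<in>{1, - 1}. P (set [1..<m]) = s * (F * (\<Prod>j\<leftarrow>[1..<m]. g (m + j)))"
    unfolding P_def by (rule syzygy_wedge_at_first_variables) auto
  then obtain s where s: "s \<in> {1, - 1}" "P {1..<m} = s * (F * (\<Prod>j\<leftarrow>[1..<m]. g (m + j)))"
    unfolding set_upt by blast
  \<comment> \<open>All signs collected; as \<open>u\<close> is its own inverse, it can be moved into the coefficients.\<close>
  define u where "u = - (koszul_sign 0 A0 * s)"
  have u: "u * u = 1" "u \<in> C"
    using s(1) koszul_sign_cases[of 0 A0] one_mem uminus_mem[OF one_mem] by (auto simp: u_def)
  have "(\<Sum>j<m. g (m + j) * r j) = u * (F * (\<Prod>j<m. g (m + j)))"
    unfolding sum_eq s(2) by (simp add: u_def prod_split mult_ac)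
  moreover have "(\<Sum>j<m. g (m + j) * (u * r j)) = u * (\<Sum>j<m. g (m + j) * r j)"
    by (simp add: sum_distrib_left mult.left_commute)
  ultimately have "(\<Sum>j<m. g (m + j) * (u * r j)) = (u * u) * (F * (\<Prod>j<m. g (m + j)))"
    by (simp only: mult.assoc)
  then show ?thesis
    using u rJ by (intro exI[of _ "\<lambda>j. u * r j"]) (auto intro: ideal_mult[OF J])
qed

end
lemma mem_homogeneous_maximal_idealD:
  assumes "f \<in> homogeneous_maximal_ideal n"
  shows "\<exists>c. (\<forall>i. c i \<in> polys n) \<and> f = (\<Sum>i<n. c i * (variable i :: 'k::field mpoly))"
proof -
  let ?S = "{f. \<exists>c. (\<forall>i. c i \<in> polys n) \<and> f = (\<Sum>i<n. c i * (variable i :: 'k mpoly))}"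
  have "polys.is_ideal n ?S"
    unfolding polys.is_ideal_def
  proof (intro conjI ballI)
    show "?S \<subseteq> polys n"
      by (auto intro!: polys.sum_mem polys_mult)
    show "0 \<in> ?S"
      by (auto intro!: exI[of _ "\<lambda>_. 0"])
    show "a + b \<in> ?S" if a: "a \<in> ?S" and b: "b \<in> ?S" for a b
    proof -
      obtain c d where "\<forall>i. c i \<in> polys n" "a = (\<Sum>i<n. c i * variable i)"
        "\<forall>i. d i \<in> polys n" "b = (\<Sum>i<n. d i * variable i)" using a b by auto
      then show ?thesis
        by (auto intro!: exI[of _ "\<lambda>i. c i + d i"] polys_add simp: algebra_simps sum.distrib)
    qed
    show "q * a \<in> ?S" if q: "q \<in> polys n" and a: "a \<in> ?S" for q a
    proof -
      obtain c where "\<forall>i. c i \<in> polys n" "a = (\<Sum>i<n. c i * variable i)" using a by auto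
      then show ?thesis
        using q by (auto intro!: exI[of _ "\<lambda>i. q * c i"] polys_mult simp: sum_distrib_left mult_ac)
    qed
  qed
  moreover have "variable ` {..<n} \<subseteq> ?S"
  proof (clarsimp)
    fix i assume i: "i < n"
    have "(variable i :: 'k mpoly) = (\<Sum>l<n. (if l = i then 1 else 0) * variable l)"
      using i by (simp add: if_distrib[of "\<lambda>x. x * _"] cong: if_cong)
    then show "\<exists>c. (\<forall>i. c i \<in> polys n) \<and> (variable i :: 'k mpoly) = (\<Sum>l<n. c l * variable l)"
      by (intro exI[of _ "\<lambda>l. if l = i then 1 else 0"]) simp
  qed
  ultimately have "homogeneous_maximal_ideal n \<subseteq> ?S"
    unfolding homogeneous_maximal_ideal_def by (rule genideal_least)
  then show ?thesis using assms by auto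
qed

lemma genideal_insertD:
  assumes S: "S \<subseteq> polys n" "f \<in> polys n" and a: "a \<in> Idl\<^bsub>mpoly_ring n\<^esub> (insert f S)"
  shows "\<exists>b\<in>Idl\<^bsub>mpoly_ring n\<^esub> S. \<exists>t\<in>polys n. a = b + f * (t :: 'k::field mpoly)"
proof -
  let ?I = "Idl\<^bsub>mpoly_ring n\<^esub> S :: 'k mpoly set"
  let ?T = "{a. \<exists>b\<in>?I. \<exists>t\<in>polys n. a = b + f * t}"
  note I = is_ideal_genideal[OF S(1)]
  have "polys.is_ideal n ?T"
    unfolding polys.is_ideal_def
  proof (intro conjI ballI)
    show "?T \<subseteq> polys n"
      using polys.ideal_subset[OF I] S(2) by (auto intro!: polys_add polys_mult)
    show "0 \<in> ?T"
      using polys.ideal_zero[OF I] by (auto intro!: bexI[of _ 0])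
    show "x + y \<in> ?T" if x: "x \<in> ?T" and y: "y \<in> ?T" for x y
    proof -
      obtain b t c u where *: "b \<in> ?I" "t \<in> polys n" "x = b + f * t" "c \<in> ?I" "u \<in> polys n" "y = c + f * u"
        using x y by auto
      then have "x + y = (b + c) + f * (t + u)" by (simp add: algebra_simps)
      then show ?thesis using * polys.ideal_add[OF I] polys_add by blast
    qed
    show "q * x \<in> ?T" if q: "q \<in> polys n" and x: "x \<in> ?T" for q x
    proof -
      obtain b t where *: "b \<in> ?I" "t \<in> polys n" "x = b + f * t" using x by auto
      then have "q * x = q * b + f * (q * t)" by (simp add: algebra_simps)
      then show ?thesis using * q polys.ideal_mult[OF I] polys_mult by blast
    qed
  qed
  moreover have "insert f S \<subseteq> ?T"
  proof -
    have "f = 0 + f * 1" "\<And>s. s = s + f * 0" by simp_all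
    then show ?thesis
      using polys.ideal_zero[OF I] genideal_contains[of S n] polys_one polys_zero by blast
  qed
  ultimately show ?thesis
    using genideal_least[of n ?T "insert f S"] a by blast
qed

lemma genideal_of_ideal:
  assumes "polys.is_ideal n J"
  shows "Idl\<^bsub>mpoly_ring n\<^esub> J = (J :: 'k::field mpoly set)"
  using genideal_least[OF assms order_refl] genideal_contains by blast

text \<open>
  There are no chains of degree above \<open>n\<close>, and each member of a regular sequence lowers the bound
  by one. This is the inequality between depth and projective dimension in its elementary form.
\<close>

lemma koszul_exact_of_regular_sequence:
  fixes J :: "'k::field mpoly set"
  assumes J: "polys.is_ideal n J"
    and reg: "regular_sequence (mpoly_ring n) (quotient_module (mpoly_ring n) J) fs"
    and fs: "set fs \<subseteq> homogeneous_maximal_ideal n" and s: "s \<le> length fs" "s \<le> Suc n"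
  shows "polys.koszul_exact n {..<n} variable J (Suc n - s)"
proof -
  define Js where "Js i = Idl\<^bsub>mpoly_ring n\<^esub> (J \<union> set (take i fs))" for i
  have idJ: "ideal J (mpoly_ring n)" using J by (simp add: ideal_mpoly_ring_iff)
  have fsR: "set fs \<subseteq> polys n"
    and nzd: "\<And>i p. i < length fs \<Longrightarrow> p \<in> polys n \<Longrightarrow> fs ! i * p \<in> Js i \<Longrightarrow> p \<in> Js i"
    using reg unfolding regular_sequence_quotient_module_iff[OF mpoly_ring_cring idJ] Js_def by auto
  have JsP: "J \<union> set (take i fs) \<subseteq> polys n" for i
    using fsR polys.ideal_subset[OF J] set_take_subset[of i fs] by auto
  have "polys.koszul_exact n {..<n} variable (Js i) (Suc n - s + i)" if "i \<le> s" for i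
    using that
  proof (induction i rule: inc_induct)
    case base
    show ?case using s(2) by (intro polys.koszul_exact_above) auto
  next
    case (step i)
    have i: "i < length fs" using step.hyps s by simp
    then have fi: "fs ! i \<in> set fs" by simp
    obtain c where c: "\<And>l. c l \<in> polys n" "fs ! i = (\<Sum>l<n. c l * variable l)"
      using mem_homogeneous_maximal_idealD fs fi by blast
    have ins: "J \<union> set (take (Suc i) fs) = insert (fs ! i) (J \<union> set (take i fs))"
      using i by (simp add: take_Suc_conv_app_nth)
    show ?case
    proof (rule polys.koszul_exact_step[where f = "fs ! i" and c = c and J' = "Js (Suc i)"])
      show "\<exists>b\<in>Js i. \<exists>t\<in>polys n. a = b + fs ! i * t" if "a \<in> Js (Suc i)" for a
        using genideal_insertD[OF JsP[of i], of "fs ! i" a] fsR fi that by (auto simp: Js_def ins)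
      show "Js i \<subseteq> Js (Suc i)"
        unfolding Js_def
        by (rule genideal_least[OF is_ideal_genideal[OF JsP]])
          (use genideal_contains[of "J \<union> set (take (Suc i) fs)" n] ins in auto)
      show "fs ! i \<in> Js (Suc i)"
        using genideal_contains[of "J \<union> set (take (Suc i) fs)" n] ins by (auto simp: Js_def)
      show "polys.koszul_exact n {..<n} variable (Js (Suc i)) (Suc (Suc n - s + i))"
        using step.IH by simp
      show "polys.is_ideal n (Js i)" "polys.is_ideal n (Js (Suc i))"
        using is_ideal_genideal[OF JsP] by (simp_all add: Js_def)
      show "a \<in> Js i" if "a \<in> polys n" "fs ! i * a \<in> Js i" for a
        using nzd[OF i] that by blast
    qed (use c in auto)
  qed
  from this[of 0] show ?thesis
    by (simp add: Js_def genideal_of_ideal[OF J])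
qed

section \<open>The ideal and its powers\<close>

text \<open>
  Write \<open>x\<^sub>i\<close> and \<open>y\<^sub>i\<close> for the variables with numbers \<open>i\<close> and \<open>m + i\<close>, where \<open>i < m\<close>. These are the
  exponents of the monomials in \<open>I\<^sup>k\<close> for the ideal \<open>I\<close> generated by \<open>x\<^sub>0 \<dots> x\<^sub>m\<^sub>-\<^sub>1\<close> and by the
  monomials that arise from it when one \<open>x\<^sub>i\<close> is replaced by \<open>y\<^sub>i\<close>. A product of \<open>k\<close> generators that
  replaces \<open>x\<^sub>i\<close> exactly \<open>b\<^sub>i\<close> times is \<open>\<Prod> x\<^sub>i\<^bsup>k - b\<^sub>i\<^esup> y\<^sub>i\<^bsup>b\<^sub>i\<^esup>\<close> with \<open>\<Sum> b\<^sub>i \<le> k\<close>. To divide a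
  given monomial, \<open>b\<^sub>i\<close> has to be at least the truncated difference of \<open>k\<close> and the exponent of
  \<open>x\<^sub>i\<close>, and it is best to take this value.
\<close>

definition power_exponent :: "nat \<Rightarrow> nat \<Rightarrow> exponent \<Rightarrow> bool" where
  "power_exponent m k e \<longleftrightarrow>
    (\<forall>i<m. k \<le> lk e i + lk e (m + i)) \<and> (\<Sum>i<m. k - lk e i) \<le> k"

definition example_ideal :: "nat \<Rightarrow> 'k::field mpoly set" where
  "example_ideal m = monomial_span (2 * m) (power_exponent m 1)"

lemma upward_closed_power_exponent: "upward_closed (power_exponent m k)"
  unfolding upward_closed_def power_exponent_def
proof (intro allI impI conjI)
  fix a b :: exponent
  assume a: "(\<forall>i<m. k \<le> lk a i + lk a (m + i)) \<and> (\<Sum>i<m. k - lk a i) \<le> k"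
  show "k \<le> lk (a + b) i + lk (a + b) (m + i)" if "i < m" for i
  proof -
    have "k \<le> lk a i + lk a (m + i)" using a that by blast
    then show ?thesis by (simp add: lookup_add)
  qed
  have "(\<Sum>i<m. k - lk (a + b) i) \<le> (\<Sum>i<m. k - lk a i)"
    by (intro sum_mono) (simp add: lookup_add)
  then show "(\<Sum>i<m. k - lk (a + b) i) \<le> k" using a by linarith
qed

lemma power_exponent_zero: "power_exponent m 0 e"
  by (simp add: power_exponent_def)

lemma power_exponent_add:
  assumes a: "power_exponent m k a" and b: "power_exponent m l b"
  shows "power_exponent m (k + l) (a + b)"
  unfolding power_exponent_def
proof (intro allI impI conjI)
  show "k + l \<le> lk (a + b) i + lk (a + b) (m + i)" if "i < m" for i
  proof -
    have "k \<le> lk a i + lk a (m + i)" "l \<le> lk b i + lk b (m + i)"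
      using a b that by (auto simp: power_exponent_def)
    then show ?thesis by (simp add: lookup_add)
  qed
  have "(\<Sum>i<m. k + l - lk (a + b) i) \<le> (\<Sum>i<m. (k - lk a i) + (l - lk b i))"
    by (intro sum_mono) (simp add: lookup_add)
  also have "\<dots> \<le> k + l"
    using a b by (simp add: power_exponent_def sum.distrib add_mono)
  finally show "(\<Sum>i<m. k + l - lk (a + b) i) \<le> k + l" .
qed

definition generator_exponent :: "nat \<Rightarrow> nat \<Rightarrow> exponent" where
  "generator_exponent m i = expo (2 * m) (\<lambda>l. if l = m + i \<or> (l < m \<and> l \<noteq> i) then 1 else 0)"

definition base_exponent :: "nat \<Rightarrow> exponent" where
  "base_exponent m = expo (2 * m) (\<lambda>l. if l < m then 1 else 0)"

lemma power_exponent_base: "power_exponent m 1 (base_exponent m)"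
  by (simp add: power_exponent_def base_exponent_def)

lemma power_exponent_generator:
  assumes "i < m"
  shows "power_exponent m 1 (generator_exponent m i)"
proof -
  have "(\<Sum>l<m. 1 - lk (generator_exponent m i) l) = (\<Sum>l<m. if l = i then 1 else 0)"
    by (intro sum.cong) (auto simp: generator_exponent_def)
  then show ?thesis
    using assms by (auto simp: power_exponent_def generator_exponent_def)
qed

text \<open>
  One generator can be split off: \<open>x\<^sub>0 \<dots> x\<^sub>m\<^sub>-\<^sub>1\<close> if all exponents of the \<open>x\<^sub>i\<close> exceed \<open>k\<close>, and
  otherwise the generator in which an \<open>x\<^sub>i\<close> of small exponent is replaced.
\<close>

lemma power_exponent_Suc_imp:
  assumes e: "power_exponent m (Suc k) e"
  shows "\<exists>a b. e = a + b \<and> power_exponent m k a \<and> power_exponent m 1 b"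
proof (cases "\<forall>i<m. Suc k \<le> lk e i")
  case True
  let ?b = "base_exponent m"
  have "e = (e - ?b) + ?b"
    by (rule exponent_split) (use True in \<open>force simp: base_exponent_def\<close>)
  moreover have "power_exponent m k (e - ?b)"
  proof -
    have "k \<le> lk (e - ?b) i" if "i < m" for i
      using True that by (fastforce simp: base_exponent_def lookup_minus)
    then show ?thesis by (simp add: power_exponent_def trans_le_add1)
  qed
  ultimately show ?thesis using power_exponent_base by blast
next
  case False
  then obtain i where i: "i < m" "lk e i \<le> k" by (auto simp: not_le less_Suc_eq_le)
  have e1: "Suc k \<le> lk e l + lk e (m + l)" if "l < m" for l
    using e that by (simp add: power_exponent_def)
  have e2: "(\<Sum>l<m. Suc k - lk e l) \<le> Suc k"
    using e by (simp add: power_exponent_def)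
  \<comment> \<open>As \<open>x\<^sub>i\<close> contributes to the sum, a missing \<open>x\<^sub>l\<close> would make it exceed \<open>k + 1\<close>.\<close>
  have pos: "1 \<le> lk e l" if l: "l < m" "l \<noteq> i" for l
  proof (rule ccontr)
    assume "\<not> 1 \<le> lk e l"
    have "(\<Sum>j\<in>{i, l}. Suc k - lk e j) \<le> (\<Sum>j<m. Suc k - lk e j)"
      using i l by (intro sum_mono2) auto
    then show False using e2 i l \<open>\<not> 1 \<le> lk e l\<close> by simp
  qed
  let ?b = "generator_exponent m i"
  have le: "lk ?b l \<le> lk e l" for l
    using pos[of l] e1[OF i(1)] i by (auto simp: generator_exponent_def)
  have eq: "e = (e - ?b) + ?b"
    by (rule exponent_split) (rule le)
  have "power_exponent m k (e - ?b)"
    unfolding power_exponent_def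
  proof (intro conjI allI impI)
    show "k \<le> lk (e - ?b) l + lk (e - ?b) (m + l)" if "l < m" for l
      using e1[OF that] that le[of l] le[of "m + l"] i by (auto simp: lookup_minus generator_exponent_def)
    have "(\<Sum>l<m. k - lk (e - ?b) l) = (k - lk e i) + (\<Sum>l\<in>{..<m} - {i}. Suc k - lk e l)"
    proof -
      have "(\<Sum>l\<in>{..<m} - {i}. k - lk (e - ?b) l) = (\<Sum>l\<in>{..<m} - {i}. Suc k - lk e l)"
      proof (intro sum.cong refl)
        fix l assume "l \<in> {..<m} - {i}"
        then show "k - lk (e - ?b) l = Suc k - lk e l"
          using pos[of l] by (auto simp: lookup_minus generator_exponent_def)
      qed
      moreover have "k - lk (e - ?b) i = k - lk e i"
        using i by (simp add: lookup_minus generator_exponent_def)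
      ultimately show ?thesis
        using i by (subst sum.remove[of _ i]) auto
    qed
    moreover have "(\<Sum>l<m. Suc k - lk e l) = (Suc k - lk e i) + (\<Sum>l\<in>{..<m} - {i}. Suc k - lk e l)"
      using i by (subst sum.remove[of _ i]) auto
    ultimately show "(\<Sum>l<m. k - lk (e - ?b) l) \<le> k"
      using e2 i by linarith
  qed
  then show ?thesis using eq power_exponent_generator[OF i(1)] by blast
qed

lemma power_exponent_Suc_iff:
  "power_exponent m (Suc k) e \<longleftrightarrow> (\<exists>a b. e = a + b \<and> power_exponent m k a \<and> power_exponent m 1 b)"
proof
  assume "\<exists>a b. e = a + b \<and> power_exponent m k a \<and> power_exponent m 1 b"
  then obtain a b where ab: "e = a + b" "power_exponent m k a" "power_exponent m 1 b" by blast
  show "power_exponent m (Suc k) e"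
    using power_exponent_add[OF ab(2,3)] ab(1) by simp
qed (rule power_exponent_Suc_imp)

lemma ideal_power_example_ideal:
  "ideal_power (mpoly_ring (2 * m)) (example_ideal m) k =
    (monomial_span (2 * m) (power_exponent m k) :: 'k::field mpoly set)"
proof (induction k)
  case 0
  then show ?case
    by (auto simp: ideal_power_simps power_exponent_zero monomial_span_def simp del: mpoly_ring_simps(2-))
next
  case (Suc k)
  have "ideal_power (mpoly_ring (2 * m)) (example_ideal m) (Suc k) =
      (monomial_span (2 * m) (\<lambda>e. \<exists>a b. e = a + b \<and> power_exponent m k a \<and> power_exponent m 1 b) :: 'k mpoly set)"
    unfolding ideal_power_simps Suc unfolding example_ideal_def
    by (rule ideal_prod_monomial_span) (rule upward_closed_power_exponent)+
  then show ?case
    by (simp only: power_exponent_Suc_iff[symmetric])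
qed

lemma example_ideal_is_ideal: "polys.is_ideal (2 * m) (example_ideal m)"
  unfolding example_ideal_def by (rule monomial_span_is_ideal[OF upward_closed_power_exponent])

text \<open>
  For \<open>k = 1\<close> the condition on exponents only depends on their support.
\<close>

lemma squarefree_example_ideal:
  "squarefree_monomial_ideal (2 * m) (example_ideal m :: 'k::field mpoly set)"
  unfolding squarefree_monomial_ideal_def
proof (intro exI conjI)
  let ?A = "squarefree_monomials (2 * m) \<inter> (example_ideal m :: 'k mpoly set)"
  have A: "?A \<subseteq> polys (2 * m)"
    using polys.ideal_subset[OF example_ideal_is_ideal] by auto
  show "example_ideal m = Idl\<^bsub>mpoly_ring (2 * m)\<^esub> ?A"
  proof
    show "Idl\<^bsub>mpoly_ring (2 * m)\<^esub> ?A \<subseteq> example_ideal m"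
      by (rule genideal_least[OF example_ideal_is_ideal]) simp
    show "example_ideal m \<subseteq> Idl\<^bsub>mpoly_ring (2 * m)\<^esub> ?A"
      unfolding example_ideal_def[of m]
    proof (rule monomial_span_subset[OF is_ideal_genideal])
      show "squarefree_monomials (2 * m) \<inter> monomial_span (2 * m) (power_exponent m 1) \<subseteq> (polys (2 * m) :: 'k mpoly set)"
        using A unfolding example_ideal_def .
      fix e assume e: "Poly_Mapping.keys e \<subseteq> {..<2 * m}" "power_exponent m 1 e"
      define d where "d = expo (2 * m) (\<lambda>i. min 1 (lk e i))"
      have d: "lk d i = min 1 (lk e i)" for i
      proof (cases "i < 2 * m")
        case False
        then have "i \<notin> Poly_Mapping.keys e" using e(1) by auto
        then show ?thesis using False by (simp add: d_def in_keys_iff)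
      qed (simp add: d_def)
      have "(\<Sum>i<m. 1 - lk d i) = (\<Sum>i<m. 1 - lk e i)"
        by (intro sum.cong) (auto simp: d)
      moreover have "1 \<le> lk d i + lk d (m + i)" if "i < m" for i
        using e(2) that by (auto simp: power_exponent_def d)
      ultimately have "power_exponent m 1 d"
        using e(2) by (auto simp: power_exponent_def)
      then have "monomial d \<in> ?A"
        using keys_expo[of "2 * m"] by (auto simp: squarefree_monomials_def example_ideal_def monomial_in_span_iff d) (auto simp: d_def)
      then have "monomial d \<in> Idl\<^bsub>mpoly_ring (2 * m)\<^esub> ?A"
        using genideal_contains by blast
      then show "monomial e \<in> Idl\<^bsub>mpoly_ring (2 * m)\<^esub> (squarefree_monomials (2 * m) \<inter> (monomial_span (2 * m) (power_exponent m 1) :: 'k mpoly set))"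
        using monomial_mem_of_divisor[OF is_ideal_genideal[OF A], of d e] e(1)
        unfolding example_ideal_def by (simp add: d)
    qed
  qed
qed auto

section \<open>The symbolic power has small depth\<close>

text \<open>
  The generator \<open>x\<^sub>0 \<dots> x\<^sub>m\<^sub>-\<^sub>1\<close> puts some \<open>x\<^sub>i\<close> into the prime, and the generator in which this \<open>x\<^sub>i\<close>
  is replaced gives a second variable.
\<close>

lemma prime_over_example_ideal:
  assumes P: "primeideal P (mpoly_ring (2 * m) :: 'k::field mpoly ring)" and sub: "example_ideal m \<subseteq> P"
  shows "\<exists>i<m. \<exists>j. variable i \<in> P \<and> variable j \<in> P \<and> (j = m + i \<or> (j < m \<and> j \<noteq> i))"
proof -
  have "monomial (base_exponent m) \<in> P"
    using sub keys_expo[of "2 * m"] power_exponent_base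
    by (auto simp: example_ideal_def monomial_in_span_iff base_exponent_def)
  then obtain i where i: "i < m" "variable i \<in> P"
    using primeideal_contains_variable[OF P, of "base_exponent m"] keys_expo[of "2 * m"]
    by (auto simp: base_exponent_def in_keys_iff split: if_splits)
  have "monomial (generator_exponent m i) \<in> P"
    using sub keys_expo[of "2 * m"] power_exponent_generator[OF i(1)]
    by (auto simp: example_ideal_def monomial_in_span_iff generator_exponent_def)
  then obtain j where "j \<in> Poly_Mapping.keys (generator_exponent m i)" "variable j \<in> P"
    using primeideal_contains_variable[OF P, of "generator_exponent m i"] keys_expo[of "2 * m"]
    by (auto simp: generator_exponent_def)
  then show ?thesis
    using i by (auto simp: generator_exponent_def in_keys_iff split: if_splits)
qed

lemma variable_prime_subset:
  assumes J: "polys.is_ideal n J" and "\<And>i. i \<in> B \<Longrightarrow> i < n \<Longrightarrow> variable i \<in> J"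
  shows "variable_prime n B \<subseteq> (J :: 'k::field mpoly set)"
  unfolding variable_prime_def
proof (rule monomial_span_subset[OF J])
  fix e assume e: "Poly_Mapping.keys e \<subseteq> {..<n}" "\<exists>i\<in>B. 0 < lk e i"
  then obtain i where i: "i \<in> B" "0 < lk e i" by blast
  then have "i \<in> Poly_Mapping.keys e" by (simp add: in_keys_iff)
  then have "i < n" using e(1) by blast
  then have "monomial (unit_exponent i) \<in> J"
    using assms(2)[OF i(1)] by (simp add: variable_def)
  moreover have "lk (unit_exponent i) l \<le> lk e l" for l
    using i(2) by (auto simp: lookup_single when_def)
  ultimately show "monomial e \<in> J"
    using monomial_mem_of_divisor[OF J] e(1) by blast
qed

lemma example_ideal_subset_variable_prime:
  "j < m \<Longrightarrow> example_ideal m \<subseteq> variable_prime (2 * m) {j, m + j}"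
  by (force simp: example_ideal_def variable_prime_def monomial_span_def power_exponent_def)

text \<open>
  The only pair of variables from the previous lemma that fits into \<open>(x\<^sub>j, y\<^sub>j)\<close> is this pair itself.
\<close>

lemma minimal_prime_of_example_ideal:
  assumes j: "j < m"
  shows "variable_prime (2 * m) {j, m + j} \<in> minimal_primes (mpoly_ring (2 * m)) (example_ideal m :: 'k::field mpoly set)"
  unfolding minimal_primes_def
proof (intro CollectI conjI allI impI)
  fix Q :: "'k mpoly set"
  assume Q: "primeideal Q (mpoly_ring (2 * m))" "example_ideal m \<subseteq> Q" "Q \<subseteq> variable_prime (2 * m) {j, m + j}"
  then obtain i l where il: "i < m" "variable i \<in> Q" "variable l \<in> Q" "l = m + i \<or> (l < m \<and> l \<noteq> i)"
    using prime_over_example_ideal by blast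
  have "i \<in> {j, m + j}" "l \<in> {j, m + j}"
    using il Q(3) variable_in_variable_prime_iff[of i "2 * m" "{j, m + j}", where 'a = 'k]
      variable_in_variable_prime_iff[of l "2 * m" "{j, m + j}", where 'a = 'k] by auto
  then have "i = j" "l = m + j"
    using il by auto
  moreover have "polys.is_ideal (2 * m) Q"
    using Q(1) by (simp add: primeideal_def ideal_mpoly_ring_iff)
  ultimately have "variable_prime (2 * m) {j, m + j} \<subseteq> Q"
    using il by (intro variable_prime_subset) auto
  then show "Q = variable_prime (2 * m) {j, m + j}" using Q(3) by blast
qed (rule primeideal_variable_prime, rule example_ideal_subset_variable_prime[OF j])

lemma ideal_power_variable_pair:
  "ideal_power (mpoly_ring n) (variable_prime n {i, j}) k
    \<subseteq> (monomial_span n (\<lambda>e. k \<le> lk e i + lk e j) :: 'k::field mpoly set)"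
proof (induction k)
  case 0
  then show ?case by (auto simp: ideal_power_simps monomial_span_def simp del: mpoly_ring_simps(2-))
next
  case (Suc k)
  have "ideal_power (mpoly_ring n) (variable_prime n {i, j}) (Suc k) \<subseteq>
      (ideal_prod (mpoly_ring n) (monomial_span n (\<lambda>e. k \<le> lk e i + lk e j))
        (monomial_span n (\<lambda>e. \<exists>l\<in>{i, j}. 0 < lk e l)) :: 'k mpoly set)"
    unfolding ideal_power_simps using Suc by (intro ideal_prod_mono) (auto simp: variable_prime_def)
  also have "\<dots> = monomial_span n (\<lambda>e. \<exists>a b. e = a + b \<and> k \<le> lk a i + lk a j \<and> (\<exists>l\<in>{i, j}. 0 < lk b l))"
    by (rule ideal_prod_monomial_span) (auto simp: upward_closed_def lookup_add)
  also have "\<dots> \<subseteq> monomial_span n (\<lambda>e. Suc k \<le> lk e i + lk e j)"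
    by (auto simp: monomial_span_def) (force simp: lookup_add)+
  finally show ?case .
qed

lemma monomial_in_ideal_power:
  assumes P: "ideal P (mpoly_ring n :: 'k::field mpoly ring)" and ij: "variable i \<in> P" "variable j \<in> P"
    and e: "Poly_Mapping.keys e \<subseteq> {..<n}" "k \<le> lk e i" "0 < (if j = i then lk e i - k else lk e j)"
  shows "monomial e \<in> ideal_power (mpoly_ring n) P (Suc k)"
proof -
  have pow: "variable i ^ s \<in> ideal_power (mpoly_ring n) P s" for s
  proof (induction s)
    case (Suc s)
    then show ?case
      using ideal_prod.prod[OF Suc ij(1), where R = "mpoly_ring n"] by (simp add: ideal_power_simps mult.commute)
  qed (simp add: ideal_power_simps)
  let ?d = "Poly_Mapping.single i k + unit_exponent j"
  have "variable i ^ k * variable j \<in> ideal_power (mpoly_ring n) P (Suc k)"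
    using ideal_prod.prod[OF pow[of k] ij(2), where R = "mpoly_ring n"] by (simp add: ideal_power_simps)
  then have d: "monomial ?d \<in> ideal_power (mpoly_ring n) P (Suc k)"
    by (simp only: variable_power monomial_mult) (simp add: variable_def monomial_mult)
  have "polys.is_ideal n (ideal_power (mpoly_ring n) P (Suc k))"
    using ideal_power_is_ideal[OF P, of "Suc k"] by (simp only: ideal_mpoly_ring_iff)
  then show ?thesis
    by (rule monomial_mem_of_divisor[OF _ d])
      (use e in \<open>auto simp: lookup_add lookup_single when_def split: if_splits\<close>)
qed

lemma symbolic_power_is_ideal:
  "polys.is_ideal n (symbolic_power (mpoly_ring n) I k :: 'k::field mpoly set)"
proof -
  have "polys.is_ideal n (ideal_power (mpoly_ring n) P k)"
    if "P \<in> minimal_primes (mpoly_ring n) I" for P :: "'k mpoly set"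
    using that ideal_power_is_ideal[of P n k]
    by (simp add: minimal_primes_def primeideal_def ideal_mpoly_ring_iff)
  then show ?thesis
    unfolding symbolic_power_def polys.is_ideal_def
    by (auto intro: polys_add polys_mult)
qed

text \<open>
  The exponent of \<open>(x\<^sub>0 \<dots> x\<^sub>m\<^sub>-\<^sub>1)\<^sup>k\<close> times one variable from each pair, namely \<open>x\<^sub>i\<close> if \<open>\<sigma> i\<close> holds
  and \<open>y\<^sub>i\<close> otherwise.
\<close>

definition choice_exponent :: "nat \<Rightarrow> nat \<Rightarrow> (nat \<Rightarrow> bool) \<Rightarrow> exponent" where
  "choice_exponent m k \<sigma> = expo (2 * m)
     (\<lambda>i. if i < m then (if \<sigma> i then Suc k else k) else if \<sigma> (i - m) then 0 else 1)"

text \<open>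
  A prime that contains \<open>x\<^sub>i\<close> and another \<open>x\<^sub>j\<close> has \<open>x\<^sub>i\<^sup>k x\<^sub>j\<close> in its power with exponent
  \<open>k + 1\<close>, which uses \<open>k \<ge> 1\<close>; a prime that contains \<open>x\<^sub>i\<close> and \<open>y\<^sub>i\<close> has \<open>x\<^sub>i\<^sup>k\<close> times the chosen
  variable in it.
\<close>

lemma choice_exponent_in_symbolic_power:
  assumes k: "1 \<le> k"
  shows "monomial (choice_exponent m k \<sigma>) \<in>
    (symbolic_power (mpoly_ring (2 * m)) (example_ideal m) (Suc k) :: 'k::field mpoly set)"
  unfolding symbolic_power_def
proof (intro IntI INT_I)
  let ?e = "choice_exponent m k \<sigma>"
  have keys: "Poly_Mapping.keys ?e \<subseteq> {..<2 * m}"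
    unfolding choice_exponent_def by (rule keys_expo)
  then show "monomial ?e \<in> carrier (mpoly_ring (2 * m))"
    by (simp add: monomial_in_polys_iff)
  fix P :: "'k mpoly set"
  assume "P \<in> minimal_primes (mpoly_ring (2 * m)) (example_ideal m)"
  then have P: "primeideal P (mpoly_ring (2 * m))" "example_ideal m \<subseteq> P"
    by (auto simp: minimal_primes_def)
  then obtain i j where ij: "i < m" "variable i \<in> P" "variable j \<in> P" "j = m + i \<or> (j < m \<and> j \<noteq> i)"
    using prime_over_example_ideal by blast
  have idP: "ideal P (mpoly_ring (2 * m))" using P(1) by (simp add: primeideal_def)
  show "monomial ?e \<in> ideal_power (mpoly_ring (2 * m)) P (Suc k)"
  proof (cases "\<sigma> i")
    case True
    show ?thesis
      by (rule monomial_in_ideal_power[OF idP ij(2) ij(2) keys])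
        (use ij True in \<open>auto simp: choice_exponent_def\<close>)
  next
    case False
    show ?thesis
      by (rule monomial_in_ideal_power[OF idP ij(2) ij(3) keys])
        (use ij False k in \<open>auto simp: choice_exponent_def\<close>)
  qed
qed

section \<open>Linear forms modulo monomial ideals\<close>

lemma lookup_variable_mult:
  "Poly_Mapping.lookup (variable c * q) g =
    (if 0 < lk g c then Poly_Mapping.lookup q (g - unit_exponent c) else (0 :: 'k::field))"
proof (cases "0 < lk g c")
  case True
  have "g = (g - unit_exponent c) + unit_exponent c"
    by (rule exponent_split) (use True in \<open>auto simp: lookup_single when_def\<close>)
  then have "g = unit_exponent c + (g - unit_exponent c)" by (simp add: add.commute)
  then have "Poly_Mapping.lookup (variable c * q) g = Poly_Mapping.lookup (monomial (unit_exponent c) * q) (unit_exponent c + (g - unit_exponent c))"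
    by (simp add: variable_def)
  then show ?thesis using True by (simp add: lookup_monomial_mult)
next
  case False
  then have "g \<noteq> unit_exponent c + b" for b
    by (auto simp: lookup_add)
  then show ?thesis
    using False by (simp add: variable_def lookup_monomial_mult_zero)
qed

text \<open>
  The hypothesis on \<open>M\<close> says that every associated prime of the monomial ideal omits some variable
  \<open>a\<close> that occurs in the linear form. Then the form is a nonzerodivisor: among the offending monomials
  of \<open>q\<close> that stay outside the ideal under multiplication by all powers of \<open>a\<close>, take one with the
  largest exponent of \<open>a\<close>. Its multiple by \<open>a\<close> cannot be cancelled in the product.
\<close>

lemma linear_form_mult_in_monomial_span:
  fixes q :: "'k::field mpoly"
  assumes B: "finite B" and up: "upward_closed M"
    and dir: "\<And>e. \<not> M e \<Longrightarrow> \<exists>a\<in>B. w a \<noteq> 0 \<and> (\<forall>s. \<not> M (e + Poly_Mapping.single a s))"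
    and q: "q \<in> polys n"
    and mem: "(\<Sum>c\<in>B. Poly_Mapping.single 0 (w c) * variable c) * q \<in> monomial_span n M"
  shows "q \<in> monomial_span n M"
proof (rule ccontr)
  assume "q \<notin> monomial_span n M"
  then obtain e0 where e0: "e0 \<in> Poly_Mapping.keys q" "\<not> M e0"
    using q by (auto simp: monomial_span_def)
  then obtain a where a: "a \<in> B" "w a \<noteq> 0" "\<forall>s. \<not> M (e0 + Poly_Mapping.single a s)"
    using dir by blast
  define G where "G = {e \<in> Poly_Mapping.keys q. \<forall>s. \<not> M (e + Poly_Mapping.single a s)}"
  have G: "finite G" "G \<noteq> {}" using e0 a by (auto simp: G_def)
  have "Max ((\<lambda>e. lk e a) ` G) \<in> (\<lambda>e. lk e a) ` G"
    using G by (intro Max_in) auto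
  then obtain e where "e \<in> G" "lk e a = Max ((\<lambda>e. lk e a) ` G)" by auto
  then have e: "e \<in> G" "\<And>e'. e' \<in> G \<Longrightarrow> lk e' a \<le> lk e a"
    using G by auto
  define g where "g = e + unit_exponent a"
  \<comment> \<open>A contribution from another variable would come from a monomial of the same kind with a larger exponent of \<open>a\<close>.\<close>
  have "Poly_Mapping.lookup (variable c * q) g = 0" if c: "c \<in> B - {a}" for c
  proof (cases "0 < lk g c")
    case True
    define e' where "e' = g - unit_exponent c"
    have g: "g = e' + unit_exponent c"
      unfolding e'_def by (rule exponent_split) (use True in \<open>auto simp: lookup_single when_def\<close>)
    have "lk g a = lk e a + 1" "lk g a = lk e' a"
      using c by (auto simp: g_def lookup_add) (auto simp: e'_def g_def lookup_add lookup_minus lookup_single)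
    then have "e' \<notin> G" using e(2)[of e'] by auto
    moreover have "\<not> M (e' + Poly_Mapping.single a s)" for s
    proof
      assume "M (e' + Poly_Mapping.single a s)"
      then have "M (e' + Poly_Mapping.single a s + unit_exponent c)"
        using up by (auto simp: upward_closed_def)
      also have "e' + Poly_Mapping.single a s + unit_exponent c = g + Poly_Mapping.single a s"
        by (simp add: g add_ac)
      also have "\<dots> = e + Poly_Mapping.single a (Suc s)"
        by (simp add: g_def add.assoc flip: single_add)
      finally show False using e(1) by (auto simp: G_def)
    qed
    ultimately have "Poly_Mapping.lookup q e' = 0" by (auto simp: G_def in_keys_iff)
    then show ?thesis using True by (simp add: lookup_variable_mult e'_def)
  qed (simp add: lookup_variable_mult)
  moreover have lk: "Poly_Mapping.lookup (Poly_Mapping.single 0 (w c) * variable c * q) g = w c * Poly_Mapping.lookup (variable c * q) g" for c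
    by (simp add: mult.assoc lookup_single_mult)
  ultimately have "Poly_Mapping.lookup ((\<Sum>c\<in>B. Poly_Mapping.single 0 (w c) * variable c) * q) g
      = (\<Sum>c\<in>{a}. w c * Poly_Mapping.lookup (variable c * q) g)"
    unfolding sum_distrib_right lookup_sum using a(1) B by (intro sum.mono_neutral_cong_right) auto
  also have "\<dots> = w a * Poly_Mapping.lookup q e"
    by (simp add: lookup_variable_mult g_def lookup_add)
  also have "\<dots> \<noteq> 0"
    using a(2) e(1) by (simp add: G_def in_keys_iff)
  finally have "g \<in> Poly_Mapping.keys ((\<Sum>c\<in>B. Poly_Mapping.single 0 (w c) * variable c) * q)"
    by (simp add: in_keys_iff)
  then have "M g" using mem unfolding monomial_span_def by blast
  then show False using e(1) by (auto simp: G_def g_def)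
qed

section \<open>Substitutions of monomials\<close>

definition push :: "(exponent \<Rightarrow> exponent) \<Rightarrow> 'k::field mpoly \<Rightarrow> 'k mpoly" where
  "push h p = (\<Sum>e\<in>Poly_Mapping.keys p. Poly_Mapping.single (h e) (Poly_Mapping.lookup p e))"

lemma push_zero [simp]: "push h 0 = 0"
  by (simp add: push_def)

lemma push_single [simp]: "push h (Poly_Mapping.single a c) = Poly_Mapping.single (h a) c"
  by (simp add: push_def)

lemma push_monomial [simp]: "push h (monomial a) = monomial (h a)"
  by (simp add: monomial_def)

lemma push_add: "push h (p + q) = push h p + push h q"
  unfolding push_def by (rule setsum_keys_plus_distrib) (simp_all add: single_add)

lemma push_uminus: "push h (- p) = - push h (p :: 'k::field mpoly)"
proof -
  have "push h p + push h (- p) = 0" by (simp flip: push_add)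
  then show ?thesis by (metis add.inverse_unique)
qed

lemma push_diff: "push h (p - q) = push h p - push h (q :: 'k::field mpoly)"
  using push_add[of h p "- q"] by (simp add: push_uminus)

lemma push_sum: "push h (sum f S) = (\<Sum>i\<in>S. push h (f i))"
  by (induction S rule: infinite_finite_induct) (simp_all add: push_add)

lemma sum_singles: "(\<Sum>e\<in>Poly_Mapping.keys p. Poly_Mapping.single e (Poly_Mapping.lookup p e)) = p"
  by (rule poly_mapping_eqI) (auto simp: lookup_sum lookup_single when_def in_keys_iff)

lemma push_mult:
  assumes "\<And>a b. h (a + b) = h a + h b"
  shows "push h (p * q) = push h p * push h (q :: 'k::field mpoly)"
proof -
  let ?l = "Poly_Mapping.lookup"
  have "p * q = (\<Sum>a\<in>Poly_Mapping.keys p. \<Sum>b\<in>Poly_Mapping.keys q. Poly_Mapping.single (a + b) (?l p a * ?l q b))"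
    by (subst (1 2) sum_singles[symmetric]) (simp only: sum_product mult_single)
  then have "push h (p * q) = (\<Sum>a\<in>Poly_Mapping.keys p. \<Sum>b\<in>Poly_Mapping.keys q. Poly_Mapping.single (h (a + b)) (?l p a * ?l q b))"
    by (simp only: push_sum push_single)
  also have "\<dots> = push h p * push h q"
    by (simp add: push_def sum_product mult_single assms)
  finally show ?thesis .
qed

lemma push_in_polys:
  assumes "\<And>e. Poly_Mapping.keys (h e) \<subseteq> {..<n}"
  shows "push h p \<in> polys n"
  unfolding push_def using assms by (intro polys.sum_mem) (auto simp: polys_def)

text \<open>
  The exponent map of the substitution \<open>y\<^sub>1, \<dots>, y\<^sub>t \<mapsto> y\<^sub>0\<close>. It also sets variables outside the
  polynomial ring to \<open>1\<close>, so that it is additive with values among the exponents of the ring.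
\<close>

definition collapse :: "nat \<Rightarrow> nat \<Rightarrow> exponent \<Rightarrow> exponent" where
  "collapse m t e = expo (2 * m) (\<lambda>l.
     if l = m then \<Sum>j\<le>t. lk e (m + j) else if m < l \<and> l \<le> m + t then 0 else lk e l)"

lemma collapse_add: "collapse m t (a + b) = collapse m t a + collapse m t b"
  by (rule poly_mapping_eqI) (simp add: collapse_def lookup_add sum.distrib)

lemma keys_collapse: "Poly_Mapping.keys (collapse m t e) \<subseteq> {..<2 * m}"
  unfolding collapse_def by (rule keys_expo)

lemma push_collapse_variable:
  assumes "l < 2 * m" "t < m"
  shows "push (collapse m t) (variable l) = (variable (if m \<le> l \<and> l \<le> m + t then m else l) :: 'k::field mpoly)"
proof -
  have "collapse m t (unit_exponent l) = unit_exponent (if m \<le> l \<and> l \<le> m + t then m else l)"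
  proof (rule poly_mapping_eqI)
    fix i
    have "(\<Sum>j\<le>t. lk (unit_exponent l) (m + j)) = (if m \<le> l \<and> l \<le> m + t then 1 else 0)"
    proof -
      have "(\<Sum>j\<le>t. lk (unit_exponent l) (m + j)) = (\<Sum>j\<in>{j. j \<le> t \<and> l = m + j}. 1)"
        by (intro sum.mono_neutral_cong_right) (auto simp: lookup_single when_def)
      also have "{j. j \<le> t \<and> l = m + j} = (if m \<le> l \<and> l \<le> m + t then {l - m} else {})"
        by auto
      finally show ?thesis by simp
    qed
    then show "lk (collapse m t (unit_exponent l)) i = lk (unit_exponent (if m \<le> l \<and> l \<le> m + t then m else l)) i"
      using assms by (auto simp: collapse_def lookup_single when_def)
  qed
  then show ?thesis by (simp add: variable_def)
qed

text \<open>
  The exponents of the image of \<open>I\<^sup>k\<close> under this substitution: only the first \<open>t + 1\<close> replacements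
  draw on the common variable \<open>y\<^sub>0\<close>.
\<close>

definition stage_exponent :: "nat \<Rightarrow> nat \<Rightarrow> nat \<Rightarrow> exponent \<Rightarrow> bool" where
  "stage_exponent m k t e \<longleftrightarrow> (\<Sum>i<m. k - lk e i) \<le> k \<and> (\<Sum>j\<le>t. k - lk e j) \<le> lk e m \<and>
     (\<forall>j. t < j \<longrightarrow> j < m \<longrightarrow> k - lk e j \<le> lk e (m + j))"

lemma upward_closed_stage_exponent: "upward_closed (stage_exponent m k t)"
  unfolding upward_closed_def
proof (intro allI impI)
  fix a b :: exponent assume a: "stage_exponent m k t a"
  have "(\<Sum>i<m. k - lk (a + b) i) \<le> (\<Sum>i<m. k - lk a i)" "(\<Sum>i\<le>t. k - lk (a + b) i) \<le> (\<Sum>i\<le>t. k - lk a i)"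
    by (intro sum_mono; simp add: lookup_add)+
  moreover have "k - lk (a + b) j \<le> lk (a + b) (m + j)" if "t < j" "j < m" for j
  proof -
    have "k - lk a j \<le> lk a (m + j)" using a that by (simp add: stage_exponent_def)
    then show ?thesis by (simp add: lookup_add)
  qed
  ultimately show "stage_exponent m k t (a + b)"
    using a by (simp add: stage_exponent_def lookup_add)
qed

definition stage_ideal :: "nat \<Rightarrow> nat \<Rightarrow> nat \<Rightarrow> 'k::field mpoly set" where
  "stage_ideal m k t = {p \<in> polys (2 * m).
     push (collapse m t) p \<in> monomial_span (2 * m) (stage_exponent m k t)}"

lemma stage_ideal_is_ideal: "polys.is_ideal (2 * m) (stage_ideal m k t :: 'k::field mpoly set)"
proof -
  note S = monomial_span_is_ideal[OF upward_closed_stage_exponent, of "2 * m" m k t]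
  show ?thesis
    unfolding polys.is_ideal_def stage_ideal_def
    by (auto simp: push_add push_mult[OF collapse_add]
        intro!: polys_add polys_mult polys.ideal_add[OF S] polys.ideal_mult[OF S] polys.ideal_zero[OF S]
          push_in_polys keys_collapse)
qed

text \<open>
  Trade the variables \<open>y\<^sub>1, \<dots>, y\<^sub>t\<close> for \<open>y\<^sub>0\<close> one at a time.
\<close>

lemma monomial_congruent_collapse:
  assumes I: "polys.is_ideal (2 * m) (I :: 'k::field mpoly set)" and t: "t < m"
    and diff: "\<And>j. 1 \<le> j \<Longrightarrow> j \<le> t \<Longrightarrow> variable m - variable (m + j) \<in> I"
    and e: "Poly_Mapping.keys e \<subseteq> {..<2 * m}"
  shows "monomial e - monomial (collapse m t e) \<in> I"
  using e
proof (induction "\<Sum>j\<in>{1..t}. lk e (m + j)" arbitrary: e rule: less_induct)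
  case less
  show ?case
  proof (cases "\<exists>j\<in>{1..t}. 0 < lk e (m + j)")
    case False
    have "lk (collapse m t e) l = lk e l" for l
    proof -
      have "lk e l = 0" if "\<not> l < 2 * m"
        using less.prems that by (auto simp: in_keys_iff)
      moreover have "lk e l = 0" if "m < l" "l \<le> m + t"
        using False that by (auto dest!: bspec[of _ _ "l - m"])
      moreover have "(\<Sum>j\<le>t. lk e (m + j)) = (\<Sum>j\<in>{0}. lk e (m + j))"
        using False by (intro sum.mono_neutral_right) auto
      ultimately show ?thesis using t by (auto simp: collapse_def)
    qed
    then have "collapse m t e = e" by (rule poly_mapping_eqI)
    then show ?thesis using polys.ideal_zero[OF I] by simp
  next
    case True
    then obtain j where j: "1 \<le> j" "j \<le> t" "0 < lk e (m + j)" by auto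
    define b where "b = e - unit_exponent (m + j)"
    have "lk (unit_exponent (m + j)) i \<le> lk e i" for i
      using j(3) by (cases "i = m + j") (simp_all add: lookup_single)
    from exponent_split[OF this] have eb: "e = unit_exponent (m + j) + b"
      by (simp add: b_def add.commute)
    define e1 where "e1 = unit_exponent m + b"
    have kb: "Poly_Mapping.keys b \<subseteq> {..<2 * m}"
      using less.prems keys_diff_exponent[of e "unit_exponent (m + j)"] by (auto simp: b_def)
    then have k1: "Poly_Mapping.keys e1 \<subseteq> {..<2 * m}"
      using t by (auto simp: e1_def keys_add_exponent)
    have "(\<Sum>i\<in>{1..t}. lk e1 (m + i)) < (\<Sum>i\<in>{1..t}. lk e (m + i))"
      by (rule sum_strict_mono_ex1)
        (use j in \<open>auto simp: e1_def eb lookup_add lookup_single when_def\<close>)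
    then have IH: "monomial e1 - monomial (collapse m t e1) \<in> I"
      using less.hyps k1 by blast
    have "monomial b * (variable m - variable (m + j)) \<in> I"
      using diff[OF j(1,2)] kb by (intro polys.ideal_mult[OF I]) (auto simp: monomial_in_polys_iff)
    moreover have "monomial e - monomial e1 = - (monomial b * (variable m - variable (m + j)) :: 'k mpoly)"
    proof -
      have "monomial b * variable i = (monomial (unit_exponent i + b) :: 'k mpoly)" for i
        by (simp only: mult.commute[of "monomial b"] variable_mult_monomial)
      then show ?thesis
        by (simp only: eb e1_def right_diff_distrib minus_diff_eq)
    qed
    ultimately have 1: "monomial e - monomial e1 \<in> I"
      using polys.ideal_uminus[OF I] by simp
    have "push (collapse m t) (variable (m + j)) = (push (collapse m t) (variable m) :: 'k mpoly)"
      using j t by (simp add: push_collapse_variable)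
    then have "monomial (collapse m t (unit_exponent (m + j))) = (monomial (collapse m t (unit_exponent m)) :: 'k mpoly)"
      by (simp add: variable_def)
    then have "collapse m t (unit_exponent (m + j)) = collapse m t (unit_exponent m)"
      unfolding monomial_def by (metis keys_single the_elem_eq zero_neq_one)
    then have "collapse m t e1 = collapse m t e"
      by (simp add: eb e1_def collapse_add)
    then show ?thesis
      using polys.ideal_add[OF I 1 IH] by simp
  qed
qed

text \<open>
  Adding the differences \<open>y\<^sub>0 - y\<^sub>j\<close> to \<open>I\<^sup>k\<close> amounts to substituting and then testing membership in
  a monomial ideal; this is what makes the regular sequence below computable.
\<close>

lemma stage_ideal_eq:
  assumes t: "t < m"
  shows "Idl\<^bsub>mpoly_ring (2 * m)\<^esub> (monomial_span (2 * m) (power_exponent m k) \<union> (\<lambda>j. variable m - variable (m + j)) ` {1..t})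
    = (stage_ideal m k t :: 'k::field mpoly set)" (is "Idl\<^bsub>_\<^esub> ?A = _")
proof
  have "monomial_span (2 * m) (power_exponent m k) \<subseteq> (stage_ideal m k t :: 'k mpoly set)"
  proof (rule monomial_span_subset[OF stage_ideal_is_ideal])
    fix e assume e: "Poly_Mapping.keys e \<subseteq> {..<2 * m}" "power_exponent m k e"
    have "(\<Sum>j\<le>t. k - lk e j) \<le> (\<Sum>j\<le>t. lk e (m + j))"
    proof (rule sum_mono)
      fix j assume "j \<in> {..t}"
      then have "k \<le> lk e j + lk e (m + j)" using e(2) t by (auto simp: power_exponent_def)
      then show "k - lk e j \<le> lk e (m + j)" by simp
    qed
    moreover have "k - lk e j \<le> lk e (m + j)" if "j < m" for j
    proof -
      have "k \<le> lk e j + lk e (m + j)" using e(2) that by (auto simp: power_exponent_def)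
      then show ?thesis by simp
    qed
    ultimately have "stage_exponent m k t (collapse m t e)"
      using e(2) t by (auto simp: stage_exponent_def collapse_def power_exponent_def)
    then show "monomial e \<in> stage_ideal m k t"
      using e(1) keys_collapse by (simp add: stage_ideal_def monomial_in_polys_iff monomial_in_span_iff)
  qed
  moreover have "variable m - variable (m + j) \<in> (stage_ideal m k t :: 'k mpoly set)" if "j \<in> {1..t}" for j
    using that t polys.ideal_zero[OF monomial_span_is_ideal[OF upward_closed_stage_exponent]]
    by (auto simp: stage_ideal_def push_diff push_collapse_variable intro!: polys.diff_mem)
  ultimately show "Idl\<^bsub>mpoly_ring (2 * m)\<^esub> ?A \<subseteq> stage_ideal m k t"
    by (intro genideal_least[OF stage_ideal_is_ideal]) auto
  let ?I = "Idl\<^bsub>mpoly_ring (2 * m)\<^esub> ?A :: 'k mpoly set"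
  have A: "?A \<subseteq> (polys (2 * m) :: 'k mpoly set)"
    using t by (auto simp: monomial_span_def intro!: polys.diff_mem)
  note I = is_ideal_genideal[OF A]
  have AI: "?A \<subseteq> ?I" by (rule genideal_contains)
  have cong: "monomial e - monomial (collapse m t e) \<in> ?I" if "Poly_Mapping.keys e \<subseteq> {..<2 * m}" for e
    using AI by (intro monomial_congruent_collapse[OF I t _ that]) auto
  have stage: "monomial_span (2 * m) (stage_exponent m k t) \<subseteq> ?I"
  proof (rule monomial_span_subset[OF I])
    fix e assume e: "Poly_Mapping.keys e \<subseteq> {..<2 * m}" "stage_exponent m k t e"
    let ?S = "\<Sum>j\<in>{1..t}. k - lk e j"
    have split0: "(\<Sum>j\<le>t. f j) = f 0 + (\<Sum>j\<in>{1..t}. f j)" for f :: "nat \<Rightarrow> nat"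
    proof -
      have "{..t} = insert 0 {1..t}" by auto
      then show ?thesis by simp
    qed
    have S: "(k - lk e 0) + ?S \<le> lk e m"
      using e(2) by (simp add: stage_exponent_def split0)
    \<comment> \<open>Redistribute \<open>y\<^sub>0\<close>: each of \<open>y\<^sub>1, \<dots>, y\<^sub>t\<close> receives what its condition in \<open>I\<^sup>k\<close> needs.\<close>
    define d where "d = expo (2 * m) (\<lambda>l. if l = m then lk e m - ?S
      else if m < l \<and> l \<le> m + t then lk e l + (k - lk e (l - m)) else lk e l)"
    have dx: "lk d i = lk e i" if "i < m" for i
      using that by (simp add: d_def)
    have "k \<le> lk d j + lk d (m + j)" if j: "j < m" for j
    proof -
      consider "j = 0" | "1 \<le> j" "j \<le> t" | "t < j" by linarith
      then show ?thesis
      proof cases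
        case 1
        then show ?thesis using S j by (simp add: d_def)
      next
        case 3
        then have "k - lk e j \<le> lk e (m + j)" using e(2) j by (simp add: stage_exponent_def)
        then show ?thesis using 3 j by (simp add: d_def)
      qed (use j in \<open>simp add: d_def\<close>)
    qed
    then have "power_exponent m k d"
      using e(2) by (simp add: power_exponent_def stage_exponent_def dx)
    moreover have kd: "Poly_Mapping.keys d \<subseteq> {..<2 * m}"
      unfolding d_def by (rule keys_expo)
    ultimately have d: "monomial d \<in> ?I"
      using AI by (auto simp: monomial_in_span_iff)
    have "collapse m t d = collapse m t e"
    proof (rule poly_mapping_eqI)
      fix l
      have "(\<Sum>j\<in>{1..t}. lk d (m + j)) = (\<Sum>j\<in>{1..t}. lk e (m + j) + (k - lk e j))"
        using t by (intro sum.cong) (auto simp: d_def)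
      then have "(\<Sum>j\<le>t. lk d (m + j)) = (\<Sum>j\<le>t. lk e (m + j))"
        using S t by (simp add: split0 sum.distrib) (simp add: d_def)
      then show "lk (collapse m t d) l = lk (collapse m t e) l"
        by (auto simp: collapse_def d_def)
    qed
    then have "monomial d - monomial (collapse m t e) \<in> ?I"
      using cong[OF kd] by simp
    then have "monomial d - (monomial d - monomial (collapse m t e)) \<in> ?I"
      by (rule polys.ideal_diff[OF I d])
    then have "monomial (collapse m t e) \<in> ?I" by simp
    then have "(monomial e - monomial (collapse m t e)) + monomial (collapse m t e) \<in> ?I"
      by (rule polys.ideal_add[OF I cong[OF e(1)]])
    then show "monomial e \<in> ?I" by simp
  qed
  show "stage_ideal m k t \<subseteq> ?I"
  proof
    fix p :: "'k mpoly" assume p: "p \<in> stage_ideal m k t"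
    have keys: "Poly_Mapping.keys e \<subseteq> {..<2 * m}" if "e \<in> Poly_Mapping.keys p" for e
      using p that by (simp add: stage_ideal_def polys_def)
    have "p - push (collapse m t) p = (\<Sum>e\<in>Poly_Mapping.keys p. Poly_Mapping.single 0 (Poly_Mapping.lookup p e) * (monomial e - monomial (collapse m t e)))"
    proof -
      have "Poly_Mapping.single 0 (Poly_Mapping.lookup p e) * (monomial e - monomial (collapse m t e)) =
        Poly_Mapping.single e (Poly_Mapping.lookup p e) - Poly_Mapping.single (collapse m t e) (Poly_Mapping.lookup p e)" for e
        by (simp add: algebra_simps monomial_def mult_single)
      then show ?thesis by (simp add: sum_subtractf sum_singles push_def)
    qed
    also have "\<dots> \<in> ?I"
      using keys by (intro polys.ideal_sum[OF I] polys.ideal_mult[OF I] single_zero_in_polys cong)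
    finally have "p - push (collapse m t) p \<in> ?I" .
    moreover have "push (collapse m t) p \<in> ?I"
      using p stage by (auto simp: stage_ideal_def)
    ultimately have "(p - push (collapse m t) p) + push (collapse m t) p \<in> ?I"
      by (rule polys.ideal_add[OF I])
    then show "p \<in> ?I" by simp
  qed
qed

section \<open>The two depths\<close>

lemma one_not_in_genideal:
  assumes "A \<subseteq> variable_prime n B"
  shows "1 \<notin> Idl\<^bsub>mpoly_ring n\<^esub> (A :: 'k::field mpoly set)"
  using genideal_least[OF variable_prime_is_ideal assms] one_not_in_variable_prime by blast

lemma homogeneous_maximal_ideal_subset: "homogeneous_maximal_ideal n \<subseteq> variable_prime n {..<n}"
  unfolding homogeneous_maximal_ideal_def
  by (rule genideal_least[OF variable_prime_is_ideal]) (auto simp: variable_in_variable_prime_iff)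

lemma variable_prime_mono: "B \<subseteq> B' \<Longrightarrow> variable_prime n B \<subseteq> variable_prime n B'"
  unfolding variable_prime_def monomial_span_def by blast

lemma symbolic_power_subset:
  assumes "j < m"
  shows "symbolic_power (mpoly_ring (2 * m)) (example_ideal m) k
    \<subseteq> (monomial_span (2 * m) (\<lambda>e. k \<le> lk e j + lk e (m + j)) :: 'k::field mpoly set)"
  using minimal_prime_of_example_ideal[OF assms] ideal_power_variable_pair[of "2 * m" j "m + j" k]
  unfolding symbolic_power_def by blast

text \<open>
  With \<open>F = (x\<^sub>0 \<dots> x\<^sub>m\<^sub>-\<^sub>1)\<^sup>k\<close> all products of \<open>F\<close> with one variable from each pair lie in
  \<open>J = I\<^bsup>(k+1)\<^esup>\<close>. But \<open>F y\<^sub>0 \<dots> y\<^sub>m\<^sub>-\<^sub>1\<close> is not a combination of the \<open>y\<^sub>j\<close> with coefficients in \<open>J\<close>: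
  after division by \<open>y\<^sub>j\<close> the degree in \<open>x\<^sub>j\<close> and \<open>y\<^sub>j\<close> is only \<open>k\<close>, too small for the power of the
  minimal prime \<open>(x\<^sub>j, y\<^sub>j)\<close>. So the Koszul homology in degree \<open>m + 1\<close> is nonzero, which rules out
  regular sequences of length \<open>m = 2m - m\<close>.
\<close>

theorem depth_symbolic_power_less:
  assumes m: "0 < m" and k: "1 \<le> k"
  shows "depth (mpoly_ring (2 * m)) (homogeneous_maximal_ideal (2 * m))
    (quotient_module (mpoly_ring (2 * m)) (symbolic_power (mpoly_ring (2 * m)) (example_ideal m :: 'k::field mpoly set) (Suc k)))
    < enat m"
proof -
  let ?n = "2 * m"
  let ?R = "mpoly_ring ?n :: 'k mpoly ring"
  define J where "J = (symbolic_power ?R (example_ideal m) (Suc k))"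
  have J: "polys.is_ideal ?n J" unfolding J_def by (rule symbolic_power_is_ideal)
  have idJ: "ideal J ?R" using J by (simp add: ideal_mpoly_ring_iff)
  have "J \<subseteq> variable_prime ?n {0, m}"
    using symbolic_power_subset[OF m, of "Suc k"] unfolding J_def variable_prime_def
    by (force simp: monomial_span_def)
  then have JV: "J \<subseteq> variable_prime ?n {..<?n}"
    using variable_prime_mono[of "{0, m}" "{..<?n}" ?n] m by auto
  have mP: "homogeneous_maximal_ideal ?n \<subseteq> (polys ?n :: 'k mpoly set)"
    using homogeneous_maximal_ideal_subset polys.ideal_subset[OF variable_prime_is_ideal] by blast
  have proper: "set_times_module ?R (homogeneous_maximal_ideal ?n) (quotient_module ?R J) \<noteq> carrier (quotient_module ?R J)"
    using set_times_quotient_module_eq_carrier_iff[OF mpoly_ring_cring idJ, of "homogeneous_maximal_ideal ?n"]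
      mP one_not_in_genideal[of "J \<union> homogeneous_maximal_ideal ?n" ?n "{..<?n}"] JV homogeneous_maximal_ideal_subset
    by auto
  have less: "length fs < m"
    if fs: "set fs \<subseteq> homogeneous_maximal_ideal ?n" "regular_sequence ?R (quotient_module ?R J) fs" for fs
  proof (rule ccontr)
    assume "\<not> length fs < m"
    then have "polys.koszul_exact ?n {..<?n} variable J (Suc ?n - m)"
      using koszul_exact_of_regular_sequence[OF J fs(2,1), of m] by simp
    then have ex: "polys.koszul_exact ?n {..<?n} variable J (Suc m)"
      by (simp add: Suc_diff_le mult_2)
    define b where "b = expo ?n (\<lambda>i. if i < m then k else 0)"
    have prod_mono: "monomial b * (\<Prod>j<m. if \<sigma> j then variable j else variable (m + j)) = (monomial (choice_exponent m k \<sigma>) :: 'k mpoly)" for \<sigma>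
    proof -
      have "(\<Prod>j<l. if \<sigma> j then variable j else variable (m + j)) = (monomial (\<Sum>j<l. unit_exponent (if \<sigma> j then j else m + j)) :: 'k mpoly)" for l
        by (induction l) (auto simp: monomial_zero variable_def monomial_mult)
      moreover have "b + (\<Sum>j<m. unit_exponent (if \<sigma> j then j else m + j)) = choice_exponent m k \<sigma>"
      proof (rule poly_mapping_eqI)
        fix i
        have "(\<Sum>j<m. lk (unit_exponent (if \<sigma> j then j else m + j)) i) = card {j. j < m \<and> i = (if \<sigma> j then j else m + j)}"
        proof -
          have "(\<Sum>j<m. lk (unit_exponent (if \<sigma> j then j else m + j)) i) = (\<Sum>j\<in>{j. j < m \<and> i = (if \<sigma> j then j else m + j)}. 1)"
            by (intro sum.mono_neutral_cong_right) (auto simp: lookup_single when_def)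
          then show ?thesis by simp
        qed
        also have "{j. j < m \<and> i = (if \<sigma> j then j else m + j)} =
            (if i < m \<and> \<sigma> i then {i} else if m \<le> i \<and> i < 2 * m \<and> \<not> \<sigma> (i - m) then {i - m} else {})"
          by auto
        finally have "(\<Sum>j<m. lk (unit_exponent (if \<sigma> j then j else m + j)) i) =
            (if i < m \<and> \<sigma> i then 1 else if m \<le> i \<and> i < 2 * m \<and> \<not> \<sigma> (i - m) then 1 else 0)"
          by simp
        then show "lk (b + (\<Sum>j<m. unit_exponent (if \<sigma> j then j else m + j))) i = lk (choice_exponent m k \<sigma>) i"
          by (auto simp: b_def choice_exponent_def lookup_add lookup_sum)
      qed
      ultimately show ?thesis by (simp add: monomial_mult)
    qed
    obtain q where q: "\<And>j. j < m \<Longrightarrow> q j \<in> J"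
      "monomial b * (\<Prod>j<m. variable (m + j)) = (\<Sum>j<m. variable (m + j) * q j)"
      using polys.koszul_exact_imp_member[OF J _ _ m _ ex, of "monomial b"] prod_mono
        choice_exponent_in_symbolic_power[OF k] keys_expo[of ?n]
      by (auto simp: J_def monomial_in_polys_iff b_def)
    let ?e = "choice_exponent m k (\<lambda>_. False)"
    have "monomial ?e = (\<Sum>j<m. variable (m + j) * q j)"
      using q(2) prod_mono[of "\<lambda>_. False"] by simp
    then have "Poly_Mapping.lookup (\<Sum>j<m. variable (m + j) * q j) ?e \<noteq> 0"
      by (metis monomial_def lookup_single_eq zero_neq_one)
    then have "(\<Sum>j<m. Poly_Mapping.lookup (variable (m + j) * q j) ?e) \<noteq> 0"
      by (simp only: lookup_sum not_False_eq_True)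
    from sum.not_neutral_contains_not_neutral[OF this]
    obtain j where j: "j < m" "Poly_Mapping.lookup (variable (m + j) * q j) ?e \<noteq> 0"
      by blast
    then have "?e - unit_exponent (m + j) \<in> Poly_Mapping.keys (q j)"
      by (auto simp: lookup_variable_mult in_keys_iff split: if_splits)
    then have "Suc k \<le> lk (?e - unit_exponent (m + j)) j + lk (?e - unit_exponent (m + j)) (m + j)"
      using q(1)[OF j(1)] symbolic_power_subset[OF j(1), of "Suc k"] unfolding J_def monomial_span_def by blast
    then show False
      using j(1) by (simp add: lookup_minus choice_exponent_def lookup_single)
  qed
  have short: "length fs \<le> m - 1"
    if "set fs \<subseteq> homogeneous_maximal_ideal ?n" "regular_sequence ?R (quotient_module ?R J) fs" for fs
  proof -
    have "length fs < m" using that by (rule less)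
    then show ?thesis by simp
  qed
  have "depth ?R (homogeneous_maximal_ideal ?n) (quotient_module ?R J) =
      Sup {enat (length fs) | fs. set fs \<subseteq> homogeneous_maximal_ideal ?n \<and> regular_sequence ?R (quotient_module ?R J) fs}"
    using proper by (simp add: depth_def)
  also have "\<dots> \<le> enat (m - 1)"
  proof (rule Sup_least)
    fix x assume "x \<in> {enat (length fs) | fs. set fs \<subseteq> homogeneous_maximal_ideal ?n \<and> regular_sequence ?R (quotient_module ?R J) fs}"
    then show "x \<le> enat (m - 1)" using short by auto
  qed
  also have "\<dots> < enat m" using m by simp
  finally show ?thesis by (simp add: J_def)
qed

text \<open>
  The regular sequence is \<open>y\<^sub>0 - y\<^sub>1, \<dots>, y\<^sub>0 - y\<^sub>m\<^sub>-\<^sub>1, x\<^sub>0 + \<dots> + x\<^sub>m\<^sub>-\<^sub>1 + y\<^sub>0\<close>. In the conditions on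
  exponents at stage \<open>i\<close>, the variables \<open>y\<^sub>0\<close> and \<open>y\<^sub>i\<^sub>+\<^sub>1\<close> occur in different inequalities. A monomial
  outside the ideal violates some inequality, and multiplying by whichever of the two variables is
  absent from it never repairs this; so the difference is regular. For the last element every
  remaining variable has to occur. If \<open>\<Sum> (k - u\<^sub>i) > k\<close>, where \<open>u\<^sub>i\<close> is the exponent of \<open>x\<^sub>i\<close>, then powers of
  \<open>y\<^sub>0\<close> do not help. Otherwise, as \<open>k < m\<close>, some \<open>u\<^sub>i\<close> is at least \<open>k\<close>, and powers of this \<open>x\<^sub>i\<close> do
  not help.
\<close>

theorem depth_ideal_power_ge:
  assumes k: "1 \<le> k" "k < m"
  shows "enat m \<le> depth (mpoly_ring (2 * m)) (homogeneous_maximal_ideal (2 * m))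
    (quotient_module (mpoly_ring (2 * m)) (ideal_power (mpoly_ring (2 * m)) (example_ideal m :: 'k::field mpoly set) k))"
proof -
  let ?n = "2 * m"
  let ?R = "mpoly_ring ?n :: 'k mpoly ring"
  define J :: "'k mpoly set" where "J = monomial_span ?n (power_exponent m k)"
  have J: "polys.is_ideal ?n J"
    unfolding J_def by (rule monomial_span_is_ideal[OF upward_closed_power_exponent])
  have idJ: "ideal J ?R" using J by (simp add: ideal_mpoly_ring_iff)
  define d :: "nat \<Rightarrow> 'k mpoly" where "d j = variable m - variable (m + j)" for j
  define f :: "'k mpoly" where "f = (\<Sum>i\<le>m. variable i)"
  define fs where "fs = map d [1..<m] @ [f]"
  have len: "length fs = m" using k by (simp add: fs_def)
  have fP: "f \<in> polys ?n" unfolding f_def using k by (intro polys.sum_mem) simp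
  have dP: "d j \<in> polys ?n" if "j < m" for j
    unfolding d_def using that by (intro polys.diff_mem) simp_all
  have fsP: "set fs \<subseteq> polys ?n"
    using fP dP by (auto simp: fs_def)
  have maxI: "polys.is_ideal ?n (homogeneous_maximal_ideal ?n :: 'k mpoly set)"
    unfolding homogeneous_maximal_ideal_def by (rule is_ideal_genideal) auto
  have varm: "variable i \<in> (homogeneous_maximal_ideal ?n :: 'k mpoly set)" if "i < ?n" for i
    using genideal_contains[of "variable ` {..<?n}" ?n] that by (auto simp: homogeneous_maximal_ideal_def)
  have fsm: "set fs \<subseteq> homogeneous_maximal_ideal ?n"
    using k by (auto simp: fs_def f_def d_def intro!: polys.ideal_diff[OF maxI] polys.ideal_sum[OF maxI] varm)
  have take: "Idl\<^bsub>?R\<^esub> (J \<union> set (take i fs)) = stage_ideal m k i" if "i < m" for i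
  proof -
    have "take i fs = map d [1..<Suc i]"
      using that by (simp add: fs_def take_map)
    then have "set (take i fs) = (\<lambda>j. variable m - variable (m + j)) ` {1..i}"
      by (auto simp: d_def atLeastLessThanSuc_atLeastAtMost)
    then show ?thesis using stage_ideal_eq[OF that] by (simp add: J_def)
  qed
  have nzd: "p \<in> stage_ideal m k i"
    if i: "i < m" and p: "p \<in> polys ?n" and mem: "fs ! i * p \<in> stage_ideal m k i" for i p
  proof -
    let ?h = "push (collapse m i)" and ?M = "stage_exponent m k i"
    have hp: "?h p \<in> polys ?n" by (rule push_in_polys[OF keys_collapse])
    have hmem: "?h (fs ! i) * ?h p \<in> monomial_span ?n ?M"
      using mem by (simp add: stage_ideal_def push_mult[OF collapse_add])
    have "?h p \<in> monomial_span ?n ?M"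
    proof (cases "Suc i < m")
      case True
      then have "i < m - 1" by simp
      then have "fs ! i = d (Suc i)" by (simp add: fs_def nth_append)
      then have h: "?h (fs ! i) = variable m - variable (m + Suc i)"
        using True by (simp add: d_def push_diff push_collapse_variable)
      define w :: "nat \<Rightarrow> 'k" where "w c = (if c = m then 1 else - 1)" for c
      have "?h (fs ! i) = (\<Sum>c\<in>{m, m + Suc i}. Poly_Mapping.single 0 (w c) * variable c)"
        by (simp add: h w_def single_uminus)
      then have *: "(\<Sum>c\<in>{m, m + Suc i}. Poly_Mapping.single 0 (w c) * variable c) * ?h p \<in> monomial_span ?n ?M"
        using hmem by simp
      show ?thesis
      proof (rule linear_form_mult_in_monomial_span[OF _ upward_closed_stage_exponent _ hp *])
        fix e assume e: "\<not> ?M e"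
        show "\<exists>a\<in>{m, m + Suc i}. w a \<noteq> 0 \<and> (\<forall>s. \<not> ?M (e + Poly_Mapping.single a s))"
        proof (cases "(\<Sum>j\<le>i. k - lk e j) \<le> lk e m")
          case True
          have "\<not> ?M (e + Poly_Mapping.single m s)" for s
            using e True by (auto simp: stage_exponent_def lookup_add lookup_single when_def)
          then show ?thesis by (auto simp: w_def)
        next
          case False
          have "(\<Sum>j\<le>i. k - lk (e + Poly_Mapping.single (m + Suc i) s) j) = (\<Sum>j\<le>i. k - lk e j)" for s
            using i by (intro sum.cong) (auto simp: lookup_add lookup_single when_def)
          then have "\<not> ?M (e + Poly_Mapping.single (m + Suc i) s)" for s
            using False by (auto simp: stage_exponent_def lookup_add lookup_single when_def)
          then show ?thesis by (auto simp: w_def)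
        qed
      qed simp
    next
      case False
      then have im: "m = Suc i" using i by simp
      then have "fs ! i = f" by (simp add: fs_def nth_append)
      then have h: "?h (fs ! i) = (\<Sum>c\<le>m. Poly_Mapping.single 0 1 * variable c)"
        using i by (auto simp: f_def push_sum push_collapse_variable intro!: sum.cong)
      have *: "(\<Sum>c\<le>m. Poly_Mapping.single 0 1 * variable c) * ?h p \<in> monomial_span ?n ?M"
        using hmem unfolding h .
      show ?thesis
      proof (rule linear_form_mult_in_monomial_span[OF _ upward_closed_stage_exponent _ hp *])
        fix e assume e: "\<not> ?M e"
        show "\<exists>a\<in>{..m}. (1 :: 'k) \<noteq> 0 \<and> (\<forall>s. \<not> ?M (e + Poly_Mapping.single a s))"
        proof (cases "(\<Sum>j<m. k - lk e j) \<le> k")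
          case False
          have "(\<Sum>j<m. k - lk (e + Poly_Mapping.single m s) j) = (\<Sum>j<m. k - lk e j)" for s
            by (intro sum.cong) (auto simp: lookup_add lookup_single when_def)
          then have "\<not> ?M (e + Poly_Mapping.single m s)" for s
            using False by (auto simp: stage_exponent_def)
          then show ?thesis by auto
        next
          case True
          have "\<exists>a<m. k - lk e a = 0"
          proof (rule ccontr)
            assume "\<not> (\<exists>a<m. k - lk e a = 0)"
            then have "(\<Sum>j<m. 1) \<le> (\<Sum>j<m. k - lk e j)"
              by (intro sum_mono) (auto simp: Suc_le_eq)
            then show False using True k by simp
          qed
          then obtain a where a: "a < m" "k \<le> lk e a" by auto
          have same: "k - lk (e + Poly_Mapping.single a s) j = k - lk e j" for s j
            using a(2) by (auto simp: lookup_add lookup_single when_def)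
          have "lk (e + Poly_Mapping.single a s) m = lk e m" for s
            using a(1) by (simp add: lookup_add lookup_single)
          then have "?M (e + Poly_Mapping.single a s) \<longleftrightarrow> ?M e" for s
            unfolding stage_exponent_def same using im by auto
          then show ?thesis using a(1) e by (intro bexI[of _ a]) simp_all
        qed
      qed simp
    qed
    then show ?thesis using p by (simp add: stage_ideal_def)
  qed
  have "\<exists>i\<in>{0, m}. 0 < lk e i" if "power_exponent m k e" for e
  proof -
    have "0 < m" using k by simp
    then have "k \<le> lk e 0 + lk e (m + 0)" using that unfolding power_exponent_def by blast
    then show ?thesis using k by auto
  qed
  then have "J \<subseteq> variable_prime ?n {0, m}"
    unfolding J_def variable_prime_def monomial_span_def by blast
  then have "J \<subseteq> variable_prime ?n {..<?n}"
    using variable_prime_mono[of "{0, m}" "{..<?n}" ?n] k by auto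
  then have "1 \<notin> Idl\<^bsub>?R\<^esub> (J \<union> set fs)"
    using fsm homogeneous_maximal_ideal_subset by (intro one_not_in_genideal[of _ _ "{..<?n}"]) blast
  then have "regular_sequence ?R (quotient_module ?R J) fs"
    unfolding regular_sequence_quotient_module_iff[OF mpoly_ring_cring idJ]
    using fsP nzd take len by auto
  then have "enat m \<le> Sup {enat (length fs) | fs. set fs \<subseteq> homogeneous_maximal_ideal ?n \<and> regular_sequence ?R (quotient_module ?R J) fs}"
    using fsm len by (intro Sup_upper) auto
  then show ?thesis
    unfolding ideal_power_example_ideal J_def[symmetric] depth_def by simp
qed

section \<open>Prime chains in polynomial rings\<close>

text \<open>
  Gaussian elimination with the pivot \<open>A p j\<close>.
\<close>

lemma homogeneous_system_has_nonzero_solution: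
  fixes A :: "'i \<Rightarrow> 'j \<Rightarrow> 'k::field"
  assumes "finite J" "finite I" "card J < card I"
  shows "\<exists>c. (\<exists>i\<in>I. c i \<noteq> 0) \<and> (\<forall>j\<in>J. (\<Sum>i\<in>I. c i * A i j) = 0)"
  using assms
proof (induction J arbitrary: I A rule: finite_induct)
  case empty
  then obtain i where "i \<in> I" by fastforce
  then show ?case by (intro exI[of _ "\<lambda>_. 1"]) auto
next
  case (insert j J)
  show ?case
  proof (cases "\<exists>p\<in>I. A p j \<noteq> 0")
    case False
    have "card J < card I" using insert by simp
    then obtain c where "\<exists>i\<in>I. c i \<noteq> 0" "\<forall>j\<in>J. (\<Sum>i\<in>I. c i * A i j) = 0"
      using insert.IH[OF insert.prems(1)] by blast
    then show ?thesis using False by (intro exI[of _ c]) auto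
  next
    case True
    then obtain p where p: "p \<in> I" "A p j \<noteq> 0" by blast
    define B where "B i l = A i l - A i j / A p j * A p l" for i l
    have "card J < card (I - {p})" using insert p by simp
    then obtain c where c: "\<exists>i\<in>I - {p}. c i \<noteq> 0" "\<forall>l\<in>J. (\<Sum>i\<in>I - {p}. c i * B i l) = 0"
      using insert.IH[of "I - {p}" B] insert.prems(1) by auto
    define c' where "c' i = (if i = p then - (\<Sum>i\<in>I - {p}. c i * A i j) / A p j else c i)" for i
    have sum: "(\<Sum>i\<in>I. c' i * A i l) = (\<Sum>i\<in>I - {p}. c i * B i l)" for l
    proof -
      have "(\<Sum>i\<in>I. c' i * A i l) = c' p * A p l + (\<Sum>i\<in>I - {p}. c i * A i l)"
        using p insert.prems(1) by (subst sum.remove[of _ p]) (auto simp: c'_def intro!: sum.cong)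
      also have "c' p * A p l = - (\<Sum>i\<in>I - {p}. c i * (A i j / A p j * A p l))"
        by (simp add: c'_def sum_divide_distrib sum_distrib_right mult.assoc)
      finally show ?thesis
        by (simp add: B_def right_diff_distrib sum_subtractf)
    qed
    have "B i j = 0" for i using p by (simp add: B_def)
    then have "\<forall>l\<in>insert j J. (\<Sum>i\<in>I. c' i * A i l) = 0"
      using c(2) by (simp add: sum)
    moreover have "\<exists>i\<in>I. c' i \<noteq> 0" using c(1) by (auto simp: c'_def)
    ultimately show ?thesis by blast
  qed
qed

text \<open>
  The value at \<open>as\<close> of the polynomial that has all exponents below \<open>N\<close> and the coefficient \<open>c l\<close>
  at the exponent vector \<open>l\<close>, nested in the order of the list: an induction along a prime chain
  can then treat one element at a time.
\<close>

fun poly_value :: "nat \<Rightarrow> (nat list \<Rightarrow> 'a::comm_ring_1) \<Rightarrow> 'a list \<Rightarrow> 'a" where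
  "poly_value N c [] = c []"
| "poly_value N c (a # as) = (\<Sum>i<N. a ^ i * poly_value N (\<lambda>l. c (i # l)) as)"

definition exponent_lists :: "nat \<Rightarrow> nat \<Rightarrow> nat list set" where
  "exponent_lists r N = {l. set l \<subseteq> {..<N} \<and> length l = r}"

lemma poly_value_eq_sum:
  "poly_value N c as = (\<Sum>l\<in>exponent_lists (length as) N. c l * prod_list (map2 (^) as l))"
proof (induction as arbitrary: c)
  case Nil
  have "exponent_lists 0 N = {[]}" by (auto simp: exponent_lists_def)
  then show ?case by simp
next
  case (Cons a as)
  have "exponent_lists (Suc (length as)) N = (\<lambda>(i, l). i # l) ` ({..<N} \<times> exponent_lists (length as) N)"
    by (auto simp: exponent_lists_def length_Suc_conv image_iff)
  moreover have "inj_on (\<lambda>(i, l). i # l) ({..<N} \<times> exponent_lists (length as) N)"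
    by (auto simp: inj_on_def)
  ultimately have "(\<Sum>l\<in>exponent_lists (Suc (length as)) N. c l * prod_list (map2 (^) (a # as) l))
      = (\<Sum>(i, l)\<in>{..<N} \<times> exponent_lists (length as) N. c (i # l) * (a ^ i * prod_list (map2 (^) as l)))"
    by (simp add: sum.reindex case_prod_beta')
  also have "\<dots> = poly_value N c (a # as)"
    by (simp add: Cons.IH sum.cartesian_product[symmetric] sum_distrib_left mult_ac)
  finally show ?case by simp
qed

text \<open>
  Elements \<open>a\<^sub>i \<in> Q\<^sub>i\<^sub>+\<^sub>1 - Q\<^sub>i\<close> chosen along a prime chain satisfy no algebraic relation, not even
  modulo \<open>Q\<^sub>0\<close>, whose coefficients are zero or lie outside the last prime. In a relation take the lowest power \<open>a\<^sub>0\<^sup>i\<close> that occurs and cancel it modulo the prime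
  \<open>Q\<^sub>0\<close>. Since \<open>a\<^sub>0 \<in> Q\<^sub>1\<close>, its coefficient lies in \<open>Q\<^sub>1\<close>, so it is a relation between the remaining
  elements modulo \<open>Q\<^sub>1\<close>.
\<close>

lemma poly_value_coefficients_vanish:
  fixes Q :: "nat \<Rightarrow> 'k::field mpoly set"
  assumes "\<And>i. i \<le> length as \<Longrightarrow> primeideal (Q i) (mpoly_ring n)"
    and "\<And>i. i < length as \<Longrightarrow> Q i \<subseteq> Q (Suc i)"
    and "\<And>i. i < length as \<Longrightarrow> as ! i \<in> Q (Suc i) - Q i"
    and "\<And>l. c l \<in> polys n" "\<And>l. c l \<in> Q (length as) \<Longrightarrow> c l = 0"
    and "poly_value N c as \<in> Q 0" "l \<in> exponent_lists (length as) N"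
  shows "c l = 0"
  using assms
proof (induction as arbitrary: Q c l)
  case Nil
  then show ?case by (simp add: exponent_lists_def)
next
  case (Cons a as)
  have ideal: "polys.is_ideal n (Q i)" if "i \<le> Suc (length as)" for i
    using Cons.prems(1)[of i] that by (simp add: primeideal_def ideal_mpoly_ring_iff)
  note Q0 = ideal[of 0, simplified] and Q1 = ideal[of "Suc 0", simplified]
  interpret P: primeideal "Q 0" "mpoly_ring n :: 'k mpoly ring"
    using Cons.prems(1)[of 0] by simp
  have a: "a \<in> Q (Suc 0)" "a \<notin> Q 0" "Q 0 \<subseteq> Q (Suc 0)"
    using Cons.prems(2)[of 0] Cons.prems(3)[of 0] by auto
  have aP: "a \<in> polys n" using a(1) polys.ideal_subset[OF Q1] by blast
  have asP: "x \<in> polys n" if x: "x \<in> set as" for x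
  proof -
    obtain i where "i < length as" "x = as ! i" using x by (auto simp: in_set_conv_nth)
    then show ?thesis
      using Cons.prems(3)[of "Suc i"] polys.ideal_subset[OF ideal[of "Suc (Suc i)"]] by auto
  qed
  define v where "v i = poly_value N (\<lambda>l. c (i # l)) as" for i
  have valP: "poly_value N c' bs \<in> polys n" if "\<And>l. c' l \<in> polys n" "set bs \<subseteq> polys n" for c' and bs :: "'k mpoly list"
    using that
  proof (induction bs arbitrary: c')
    case (Cons b bs)
    then show ?case by (auto intro!: polys.sum_mem polys_mult polys.power_mem)
  qed simp
  have vP: "v i \<in> polys n" for i
    unfolding v_def using asP Cons.prems(4) by (intro valP) auto
  have tail: "c (i # l) = 0" if v: "v i \<in> Q (Suc 0)" and l: "l \<in> exponent_lists (length as) N" for i l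
  proof (rule Cons.IH[where Q = "\<lambda>i. Q (Suc i)" and c = "\<lambda>l. c (i # l)"])
    show "poly_value N (\<lambda>l. c (i # l)) as \<in> Q (Suc 0)" using v by (simp add: v_def)
    show "primeideal (Q (Suc j)) (mpoly_ring n)" if "j \<le> length as" for j
      using Cons.prems(1)[of "Suc j"] that by simp
    show "Q (Suc j) \<subseteq> Q (Suc (Suc j))" if "j < length as" for j
      using Cons.prems(2)[of "Suc j"] that by simp
    show "as ! j \<in> Q (Suc (Suc j)) - Q (Suc j)" if "j < length as" for j
      using Cons.prems(3)[of "Suc j"] that by simp
    show "c (i # l) \<in> polys n" for l by (rule Cons.prems(4))
    show "c (i # l) = 0" if "c (i # l) \<in> Q (Suc (length as))" for l
      using Cons.prems(5)[of "i # l"] that by simp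
  qed (rule l)
  have zero: "v i = 0" if "v i \<in> Q (Suc 0)" for i
    unfolding v_def poly_value_eq_sum by (intro sum.neutral) (simp add: tail[OF that])
  have all: "v i \<in> Q (Suc 0)" if "i < N" for i
    using that
  proof (induction i rule: less_induct)
    case (less i)
    have "(\<Sum>j<N. a ^ j * v j) \<in> Q 0"
      using Cons.prems(6) by (simp add: v_def)
    also have "(\<Sum>j<N. a ^ j * v j) = (\<Sum>j\<in>{i..<N}. a ^ j * v j)"
    proof (rule sum.mono_neutral_right)
      show "\<forall>j\<in>{..<N} - {i..<N}. a ^ j * v j = 0"
        using less zero by auto
    qed auto
    also have "\<dots> = a ^ i * (\<Sum>j\<in>{i..<N}. a ^ (j - i) * v j)"
      unfolding sum_distrib_left by (intro sum.cong refl) (simp flip: mult.assoc power_add)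
    finally have in0: "a ^ i * (\<Sum>j\<in>{i..<N}. a ^ (j - i) * v j) \<in> Q 0" .
    have wP: "(\<Sum>j\<in>{i..<N}. a ^ (j - i) * v j) \<in> polys n"
      by (intro polys.sum_mem polys_mult polys.power_mem aP vP)
    have "a ^ s * w \<in> Q 0 \<Longrightarrow> w \<in> polys n \<Longrightarrow> w \<in> Q 0" for s and w :: "'k mpoly"
    proof (induction s)
      case (Suc s)
      have "a * (a ^ s * w) \<in> Q 0" using Suc.prems(1) by (simp add: mult.assoc)
      then have "a ^ s * w \<in> Q 0"
        using P.I_prime[of a "a ^ s * w"] a(2) aP Suc.prems(2) by (auto intro: polys_mult polys.power_mem)
      then show ?case using Suc by blast
    qed simp
    then have "(\<Sum>j\<in>{i..<N}. a ^ (j - i) * v j) \<in> Q (Suc 0)"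
      using in0 wP a(3) by blast
    moreover have "(\<Sum>j\<in>{i..<N}. a ^ (j - i) * v j) = v i + (\<Sum>j\<in>{Suc i..<N}. a ^ (j - i) * v j)"
      using less.prems by (simp add: sum.atLeast_Suc_lessThan)
    moreover have "(\<Sum>j\<in>{Suc i..<N}. a ^ (j - i) * v j) \<in> Q (Suc 0)"
    proof (rule polys.ideal_sum[OF Q1])
      fix j assume "j \<in> {Suc i..<N}"
      then have "j - i = Suc (j - Suc i)" by auto
      then have "a ^ (j - i) * v j = (a ^ (j - Suc i) * v j) * a"
        by (simp only: power_Suc mult_ac)
      moreover have "a ^ (j - Suc i) * v j \<in> polys n"
        by (intro polys_mult polys.power_mem aP vP)
      then have "(a ^ (j - Suc i) * v j) * a \<in> Q (Suc 0)"
        by (rule polys.ideal_mult[OF Q1 _ a(1)])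
      ultimately show "a ^ (j - i) * v j \<in> Q (Suc 0)" by (simp only:)
    qed
    ultimately show ?case
      using polys.ideal_diff[OF Q1] by fastforce
  qed
  obtain i l' where l: "l = i # l'" "i < N" "l' \<in> exponent_lists (length as) N"
    using Cons.prems(7) by (cases l) (auto simp: exponent_lists_def)
  then show ?case using tail all by blast
qed


lemma exponent_bound:
  assumes "finite S"
  shows "\<exists>d. \<forall>p\<in>S. \<forall>e\<in>Poly_Mapping.keys (p :: 'k::field mpoly). \<forall>i<n. lk e i \<le> d"
proof -
  let ?X = "\<Union>p\<in>S. \<Union>e\<in>Poly_Mapping.keys p. (\<lambda>i. lk e i) ` {..<n}"
  have "finite ?X" using assms by simp
  then have "\<forall>x\<in>?X. x \<le> Max ?X" by simp
  then show ?thesis by (intro exI[of _ "Max ?X"]) blast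
qed

text \<open>
  Bounding the degree in each variable separately makes the bound additive under products, and
  the number of monomials within it polynomial in \<open>D\<close>.
\<close>

definition box :: "nat \<Rightarrow> nat \<Rightarrow> 'k::field mpoly set" where
  "box n D = {p \<in> polys n. \<forall>e\<in>Poly_Mapping.keys p. \<forall>i<n. lk e i \<le> D}"

lemma box_one: "1 \<in> box n 0"
  by (auto simp: box_def)

lemma box_mult: "p \<in> box n D \<Longrightarrow> q \<in> box n D' \<Longrightarrow> p * q \<in> box n (D + D')"
  unfolding box_def
proof (intro CollectI conjI ballI allI impI)
  assume pq: "p \<in> {p \<in> polys n. \<forall>e\<in>Poly_Mapping.keys p. \<forall>i<n. lk e i \<le> D}"
    "q \<in> {p \<in> polys n. \<forall>e\<in>Poly_Mapping.keys p. \<forall>i<n. lk e i \<le> D'}"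
  then show "p * q \<in> polys n" by (auto intro: polys_mult)
  fix e i assume e: "e \<in> Poly_Mapping.keys (p * q)" and i: "i < n"
  obtain a b where "e = a + b" "a \<in> Poly_Mapping.keys p" "b \<in> Poly_Mapping.keys q"
    using keys_mult[of p q] e by blast
  then show "lk e i \<le> D + D'" using pq i by (auto simp: lookup_add intro!: add_mono)
qed

lemma box_mono: "D \<le> D' \<Longrightarrow> box n D \<subseteq> box n D'"
  by (fastforce simp: box_def)

lemma box_power: "p \<in> box n D \<Longrightarrow> p ^ k \<in> box n (k * D)"
  by (induction k) (auto simp: box_one intro: box_mult)

lemma box_power_product:
  assumes "set as \<subseteq> box n D" "l \<in> exponent_lists (length as) N"
  shows "prod_list (map2 (^) as l) \<in> box n (length as * (N * D))"
  using assms
proof (induction as arbitrary: l)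
  case Nil
  then show ?case by (simp add: box_one)
next
  case (Cons a as)
  then obtain i l' where l: "l = i # l'" "i < N" "l' \<in> exponent_lists (length as) N"
    by (cases l) (auto simp: exponent_lists_def)
  have "a ^ i \<in> box n (N * D)"
    using box_power[of a n D i] box_mono[of "i * D" "N * D" n] l(2) Cons.prems(1) by auto
  then show ?case
    using box_mult[OF _ Cons.IH[OF _ l(3)]] Cons.prems(1) by (simp add: l(1))
qed

lemma finite_box_exponents:
  "finite {e :: exponent. Poly_Mapping.keys e \<subseteq> {..<n} \<and> (\<forall>i<n. lk e i \<le> D)}" (is "finite ?E")
  and card_box_exponents:
  "card {e :: exponent. Poly_Mapping.keys e \<subseteq> {..<n} \<and> (\<forall>i<n. lk e i \<le> D)} \<le> Suc D ^ n"
proof -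
  let ?F = "{l :: nat list. set l \<subseteq> {..D} \<and> length l = n}"
  have inj: "inj_on (\<lambda>e. map (lk e) [0..<n]) ?E"
  proof (rule inj_onI)
    fix e e' :: exponent assume e: "e \<in> ?E" "e' \<in> ?E" "map (lk e) [0..<n] = map (lk e') [0..<n]"
    show "e = e'"
    proof (rule poly_mapping_eqI)
      fix i
      have "i \<notin> Poly_Mapping.keys e" "i \<notin> Poly_Mapping.keys e'" if "\<not> i < n"
        using e that by auto
      then show "lk e i = lk e' i"
        using e(3) by (cases "i < n") (auto simp: in_keys_iff)
    qed
  qed
  have sub: "(\<lambda>e. map (lk e) [0..<n]) ` ?E \<subseteq> ?F" by auto
  have fin: "finite ?F" by (rule finite_lists_length_eq) simp
  show "finite ?E" using finite_subset[OF sub fin] inj by (rule finite_imageD)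
  have "card ?E \<le> card ?F" using card_inj_on_le[OF inj sub fin] .
  then show "card ?E \<le> Suc D ^ n" by (simp add: card_lists_length_eq)
qed

text \<open>
  With exponents below \<open>N\<close>, the power products of \<open>r > n\<close> elements number \<open>N\<^sup>r\<close>, but all of them
  are combinations of only \<open>O(N\<^sup>n)\<close> monomials.
\<close>

lemma algebraically_dependent:
  fixes as :: "'k::field mpoly list"
  assumes as: "set as \<subseteq> polys n" "n < length as"
  shows "\<exists>N c. poly_value N (\<lambda>l. Poly_Mapping.single 0 (c l)) as = 0 \<and> (\<exists>l\<in>exponent_lists (length as) N. c l \<noteq> 0)"
proof -
  obtain d where d: "\<forall>p\<in>set as. \<forall>e\<in>Poly_Mapping.keys p. \<forall>i<n. lk e i \<le> d"
    using exponent_bound[of "set as" n] by auto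
  define r where "r = length as"
  \<comment> \<open>Chosen such that \<open>(N (r d + 1))\<^sup>n < N\<^bsup>n+1\<^esup>\<close>.\<close>
  define N where "N = Suc (Suc (r * d) ^ n)"
  define D where "D = r * (N * d)"
  define E where "E = {e :: exponent. Poly_Mapping.keys e \<subseteq> {..<n} \<and> (\<forall>i<n. lk e i \<le> D)}"
  have box: "prod_list (map2 (^) as l) \<in> box n D" if "l \<in> exponent_lists r N" for l
    using box_power_product[of as n d l N] as d that by (auto simp: r_def D_def box_def)
  have keys: "Poly_Mapping.keys (prod_list (map2 (^) as l)) \<subseteq> E" if "l \<in> exponent_lists r N" for l
    using box[OF that] by (auto simp: E_def box_def polys_def)
  have "card E \<le> Suc D ^ n"
    unfolding E_def by (rule card_box_exponents)
  also have "\<dots> \<le> (N * Suc (r * d)) ^ n"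
    by (intro power_mono) (simp_all add: D_def N_def algebra_simps)
  also have "\<dots> = N ^ n * Suc (r * d) ^ n" by (rule power_mult_distrib)
  also have "\<dots> < N ^ n * N" by (simp add: N_def)
  also have "\<dots> = N ^ Suc n" by simp
  also have "\<dots> \<le> N ^ r" using as(2) by (intro power_increasing) (simp_all add: N_def r_def)
  also have "\<dots> = card (exponent_lists r N)"
    unfolding exponent_lists_def by (subst card_lists_length_eq) auto
  finally have "card E < card (exponent_lists r N)" .
  moreover have "finite E" unfolding E_def by (rule finite_box_exponents)
  moreover have "finite (exponent_lists r N)"
    unfolding exponent_lists_def by (rule finite_lists_length_eq) simp
  ultimately obtain c where c: "\<exists>l\<in>exponent_lists r N. c l \<noteq> 0"
    "\<forall>e\<in>E. (\<Sum>l\<in>exponent_lists r N. c l * Poly_Mapping.lookup (prod_list (map2 (^) as l)) e) = 0"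
    using homogeneous_system_has_nonzero_solution[of E "exponent_lists r N" "\<lambda>l e. Poly_Mapping.lookup (prod_list (map2 (^) as l)) e"]
    by blast
  have "poly_value N (\<lambda>l. Poly_Mapping.single 0 (c l)) as = 0"
  proof (rule poly_mapping_eqI)
    fix e
    have "Poly_Mapping.lookup (poly_value N (\<lambda>l. Poly_Mapping.single 0 (c l)) as) e
        = (\<Sum>l\<in>exponent_lists r N. c l * Poly_Mapping.lookup (prod_list (map2 (^) as l)) e)"
      by (simp add: poly_value_eq_sum lookup_sum lookup_single_mult r_def)
    also have "\<dots> = 0"
    proof (cases "e \<in> E")
      case False
      then have "Poly_Mapping.lookup (prod_list (map2 (^) as l)) e = 0" if "l \<in> exponent_lists r N" for l
        using keys[OF that] by (auto simp: in_keys_iff)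
      then show ?thesis by simp
    qed (use c(2) in blast)
    finally show "Poly_Mapping.lookup (poly_value N (\<lambda>l. Poly_Mapping.single 0 (c l)) as) e = Poly_Mapping.lookup 0 e"
      by simp
  qed
  then show ?thesis using c(1) by (auto simp: r_def)
qed

lemma prime_chain_length_le:
  fixes Q :: "nat \<Rightarrow> 'k::field mpoly set"
  assumes prime: "\<And>i. i \<le> r \<Longrightarrow> primeideal (Q i) (mpoly_ring n)"
    and chain: "\<And>i. i < r \<Longrightarrow> Q i \<subset> Q (Suc i)"
  shows "r \<le> n"
proof (rule ccontr)
  assume "\<not> r \<le> n"
  have ideal: "polys.is_ideal n (Q i)" if "i \<le> r" for i
    using prime[OF that] by (simp add: primeideal_def ideal_mpoly_ring_iff)
  have "\<forall>i. \<exists>a. i < r \<longrightarrow> a \<in> Q (Suc i) - Q i" using chain by blast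
  then obtain a where a: "\<And>i. i < r \<Longrightarrow> a i \<in> Q (Suc i) - Q i" by metis
  define as where "as = map a [0..<r]"
  have len: "length as = r" by (simp add: as_def)
  have "a i \<in> polys n" if "i < r" for i
    using a[OF that] polys.ideal_subset[OF ideal[of "Suc i"]] that by auto
  then have "set as \<subseteq> polys n" by (auto simp: as_def)
  then obtain N and c :: "nat list \<Rightarrow> 'k" and l where c: "poly_value N (\<lambda>l. Poly_Mapping.single 0 (c l)) as = 0"
    "l \<in> exponent_lists r N" "c l \<noteq> 0"
    using algebraically_dependent[of as n] len \<open>\<not> r \<le> n\<close> by auto
  have "Poly_Mapping.single 0 (c l) = (0 :: 'k mpoly)"
  proof (rule poly_value_coefficients_vanish[where as = as and Q = Q and n = n and N = N and c = "\<lambda>l. Poly_Mapping.single 0 (c l)"])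
    show "Poly_Mapping.single 0 (c l) = (0 :: 'k mpoly)" if mem: "Poly_Mapping.single 0 (c l) \<in> Q (length as)" for l
    proof (rule ccontr)
      assume "Poly_Mapping.single 0 (c l) \<noteq> (0 :: 'k mpoly)"
      then have "c l \<noteq> 0" by auto
      interpret P: primeideal "Q r" "mpoly_ring n :: 'k mpoly ring" using prime by simp
      have "Poly_Mapping.single 0 (inverse (c l)) * Poly_Mapping.single 0 (c l) \<in> Q r"
        using mem len by (intro polys.ideal_mult[OF ideal] single_zero_in_polys) auto
      then have "\<one>\<^bsub>mpoly_ring n\<^esub> \<in> Q r"
        using \<open>c l \<noteq> 0\<close> by (simp add: mult_single)
      then show False using P.one_imp_carrier P.I_notcarr by blast
    qed
    show "poly_value N (\<lambda>l. Poly_Mapping.single 0 (c l)) as \<in> Q 0"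
      using c(1) polys.ideal_zero[OF ideal[of 0]] by simp
  qed (use len prime chain a c(2) single_zero_in_polys in \<open>auto simp: as_def\<close>)
  then show False using c(3) by (metis lookup_single_eq lookup_zero)
qed

text \<open>
  A prime chain that ends in \<open>(x\<^sub>b)\<^bsub>b\<in>B\<^esub>\<close> can be prolonged by adding the other variables one at a time,
  so the bound on the length of all prime chains bounds the height as well.
\<close>

lemma prime_height_variable_prime:
  assumes "B \<subseteq> {..<n}"
  shows "prime_height (mpoly_ring n) (variable_prime n B :: 'k::field mpoly set) \<le> enat (card B)"
  unfolding prime_height_def
proof (rule Sup_least, clarify)
  fix r and Q :: "nat \<Rightarrow> 'k mpoly set"
  assume Q: "\<forall>i\<le>r. primeideal (Q i) (mpoly_ring n)" "\<forall>i<r. Q i \<subset> Q (Suc i)" "Q r = variable_prime n B"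
  define s where "s = n - card B"
  have fin: "finite B" using assms finite_subset by blast
  have "card ({..<n} - B) = s" using assms fin by (simp add: s_def card_Diff_subset)
  then obtain g where g: "bij_betw g {..<s} ({..<n} - B)"
    using ex_bij_betw_nat_finite[of "{..<n} - B"] by (auto simp: lessThan_atLeast0)
  define Q' where "Q' i = (if i \<le> r then Q i else variable_prime n (B \<union> g ` {..<i - r}))" for i
  have Q'r: "Q' (r + i) = variable_prime n (B \<union> g ` {..<i})" for i
    using Q(3) by (cases "i = 0") (auto simp: Q'_def)
  have "r + s \<le> n"
  proof (rule prime_chain_length_le)
    show "primeideal (Q' i) (mpoly_ring n)" for i
      using Q(1) primeideal_variable_prime by (auto simp: Q'_def)
    fix i assume i: "i < r + s"
    show "Q' i \<subset> Q' (Suc i)"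
    proof (cases "i < r")
      case False
      define l where "l = i - r"
      have il: "i = r + l" "l < s" using i False by (auto simp: l_def)
      have "inj_on g {..<s}" "g ` {..<s} = {..<n} - B"
        using g by (auto simp: bij_betw_def)
      then have gl: "g l < n" "g l \<notin> B" "g l \<notin> g ` {..<l}"
        using il(2) inj_on_image_mem_iff[of g "{..<s}" l "{..<l}"] by auto
      have "variable (g l) \<in> (Q' (r + Suc l) :: 'k mpoly set)" "variable (g l) \<notin> (Q' (r + l) :: 'k mpoly set)"
        using gl unfolding Q'r by (auto simp: variable_in_variable_prime_iff)
      moreover have "Q' (r + l) \<subseteq> Q' (r + Suc l)"
        unfolding Q'r by (rule variable_prime_mono) auto
      ultimately show ?thesis by (auto simp: il(1))
    qed (use Q(2) in \<open>auto simp: Q'_def\<close>)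
  qed
  then have "r \<le> card B"
    using card_mono[OF _ assms] by (simp add: s_def)
  then show "enat r \<le> enat (card B)" by simp
qed

text \<open>
  The prime \<open>(x\<^sub>0, y\<^sub>0)\<close> has height at most two, and every prime over the ideal contains two distinct
  variables, the first of which generates a prime strictly between \<open>0\<close> and it.
\<close>

theorem ideal_height_example_ideal:
  assumes m: "2 \<le> m"
  shows "ideal_height (mpoly_ring (2 * m)) (example_ideal m :: 'k::field mpoly set) = 2"
proof (rule antisym)
  let ?R = "mpoly_ring (2 * m) :: 'k mpoly ring"
  let ?V = "variable_prime (2 * m) {0, m} :: 'k mpoly set"
  have "ideal_height ?R (example_ideal m) \<le> prime_height ?R ?V"
    unfolding ideal_height_def
    using example_ideal_subset_variable_prime[of 0 m] primeideal_variable_prime m by (intro Inf_lower imageI) auto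
  also have "\<dots> \<le> enat (card {0, m})"
    using m by (intro prime_height_variable_prime) auto
  also have "\<dots> = 2" using m by (simp add: numeral_eq_enat)
  finally show "ideal_height ?R (example_ideal m) \<le> 2" .
  show "2 \<le> ideal_height ?R (example_ideal m)"
    unfolding ideal_height_def
  proof (rule Inf_greatest, clarify)
    fix P :: "'k mpoly set" assume P: "primeideal P ?R" "example_ideal m \<subseteq> P"
    then obtain i j where ij: "i < m" "variable i \<in> P" "variable j \<in> P" "j = m + i \<or> (j < m \<and> j \<noteq> i)"
      using prime_over_example_ideal by blast
    have ne: "i \<noteq> j" "i < 2 * m" "j < 2 * m" using ij by auto
    have idP: "polys.is_ideal (2 * m) P" using P(1) by (simp add: primeideal_def ideal_mpoly_ring_iff)
    define Q where "Q l = (if l = 0 then variable_prime (2 * m) {} else if l = 1 then variable_prime (2 * m) {i} else P)" for l :: nat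
    have "variable_prime (2 * m) {} \<subset> (variable_prime (2 * m) {i} :: 'k mpoly set)"
      using variable_prime_mono[of "{}" "{i}" "2 * m"] variable_in_variable_prime_iff[OF ne(2), of "{i}"]
        variable_in_variable_prime_iff[OF ne(2), of "{}"] by blast
    moreover have "variable_prime (2 * m) {i} \<subset> P"
      using variable_prime_subset[OF idP, of "{i}"] ij(2,3) variable_in_variable_prime_iff[OF ne(3), of "{i}"] ne(1) by blast
    ultimately have "\<forall>l<2. Q l \<subset> Q (Suc l)" by (auto simp: Q_def less_2_cases_iff)
    moreover have "\<forall>l\<le>2. primeideal (Q l) ?R"
      using P(1) primeideal_variable_prime by (auto simp: Q_def)
    moreover have "Q 2 = P" by (simp add: Q_def)
    ultimately have "enat 2 \<le> prime_height ?R P"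
      unfolding prime_height_def by (intro Sup_upper) blast
    then show "2 \<le> prime_height ?R P" by (simp add: numeral_eq_enat)
  qed
qed

section \<open>The comparison of the depths\<close>

theorem theorem1p5:
  fixes k :: nat
  assumes "k \<ge> 2"
  shows "\<exists>(n :: nat) (I :: 'k::field mpoly set).
    squarefree_monomial_ideal n I \<and>
    ideal_height (mpoly_ring n) I = 2 \<and>
    depth (mpoly_ring n) (homogeneous_maximal_ideal n)
        (quotient_module (mpoly_ring n) (symbolic_power (mpoly_ring n) I k))
      < depth (mpoly_ring n) (homogeneous_maximal_ideal n)
        (quotient_module (mpoly_ring n) (ideal_power (mpoly_ring n) I k))"
proof (intro exI conjI)
  let ?I = "example_ideal (Suc k) :: 'k mpoly set"
  show "squarefree_monomial_ideal (2 * Suc k) ?I"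
    by (rule squarefree_example_ideal)
  show "ideal_height (mpoly_ring (2 * Suc k)) ?I = 2"
    using assms by (intro ideal_height_example_ideal) simp
  have "Suc (k - 1) = k" "1 \<le> k - 1" using assms by simp_all
  then have "depth (mpoly_ring (2 * Suc k)) (homogeneous_maximal_ideal (2 * Suc k))
      (quotient_module (mpoly_ring (2 * Suc k)) (symbolic_power (mpoly_ring (2 * Suc k)) ?I k)) < enat (Suc k)"
    using depth_symbolic_power_less[of "Suc k" "k - 1", where 'k = 'k] by simp
  also have "\<dots> \<le> depth (mpoly_ring (2 * Suc k)) (homogeneous_maximal_ideal (2 * Suc k))
      (quotient_module (mpoly_ring (2 * Suc k)) (ideal_power (mpoly_ring (2 * Suc k)) ?I k))"
    using assms by (intro depth_ideal_power_ge) simp_all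
  finally show "depth (mpoly_ring (2 * Suc k)) (homogeneous_maximal_ideal (2 * Suc k))
      (quotient_module (mpoly_ring (2 * Suc k)) (symbolic_power (mpoly_ring (2 * Suc k)) ?I k))
    < depth (mpoly_ring (2 * Suc k)) (homogeneous_maximal_ideal (2 * Suc k))
      (quotient_module (mpoly_ring (2 * Suc k)) (ideal_power (mpoly_ring (2 * Suc k)) ?I k))" .
qed

end
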